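(* Let $X(n)$ be the self-repelling random walk with directed edges on $\mathbb{Z}$ governed by the weight function $w$, as defined in the context. Let $s\in(0,\infty)$ be fixed and, for $A>0$, let $\theta_{s/A}$ be a random variable with geometric distribution $$\mathbf{P}(\theta_{s/A}=n)=(1-e^{-s/A})e^{-sn/A},\qquad n=0,1,2,\dots,$$ which is independent of the random walk $X(\cdot)$. Then, for almost all $x\in\mathbb{R}$ (with respect to Lebesgue measure), $$A^{1/2}\,\mathbf{P}\big(X(\theta_{s/A})=\lfloor A^{1/2}x\rfloor\big)\longrightarrow\hat\varphi(s,x)$$ as $A\to\infty$, where $$\hat\varphi(s,x)=s\int_0^\infty e^{-st}\,\frac{1}{2\sqrt t}\,\mathbf{1}\{|x|\le\sqrt t\}\,dt=\sqrt{s\pi}\,\big(1-F(\sqrt{2s}\,|x|)\big)$$ and $F(x)=\frac{1}{\sqrt{2\pi}}\int_{-\infty}^x e^{-y^2/2}\,dy$ is the standard normal distribution function.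
   Context: Notation: $\mathbb{Z}_+=\{0,1,2,\dots\}$. Weight function: $w:\mathbb{Z}\to(0,\infty)$ satisfies $w(z+1)\ge w(z)$ for all $z\in\mathbb{Z}$ and $\lim_{z\to\infty}(w(z)-w(-z))>0$ (i.e. $w$ is non-decreasing and non-constant). The walk: $X(n)$, $n\in\mathbb{Z}_+$, is a nearest neighbour random walk on $\mathbb{Z}$ with $X(0)=0$. Its local times on oriented edges are $$\ell^{\pm}(n,k)=\#\{0\le j\le n-1: X(j)=k,\ X(j+1)=k\pm1\},\qquad (n,k)\in\mathbb{Z}_+\times\mathbb{Z}.$$ With $\mathcal{F}_n$ the history of the walk up to time $n$, i.e. the $\sigma$-algebra generated by $X(0),\dots,X(n)$, the law of the walk is given by $$\mathbf{P}\big(X(n+1)=X(n)\pm1\mid\mathcal{F}_n\big)=\frac{w(\mp D_n)}{w(D_n)+w(-D_n)},\qquad D_n=\ell^+(n,X(n))-\ell^-(n,X(n)).$$ *)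

theory Defs
  imports "HOL-Probability.Probability"
begin

text \<open>For a non-decreasing \<open>w\<close> the limit always exists, possibly as \<open>\<infinity>\<close>; hence it is
  taken in the extended reals.\<close>

definition weight_function :: "(int \<Rightarrow> real) \<Rightarrow> bool" where
  "weight_function w \<longleftrightarrow>
     (\<forall>z. 0 < w z) \<and> (\<forall>z. w z \<le> w (z + 1)) \<and>
     (\<exists>L>0. ((\<lambda>z. ereal (w z - w (- z))) \<longlongrightarrow> L) at_top)"

definition local_time_plus :: "(nat \<Rightarrow> int) \<Rightarrow> nat \<Rightarrow> int \<Rightarrow> nat" where
  "local_time_plus p n k = card {j. j < n \<and> p j = k \<and> p (Suc j) = k + 1}"

definition local_time_minus :: "(nat \<Rightarrow> int) \<Rightarrow> nat \<Rightarrow> int \<Rightarrow> nat" where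
  "local_time_minus p n k = card {j. j < n \<and> p j = k \<and> p (Suc j) = k - 1}"

definition local_drift :: "(nat \<Rightarrow> int) \<Rightarrow> nat \<Rightarrow> int" where
  "local_drift p n = int (local_time_plus p n (p n)) - int (local_time_minus p n (p n))"

definition history :: "'a measure \<Rightarrow> (nat \<Rightarrow> 'a \<Rightarrow> int) \<Rightarrow> nat \<Rightarrow> 'a measure" where
  "history M X n = sigma (space M) {X j -` B \<inter> space M | j B. j \<le> n}"

text \<open>The starting point and the nearest neighbour property are required almost surely,
  as the walk is specified through its law. Since the \<open>X n\<close> are measurable, \<open>history M X n\<close>
  is a subalgebra of \<open>M\<close>, and the conditional expectations below are genuine ones.\<close>

locale self_repelling_walk = prob_space M
  for M :: "'a measure" and w :: "int \<Rightarrow> real" and X :: "nat \<Rightarrow> 'a \<Rightarrow> int" +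
  assumes weight: "weight_function w"
    and measurable_walk: "X n \<in> measurable M (count_space UNIV)"
    and start: "AE \<omega> in M. X 0 \<omega> = 0"
    and nearest_neighbour: "AE \<omega> in M. \<bar>X (Suc n) \<omega> - X n \<omega>\<bar> = 1"
    and step_right:
      "AE \<omega> in M. real_cond_exp M (history M X n)
           (indicat_real {\<omega> \<in> space M. X (Suc n) \<omega> = X n \<omega> + 1}) \<omega> =
         (let D = local_drift (\<lambda>j. X j \<omega>) n in w (- D) / (w D + w (- D)))"
    and step_left:
      "AE \<omega> in M. real_cond_exp M (history M X n)
           (indicat_real {\<omega> \<in> space M. X (Suc n) \<omega> = X n \<omega> - 1}) \<omega> =
         (let D = local_drift (\<lambda>j. X j \<omega>) n in w D / (w D + w (- D)))"

definition phi_hat :: "real \<Rightarrow> real \<Rightarrow> real" where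
  "phi_hat s x =
     s * (LBINT t:{0<..}. exp (- s * t) * (1 / (2 * sqrt t)) * indicat_real {t. \<bar>x\<bar> \<le> sqrt t} t)"

definition std_normal_cdf :: "real \<Rightarrow> real" where
  "std_normal_cdf x = (1 / sqrt (2 * pi)) * (LBINT y:{..x}. exp (- y\<^sup>2 / 2))"

lemma std_normal_cdf_eq_cdf: "std_normal_cdf = cdf std_normal_distribution"
proof
  fix x :: real
  have "cdf std_normal_distribution x = (LBINT y:{..x}. std_normal_density y)"
  proof -
    have "emeasure std_normal_distribution {..x} =
        (\<integral>\<^sup>+y. ennreal (indicator {..x} y *\<^sub>R std_normal_density y) \<partial>lborel)"
      by (subst emeasure_density) (auto intro!: nn_integral_cong split: split_indicator)
    also have "\<dots> = ennreal (LBINT y:{..x}. std_normal_density y)"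
      unfolding set_lebesgue_integral_def
    proof (rule nn_integral_eq_integral)
      show "integrable lborel (\<lambda>y. indicat_real {..x} y *\<^sub>R std_normal_density y)"
        by (rule integrable_mult_indicator) auto
    qed simp
    finally show ?thesis
      by (simp add: cdf_def2 measure_def set_lebesgue_integral_def integral_nonneg_AE)
  qed
  then show "std_normal_cdf x = cdf std_normal_distribution x"
    by (simp add: std_normal_cdf_def std_normal_density_def set_lebesgue_integral_def
        del: integral_mult_right_zero flip: integral_mult_right_zero)
qed

end

theory Submission
  imports Defs
begin

text \<open>At a fixed site \<open>k\<close> the walk turns up or down according to the difference \<open>D\<close> of its earlier up and
down exits from \<open>k\<close>, and to nothing else. So the exits from \<open>k\<close> follow a Markov chain of their own, and
the chains of different sites are independent. The joint law of the position \<open>X n\<close> and of all local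
times is therefore a product of one factor per site (\<open>state_law\<close>): a site to the left of the walk was
last left upwards, a site to its right was last left downwards, and the current site is unconstrained.

A nearest neighbour path crosses every edge alternately up and down. Hence the numbers of up and down
crossings of an edge differ by at most one, in a way determined by the end point, and the local times
seen from \<open>X n = k\<close> form two Markov chains, one to the right and one to the left of \<open>k\<close> (a Ray-Knight
description). Both move by the same kernel \<open>ups_law\<close>: if the walk left a site \<open>z\<close> times in one direction,
this kernel is the law of the number of exits in the other direction before the \<open>z\<close>-th one. Only between
\<open>0\<close> and \<open>k\<close> is one crossing added at each step. Since \<open>n\<close> is the sum of all local times, the Green
function \<open>\<Sum>n. exp (- \<beta> n) P (X n = k)\<close> becomes a sum of products of two discounted sums along these
chains (\<open>green_identity\<close>). It is all that matters here, because \<open>X\<close> at an independent geometric time has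
the law \<open>(1 - exp (- \<beta>)) * \<Sum>n. exp (- \<beta> n) P (X n = k)\<close> with \<open>\<beta> = s / A\<close>.

One step of the kernel changes \<open>z\<close> by \<open>- 1 / 2\<close> on average, with an error that vanishes as \<open>z\<close> grows, and
with fluctuations that have bounded exponential moments. The reason is that the difference \<open>D\<close>
observed after down exits has an explicit stationary law, symmetric about \<open>- 1 / 2\<close>, to which it converges
(\<open>edge_law_symmetric\<close>, \<open>iter_kernel_tendsto\<close>, \<open>ups_law_mean_tendsto\<close>). So on the scale \<open>\<beta> powr (- 1 / 2)\<close>
the chains are straight lines of slope \<open>- 1 / 2\<close>, or \<open>1 / 2\<close> where crossings are added, and the local times have a
deterministic triangular shape. The discounted sums are then close to the explicit Gaussian
\<open>gauss\<close>, which solves the one-step equation up to small errors: \<open>right_transform_close\<close> and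
\<open>left_transform_close\<close> turn this into uniform bounds by comparison with super- and subsolutions. The
sum in \<open>green_identity\<close> is a Riemann sum; \<open>right_transform_decay\<close> dominates it, and its limit is
\<open>\<integral>h>0. 2 * exp (- s * (2 * h + \<bar>x\<bar>)\<^sup>2)\<close>, which is \<open>phi_hat s x / s\<close>. Negative \<open>x\<close> reduce to nonnegative ones because
\<open>- X\<close> is a walk of the same kind.\<close>

section \<open>Exits from a single site\<close>

text \<open>At difference \<open>d\<close> a down exit has probability \<open>up_prob w (- d)\<close>.\<close>

definition up_prob :: "(int \<Rightarrow> real) \<Rightarrow> int \<Rightarrow> real" where
  "up_prob w d = w (- d) / (w d + w (- d))"

definition ups_before_down :: "(int \<Rightarrow> real) \<Rightarrow> int \<Rightarrow> nat pmf" where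
  "ups_before_down w x =
     embed_pmf (\<lambda>n. (\<Prod>i<n. up_prob w (x + int i)) * up_prob w (- (x + int n)))"

text \<open>The chain of the differences \<open>D\<close> observed right after each down exit.\<close>

definition down_kernel :: "(int \<Rightarrow> real) \<Rightarrow> int \<Rightarrow> int pmf" where
  "down_kernel w x = map_pmf (\<lambda>n. x + int n - 1) (ups_before_down w x)"

text \<open>The difference \<open>D\<close> is a reversible walk on the integers. Its conductance on the edge between \<open>d\<close> and
\<open>d + 1\<close> is, up to a constant, \<open>edge_weight w d\<close>. These weights are symmetric under \<open>d \<mapsto> - 1 - d\<close>; the
half with \<open>d \<ge> 0\<close> is indexed by natural numbers.\<close>

definition half_edge_weight :: "(int \<Rightarrow> real) \<Rightarrow> nat \<Rightarrow> real" where
  "half_edge_weight w n = (\<Prod>i<n. w (- int (Suc i)) / w (int (Suc i)))"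

definition edge_weight :: "(int \<Rightarrow> real) \<Rightarrow> int \<Rightarrow> real" where
  "edge_weight w d = half_edge_weight w (nat (max d (- 1 - d)))"

text \<open>A down exit that ends in \<open>d\<close> crosses the edge between \<open>d\<close> and \<open>d + 1\<close>. So the stationary law of \<open>D\<close>
after down exits is the law of a random edge, chosen proportionally to its conductance and labelled by its
lower end point.\<close>

definition edge_law :: "(int \<Rightarrow> real) \<Rightarrow> int pmf" where
  "edge_law w = embed_pmf (\<lambda>d. edge_weight w d / (2 * suminf (half_edge_weight w)))"

primrec iter_kernel :: "('a \<Rightarrow> 'a pmf) \<Rightarrow> nat \<Rightarrow> 'a \<Rightarrow> 'a pmf" where
  "iter_kernel K 0 x = return_pmf x"
| "iter_kernel K (Suc m) x = bind_pmf (iter_kernel K m x) K"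

lemma iter_kernel_Suc_left: "iter_kernel K (Suc m) x = bind_pmf (K x) (iter_kernel K m)"
proof (induction m)
  case 0
  show ?case by (simp add: bind_return_pmf bind_return_pmf')
next
  case (Suc m)
  have "iter_kernel K (Suc (Suc m)) x = bind_pmf (bind_pmf (K x) (iter_kernel K m)) K"
    using Suc by simp
  also have "\<dots> = bind_pmf (K x) (iter_kernel K (Suc m))"
    by (simp add: bind_assoc_pmf iter_kernel.simps(2)[abs_def])
  finally show ?case .
qed

lemma nn_integral_count_space_int:
  fixes f :: "int \<Rightarrow> ennreal"
  shows "(\<integral>\<^sup>+d. f d \<partial>count_space UNIV) =
    (\<integral>\<^sup>+n. f (int n) \<partial>count_space UNIV) + (\<integral>\<^sup>+n. f (- 1 - int n) \<partial>count_space UNIV)"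
proof -
  have 1: "(\<integral>\<^sup>+d. f d * indicator {0..} d \<partial>count_space UNIV) = (\<integral>\<^sup>+n. f (int n) \<partial>count_space UNIV)"
  proof -
    have "bij_betw int UNIV {0::int..}"
      by (rule bij_betwI[where g = nat]) auto
    from nn_integral_bij_count_space[OF this, of f] show ?thesis
      by (simp add: nn_integral_count_space_indicator)
  qed
  have 2: "(\<integral>\<^sup>+d. f d * indicator {..<0} d \<partial>count_space UNIV) = (\<integral>\<^sup>+n. f (- 1 - int n) \<partial>count_space UNIV)"
  proof -
    have "bij_betw (\<lambda>n. - 1 - int n) UNIV {..<0::int}"
      by (rule bij_betwI[where g = "\<lambda>d. nat (- 1 - d)"]) auto
    from nn_integral_bij_count_space[OF this, of f] show ?thesis
      by (simp add: nn_integral_count_space_indicator)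
  qed
  have "(\<integral>\<^sup>+d. f d \<partial>count_space UNIV) =
      (\<integral>\<^sup>+d. f d * indicator {0..} d + f d * indicator {..<0} d \<partial>count_space UNIV)"
    by (intro nn_integral_cong) (auto split: split_indicator)
  also have "\<dots> = (\<integral>\<^sup>+d. f d * indicator {0..} d \<partial>count_space UNIV)
      + (\<integral>\<^sup>+d. f d * indicator {..<0} d \<partial>count_space UNIV)"
    by (intro nn_integral_add) auto
  finally show ?thesis using 1 2 by simp
qed

locale repelling_weight =
  fixes w :: "int \<Rightarrow> real"
  assumes weight_function: "weight_function w"
begin

abbreviation "p \<equiv> up_prob w"

lemma w_pos: "0 < w z"
  using weight_function by (simp add: weight_function_def)

lemma w_mono: "a \<le> b \<Longrightarrow> w a \<le> w b"
proof (induction b rule: int_ge_induct)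
  case (step i)
  moreover have "w i \<le> w (i + 1)" using weight_function by (simp add: weight_function_def)
  ultimately show ?case by linarith
qed simp

lemma w_strict: "\<exists>N::nat. w (- int N) < w (int N)"
proof -
  obtain L where L: "L > 0" "((\<lambda>z. ereal (w z - w (- z))) \<longlongrightarrow> L) at_top"
    using weight_function by (auto simp: weight_function_def)
  then have "eventually (\<lambda>z. 0 < ereal (w z - w (- z))) at_top"
    by (rule order_tendstoD[rotated])
  then obtain N where "\<And>z. z \<ge> N \<Longrightarrow> 0 < ereal (w z - w (- z))"
    by (auto simp: eventually_at_top_linorder)
  from this[of "int (nat N)"] show ?thesis by (intro exI[of _ "nat N"]) auto
qed

lemma p_pos: "0 < p d" and p_less_1: "p d < 1"
  using w_pos[of d] w_pos[of "- d"] by (auto simp: up_prob_def field_simps)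

lemma p_nonneg [simp]: "0 \<le> p d" using p_pos[of d] by simp

lemma p_minus: "p (- d) = 1 - p d"
  using w_pos[of d] w_pos[of "- d"] by (auto simp: up_prob_def field_simps)

lemma p_le_half: "0 \<le> d \<Longrightarrow> p d \<le> 1 / 2"
  using w_pos[of d] w_pos[of "- d"] w_mono[of "- d" d] by (auto simp: up_prob_def field_simps)

text \<open>A run of up exits ends almost surely: as soon as the difference is nonnegative, each further up
exit has probability at most \<open>1 / 2\<close>.\<close>

lemma prod_p_tendsto_0: "(\<lambda>n. \<Prod>i<n. p (x + int i)) \<longlonglongrightarrow> 0"
proof -
  define N where "N = nat \<bar>x\<bar>"
  have bound: "(\<Prod>i<N + n. p (x + int i)) \<le> (1 / 2) ^ n" for n
  proof (induction n)
    case 0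
    show ?case by (auto intro!: prod_le_1 less_imp_le[OF p_less_1])
  next
    case (Suc n)
    have "p (x + int (N + n)) \<le> 1 / 2" by (rule p_le_half) (auto simp: N_def)
    then have "(\<Prod>i<N + n. p (x + int i)) * p (x + int (N + n)) \<le> (1 / 2) ^ n * (1 / 2)"
      using Suc by (intro mult_mono) auto
    then show ?case by simp
  qed
  have "(\<lambda>n. \<Prod>i<n + N. p (x + int i)) \<longlonglongrightarrow> 0"
  proof (rule tendsto_sandwich[of "\<lambda>_. 0"])
    show "(\<lambda>n. (1 / 2 :: real) ^ n) \<longlonglongrightarrow> 0" by (rule LIMSEQ_power_zero) simp
    show "\<forall>\<^sub>F n in sequentially. (\<Prod>i<n + N. p (x + int i)) \<le> (1 / 2) ^ n"
      using bound by (simp add: add.commute)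
    show "\<forall>\<^sub>F n in sequentially. 0 \<le> (\<Prod>i<n + N. p (x + int i))"
      by (intro always_eventually allI prod_nonneg) simp
  qed simp
  then show ?thesis by (rule LIMSEQ_offset)
qed

lemma ups_before_down_sums:
  "(\<lambda>n. (\<Prod>i<n. p (x + int i)) * p (- (x + int n))) sums 1"
proof -
  have "(\<lambda>n. (\<Prod>i<n. p (x + int i)) - (\<Prod>i<Suc n. p (x + int i))) sums
      ((\<Prod>i<0. p (x + int i)) - 0)"
    by (rule telescope_sums'[OF prod_p_tendsto_0])
  then show ?thesis
    unfolding p_minus by (simp add: algebra_simps)
qed

lemma pmf_ups_before_down:
  "pmf (ups_before_down w x) n = (\<Prod>i<n. p (x + int i)) * p (- (x + int n))"
  unfolding ups_before_down_def
proof (rule pmf_embed_pmf)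
  show nonneg: "0 \<le> (\<Prod>i<n. p (x + int i)) * p (- (x + int n))" for n
    by (auto intro!: prod_nonneg mult_nonneg_nonneg)
  show "(\<integral>\<^sup>+ n. ennreal ((\<Prod>i<n. p (x + int i)) * p (- (x + int n))) \<partial>count_space UNIV) = 1"
    using ups_before_down_sums[of x] nonneg
    by (simp add: nn_integral_count_space_nat suminf_ennreal2 sums_iff)
qed

lemma pmf_down_kernel:
  "pmf (down_kernel w x) y = (if x \<le> y + 1
     then (\<Prod>i<nat (y + 1 - x). p (x + int i)) * p (- (y + 1)) else 0)"
proof (cases "x \<le> y + 1")
  case True
  have "inj (\<lambda>n. x + int n - 1)" by (auto simp: inj_on_def)
  from pmf_map_inj'[OF this, of "ups_before_down w x" "nat (y + 1 - x)"] True
  show ?thesis by (simp add: down_kernel_def pmf_ups_before_down)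
next
  case False
  then show ?thesis
    unfolding down_kernel_def by (auto intro!: pmf_map_outside)
qed

text \<open>Decomposition according to the first exit.\<close>

lemma down_kernel_step:
  "pmf (down_kernel w x) y =
     (1 - p x) * indicator {x - 1} y + p x * pmf (down_kernel w (x + 1)) y"
proof -
  consider "y = x - 1" | "y < x - 1" | "x \<le> y" by linarith
  then show ?thesis
  proof cases
    case 3
    define n where "n = nat (y - x)"
    have n: "nat (y + 1 - x) = Suc n" "nat (y + 1 - (x + 1)) = n"
      using 3 by (auto simp: n_def)
    have "(\<Prod>i<Suc n. p (x + int i)) = p x * (\<Prod>i<n. p (x + 1 + int i))"
      by (subst prod.lessThan_Suc_shift) (simp add: algebra_simps)
    then show ?thesis using 3 by (simp add: pmf_down_kernel n del: prod.lessThan_Suc) (simp add: n_def)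
  qed (auto simp: pmf_down_kernel p_minus)
qed

lemma pmf_down_kernel_pos: "x \<le> y + 1 \<Longrightarrow> 0 < pmf (down_kernel w x) y"
  by (auto simp: pmf_down_kernel simp del: minus_add_distrib intro!: prod_pos p_pos mult_pos_pos)

lemma half_edge_weight_pos: "0 < half_edge_weight w n"
  unfolding half_edge_weight_def by (auto intro!: prod_pos divide_pos_pos w_pos)

lemma edge_weight_pos: "0 < edge_weight w d"
  by (simp add: edge_weight_def half_edge_weight_pos)

lemma half_edge_weight_Suc:
  "half_edge_weight w (Suc n) * w (int (Suc n)) = half_edge_weight w n * w (- int (Suc n))"
  using w_pos[of "int (Suc n)"] by (simp add: half_edge_weight_def)

text \<open>Detailed balance at the site \<open>d\<close> of the walk of differences, for its two adjacent edges.\<close>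

lemma edge_weight_balance: "edge_weight w d * w d = edge_weight w (d - 1) * w (- d)"
proof -
  consider n where "d = int (Suc n)" | "d = 0" | n where "d = - int (Suc n)"
    by (metis int_cases nat.exhaust of_nat_0)
  then show ?thesis
  proof cases
    case (1 n)
    have e: "nat (max d (-1-d)) = Suc n" "nat (max (d-1) (-1-(d-1))) = n" using 1 by auto
    show ?thesis using half_edge_weight_Suc[of n] unfolding edge_weight_def e
      by (simp add: 1 del: of_nat_Suc)
  next
    case 2
    then show ?thesis by (simp add: edge_weight_def)
  next
    case (3 n)
    have e: "nat (max d (-1-d)) = n" "nat (max (d-1) (-1-(d-1))) = Suc n" using 3 by auto
    show ?thesis using half_edge_weight_Suc[of n] unfolding edge_weight_def e
      by (simp add: 3 del: of_nat_Suc)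
  qed
qed

lemma edge_weight_p: "(1 - p d) * edge_weight w d = p d * edge_weight w (d - 1)"
proof -
  have "w d + w (- d) > 0" using w_pos[of d] w_pos[of "- d"] by simp
  then show ?thesis using edge_weight_balance[of d]
    by (simp add: up_prob_def field_simps)
qed

text \<open>The ratios of consecutive weights are nonincreasing and eventually below one, because \<open>w\<close> is
not constant.\<close>

lemma half_edge_weight_exp_summable:
  "\<exists>\<theta>>0. summable (\<lambda>n. half_edge_weight w n * exp (\<theta> * (real n + 1)))"
proof -
  obtain N where N: "w (- int N) < w (int N)" using w_strict by blast
  define \<rho> where "\<rho> = w (- int N) / w (int N)"
  have \<rho>: "0 < \<rho>" "\<rho> < 1" using N w_pos by (auto simp: \<rho>_def)
  define \<theta> where "\<theta> = - ln \<rho> / 2"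
  have \<theta>: "\<theta> > 0" using \<rho> by (simp add: \<theta>_def)
  have c: "\<rho> * exp \<theta> = exp (- \<theta>)"
  proof -
    have "\<rho> = exp (- 2 * \<theta>)" using \<rho> by (simp add: \<theta>_def)
    then show ?thesis by (simp flip: exp_add)
  qed
  have "summable (\<lambda>n. half_edge_weight w n * exp (\<theta> * (real n + 1)))"
  proof (rule summable_ratio_test[where c = "exp (- \<theta>)" and N = N])
    show "exp (- \<theta>) < 1" using \<theta> by simp
    fix n assume n: "N \<le> n"
    have ratio: "w (- int (Suc n)) / w (int (Suc n)) \<le> \<rho>"
      unfolding \<rho>_def using n w_pos by (intro frac_le w_mono) (auto intro: less_imp_le)
    then have *: "half_edge_weight w (Suc n) \<le> half_edge_weight w n * \<rho>"
      using mult_left_mono[OF ratio less_imp_le[OF half_edge_weight_pos[of n]]]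
      by (simp add: half_edge_weight_def del: of_nat_Suc)
    have e: "exp (\<theta> * (real (Suc n) + 1)) = exp (\<theta> * (real n + 1)) * exp \<theta>"
      by (subst exp_add[symmetric]) (simp add: algebra_simps)
    have "norm (half_edge_weight w (Suc n) * exp (\<theta> * (real (Suc n) + 1)))
        = half_edge_weight w (Suc n) * (exp (\<theta> * (real n + 1)) * exp \<theta>)"
      using half_edge_weight_pos[of "Suc n"] by (simp only: e norm_mult) simp
    also have "\<dots> \<le> (half_edge_weight w n * \<rho>) * (exp (\<theta> * (real n + 1)) * exp \<theta>)"
      by (intro mult_right_mono *) auto
    also have "\<dots> = (half_edge_weight w n * exp (\<theta> * (real n + 1))) * (\<rho> * exp \<theta>)"
      by (simp add: algebra_simps)
    also have "\<dots> = exp (- \<theta>) * norm (half_edge_weight w n * exp (\<theta> * (real n + 1)))"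
      using half_edge_weight_pos[of n] by (simp add: c abs_mult)
    finally show "norm (half_edge_weight w (Suc n) * exp (\<theta> * (real (Suc n) + 1)))
        \<le> exp (- \<theta>) * norm (half_edge_weight w n * exp (\<theta> * (real n + 1)))" .
  qed
  with \<theta> show ?thesis by blast
qed

lemma half_edge_weight_summable: "summable (half_edge_weight w)"
proof -
  obtain \<theta> where \<theta>: "\<theta> > 0" "summable (\<lambda>n. half_edge_weight w n * exp (\<theta> * (real n + 1)))"
    using half_edge_weight_exp_summable by blast
  show ?thesis
  proof (rule summable_comparison_test'[OF \<theta>(2), of 0])
    fix n :: nat
    have "1 \<le> exp (\<theta> * (real n + 1))" using \<theta> by simp
    then show "norm (half_edge_weight w n) \<le> half_edge_weight w n * exp (\<theta> * (real n + 1))"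
      using half_edge_weight_pos[of n] by (simp add: mult_le_cancel_left1)
  qed
qed

abbreviation "mass \<equiv> 2 * suminf (half_edge_weight w)"

lemma mass_pos: "0 < mass"
  using suminf_pos[OF half_edge_weight_summable] half_edge_weight_pos by auto

lemma nat_max_edge: "nat (max (int n) (- 1 - int n)) = n" "nat (max (- 1 - int n) (- 1 - (- 1 - int n))) = n"
  by auto

lemma pmf_edge_law: "pmf (edge_law w) d = edge_weight w d / mass"
  unfolding edge_law_def
proof (rule pmf_embed_pmf)
  show "0 \<le> edge_weight w d / mass" for d
    using edge_weight_pos[of d] mass_pos by simp
  have "(\<integral>\<^sup>+n. ennreal (half_edge_weight w n / mass) \<partial>count_space UNIV)
      = ennreal (suminf (half_edge_weight w) / mass)"
  proof -
    have "(\<lambda>n. half_edge_weight w n / mass) sums (suminf (half_edge_weight w) / mass)"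
      by (rule sums_divide[OF summable_sums[OF half_edge_weight_summable]])
    moreover have "\<And>n. 0 \<le> half_edge_weight w n / mass"
      using half_edge_weight_pos less_imp_le mass_pos by (metis divide_nonneg_nonneg)
    ultimately show ?thesis
      by (simp add: nn_integral_count_space_nat suminf_ennreal2 sums_iff)
  qed
  moreover have "suminf (half_edge_weight w) / mass = 1 / 2" using mass_pos by simp
  ultimately have "(\<integral>\<^sup>+n. ennreal (half_edge_weight w n / mass) \<partial>count_space UNIV) = ennreal (1 / 2)"
    by (simp only:)
  moreover have "ennreal (1 / 2) + ennreal (1 / 2) = 1"
    by (subst ennreal_plus[symmetric]) auto
  ultimately show "(\<integral>\<^sup>+ d. ennreal (edge_weight w d / mass) \<partial>count_space UNIV) = 1"
    unfolding nn_integral_count_space_int edge_weight_def nat_max_edge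
    by (simp only:)
qed

lemma edge_law_pos: "0 < pmf (edge_law w) d"
  using edge_weight_pos[of d] mass_pos by (simp add: pmf_edge_law)

lemma edge_law_p: "(1 - p d) * pmf (edge_law w) d = p d * pmf (edge_law w) (d - 1)"
  using edge_weight_p[of d] by (simp add: pmf_edge_law)

text \<open>Write \<open>\<pi>\<close> for the edge law and \<open>k x\<close> for the probability of a step of the chain from \<open>x\<close> to \<open>y\<close>.
Multiplying the first-exit decomposition of \<open>k x\<close> by \<open>\<pi> x + \<pi> (x - 1)\<close> and using detailed balance gives
\<open>\<pi> x * k x = \<pi> (x - 1) * [x - 1 = y] + \<pi> x * k (x + 1) - \<pi> (x - 1) * k x\<close>, where the last two
terms telescope over \<open>x\<close>.\<close>

lemma edge_law_subinvariant: "pmf (bind_pmf (edge_law w) (down_kernel w)) y \<le> pmf (edge_law w) y"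
proof -
  let ?k = "\<lambda>x. pmf (down_kernel w x) y" and ?\<pi> = "pmf (edge_law w)"
  have step: "?\<pi> x * ?k x = ?\<pi> (x - 1) * indicator {x - 1} y + ?\<pi> x * ?k (x + 1) - ?\<pi> (x - 1) * ?k x" for x
  proof -
    have "(?\<pi> x + ?\<pi> (x - 1)) * ?k x
        = (?\<pi> x + ?\<pi> (x - 1)) * (1 - p x) * indicator {x - 1} y
          + (?\<pi> x + ?\<pi> (x - 1)) * p x * ?k (x + 1)"
      by (subst down_kernel_step) (simp add: algebra_simps)
    also have "(?\<pi> x + ?\<pi> (x - 1)) * (1 - p x) = ?\<pi> (x - 1)"
      using edge_law_p[of x] by (simp add: algebra_simps)
    also have "(?\<pi> x + ?\<pi> (x - 1)) * p x = ?\<pi> x"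
      using edge_law_p[of x] by (simp add: algebra_simps)
    finally show ?thesis by (simp add: algebra_simps)
  qed
  have tele: "(\<Sum>i<n. ?\<pi> (y + 1 - int i) * ?k (y + 1 - int i))
      = (if n = 0 then 0 else ?\<pi> y) - ?\<pi> (y + 1 - int n) * ?k (y + 2 - int n)" for n
  proof (induction n)
    case 0
    show ?case by (simp add: pmf_down_kernel)
  next
    case (Suc n)
    have "y + 1 - int n - 1 = y + 1 - int (Suc n)" "y + 1 - int n + 1 = y + 2 - int n"
      "y + 2 - int (Suc n) = y + 1 - int n" by auto
    note st = step[of "y + 1 - int n", unfolded this(1,2)]
    show ?case
    proof (cases "n = 0")
      case True
      have "?k (y + 2) = 0" by (simp add: pmf_down_kernel)
      then show ?thesis using st True by (simp add: indicator_def add.commute)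
    next
      case False
      then have "indicator {y + 1 - int (Suc n)} y = (0 :: real)" by (simp add: indicator_def)
      then show ?thesis
        using st Suc False unfolding \<open>y + 2 - int (Suc n) = y + 1 - int n\<close> by (simp del: of_nat_Suc)
    qed
  qed
  have partial: "(\<Sum>i<n. ?\<pi> (y + 1 - int i) * ?k (y + 1 - int i)) \<le> ?\<pi> y" for n
  proof -
    define c where "c = ?\<pi> (y + 1 - int n) * ?k (y + 2 - int n)"
    have "0 \<le> c" "0 \<le> ?\<pi> y" by (auto simp: c_def)
    then have "(if n = 0 then 0 else b) - c \<le> b" if "b = ?\<pi> y" for b :: real
      using that by (simp add: field_simps)
    then show ?thesis unfolding tele c_def by blast
  qed
  have "ennreal (pmf (bind_pmf (edge_law w) (down_kernel w)) y) = (\<integral>\<^sup>+x. ennreal (?\<pi> x * ?k x) \<partial>count_space UNIV)"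
    by (simp add: ennreal_pmf_bind nn_integral_measure_pmf ennreal_mult)
  also have "\<dots> = (\<integral>\<^sup>+x. ennreal (?\<pi> x * ?k x) \<partial>count_space {..y + 1})"
    by (subst (2) nn_integral_count_space_indicator)
      (auto intro!: nn_integral_cong split: split_indicator simp: pmf_down_kernel)
  also have "\<dots> = (\<integral>\<^sup>+i. ennreal (?\<pi> (y + 1 - int i) * ?k (y + 1 - int i)) \<partial>count_space UNIV)"
  proof -
    have "bij_betw (\<lambda>i. y + 1 - int i) UNIV {..y + 1}"
      by (rule bij_betwI[where g = "\<lambda>x. nat (y + 1 - x)"]) auto
    from nn_integral_bij_count_space[OF this, of "\<lambda>x. ennreal (?\<pi> x * ?k x)"]
    show ?thesis by (rule sym)
  qed
  also have "\<dots> = (\<Sum>i. ennreal (?\<pi> (y + 1 - int i) * ?k (y + 1 - int i)))"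
    by (simp add: nn_integral_count_space_nat)
  also have "\<dots> \<le> ennreal (?\<pi> y)"
  proof (rule suminf_le_const[OF summableI])
    fix n
    have "(\<Sum>i<n. ennreal (?\<pi> (y + 1 - int i) * ?k (y + 1 - int i)))
        = ennreal (\<Sum>i<n. ?\<pi> (y + 1 - int i) * ?k (y + 1 - int i))"
      by (rule sum_ennreal) simp
    also have "\<dots> \<le> ennreal (?\<pi> y)" by (rule ennreal_leI[OF partial])
    finally show "(\<Sum>i<n. ennreal (?\<pi> (y + 1 - int i) * ?k (y + 1 - int i))) \<le> ennreal (?\<pi> y)" .
  qed
  finally show ?thesis by simp
qed

text \<open>Two probability laws, one of which is pointwise at most the other, are equal.\<close>

lemma edge_law_invariant: "bind_pmf (edge_law w) (down_kernel w) = edge_law w"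
  using pmf_neq_exists_less edge_law_subinvariant by (metis linorder_not_le)

text \<open>This symmetry is the source of the mean \<open>- 1 / 2\<close>, and so of the slope of the limiting local time
profile.\<close>

lemma edge_law_symmetric: "map_pmf (\<lambda>d. - 1 - d) (edge_law w) = edge_law w"
proof (rule pmf_eqI)
  fix d :: int
  have "inj (\<lambda>d. - 1 - d :: int)" by (auto simp: inj_on_def)
  from pmf_map_inj'[OF this, of "edge_law w" "- 1 - d"]
  show "pmf (map_pmf (\<lambda>d. - 1 - d) (edge_law w)) d = pmf (edge_law w) d"
    by (simp add: pmf_edge_law edge_weight_def max.commute)
qed

lemma edge_law_exp_moment:
  "\<exists>\<theta>>0. (\<integral>\<^sup>+d. ennreal (exp (\<theta> * \<bar>real_of_int d\<bar>)) \<partial>measure_pmf (edge_law w)) < \<infinity>"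
proof -
  obtain \<theta> where \<theta>: "\<theta> > 0" "summable (\<lambda>n. half_edge_weight w n * exp (\<theta> * (real n + 1)))"
    using half_edge_weight_exp_summable by blast
  define c where "c n = half_edge_weight w n / mass * exp (\<theta> * (real n + 1))" for n
  have c_nonneg: "0 \<le> c n" for n
    using half_edge_weight_pos[of n] mass_pos by (simp add: c_def)
  have "summable c"
    using summable_divide[OF \<theta>(2), of mass] unfolding c_def times_divide_eq_left .
  then have fin: "(\<integral>\<^sup>+n. ennreal (c n) \<partial>count_space UNIV) < \<infinity>"
    using c_nonneg by (simp add: nn_integral_count_space_nat suminf_ennreal2)
  have "(\<integral>\<^sup>+d. ennreal (exp (\<theta> * \<bar>real_of_int d\<bar>)) \<partial>measure_pmf (edge_law w))
      = (\<integral>\<^sup>+n. ennreal (half_edge_weight w n / mass) * ennreal (exp (\<theta> * real n)) \<partial>count_space UNIV)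
      + (\<integral>\<^sup>+n. ennreal (half_edge_weight w n / mass) * ennreal (exp (\<theta> * (real n + 1))) \<partial>count_space UNIV)"
    unfolding nn_integral_measure_pmf nn_integral_count_space_int pmf_edge_law edge_weight_def nat_max_edge
    by (simp add: abs_if algebra_simps)
  also have "\<dots> \<le> (\<integral>\<^sup>+n. ennreal (c n) \<partial>count_space UNIV) + (\<integral>\<^sup>+n. ennreal (c n) \<partial>count_space UNIV)"
    using \<theta>(1) half_edge_weight_pos mass_pos
    by (intro add_mono nn_integral_mono)
      (auto simp: c_def less_imp_le simp flip: ennreal_mult intro!: ennreal_leI mult_left_mono divide_right_mono)
  also have "\<dots> < \<infinity>" using fin by simp
  finally show ?thesis using \<theta>(1) by blast
qed

end

lemma integrable_pmf_bounded:
  fixes f :: "'a \<Rightarrow> real"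
  assumes "\<And>x. \<bar>f x\<bar> \<le> B"
  shows "integrable (measure_pmf p) f"
  by (rule measure_pmf.integrable_const_bound[where B = B]) (use assms in auto)

lemma expectation_bind_pmf:
  fixes f :: "'b \<Rightarrow> real"
  assumes "\<And>x. 0 \<le> f x" "\<And>x. f x \<le> B"
  shows "measure_pmf.expectation (bind_pmf p K) f =
    measure_pmf.expectation p (\<lambda>x. measure_pmf.expectation (K x) f)"
proof -
  have int: "integrable (measure_pmf q) f" for q
    by (rule integrable_pmf_bounded[of _ B]) (use assms in simp)
  have bd: "0 \<le> measure_pmf.expectation q f" "measure_pmf.expectation q f \<le> B" for q
    using assms int by (auto intro!: measure_pmf.integral_le_const)
  have int': "integrable (measure_pmf p) (\<lambda>x. measure_pmf.expectation (K x) f)"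
    by (rule integrable_pmf_bounded[of _ B]) (use bd in simp)
  have "ennreal (measure_pmf.expectation (bind_pmf p K) f) = (\<integral>\<^sup>+x. \<integral>\<^sup>+y. ennreal (f y) \<partial>K x \<partial>p)"
    using assms by (subst nn_integral_eq_integral[OF int, symmetric]) auto
  also have "\<dots> = (\<integral>\<^sup>+x. ennreal (measure_pmf.expectation (K x) f) \<partial>p)"
    using assms by (intro nn_integral_cong nn_integral_eq_integral[OF int]) auto
  also have "\<dots> = ennreal (measure_pmf.expectation p (\<lambda>x. measure_pmf.expectation (K x) f))"
    using bd by (intro nn_integral_eq_integral[OF int']) auto
  finally show ?thesis
    using bd by (simp add: integral_nonneg_AE)
qed

lemma pmf_times_le_expectation:
  fixes g :: "'a \<Rightarrow> real"
  assumes "\<And>x. 0 \<le> g x" "integrable (measure_pmf q) g"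
  shows "pmf q u * g u \<le> measure_pmf.expectation q g"
proof -
  have "pmf q u * g u = measure_pmf.expectation q (\<lambda>x. g u * indicator {u} x)"
    by (subst integral_measure_pmf[of "{u}"]) (auto simp: indicator_def)
  also have "\<dots> \<le> measure_pmf.expectation q g"
    using assms by (intro integral_mono)
      (auto intro!: integrable_pmf_bounded[of _ 1] split: split_indicator)
  finally show ?thesis .
qed

lemma iter_kernel_invariant:
  assumes "bind_pmf \<pi> K = \<pi>"
  shows "bind_pmf \<pi> (iter_kernel K m) = \<pi>"
proof (induction m)
  case 0
  show ?case by (simp add: bind_return_pmf' iter_kernel.simps(1)[abs_def])
next
  case (Suc m)
  then show ?case
    using assms by (simp add: iter_kernel.simps(2)[abs_def] flip: bind_assoc_pmf)
qed

text \<open>Starting from a point instead of the invariant law costs a bounded factor, uniformly in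
time. Hence moments of the invariant law bound the moments of the chain at all times.\<close>

lemma pmf_iter_kernel_le:
  assumes inv: "bind_pmf \<pi> K = \<pi>" and pos: "0 < pmf \<pi> x"
  shows "pmf (iter_kernel K m x) y \<le> pmf \<pi> y / pmf \<pi> x"
proof -
  have "pmf \<pi> x * pmf (iter_kernel K m x) y
      \<le> measure_pmf.expectation \<pi> (\<lambda>u. pmf (iter_kernel K m u) y)"
    by (rule pmf_times_le_expectation) (auto intro!: integrable_pmf_bounded[of _ 1] simp: pmf_le_1)
  also have "\<dots> = pmf \<pi> y"
    by (simp flip: pmf_bind add: iter_kernel_invariant[OF inv])
  finally show ?thesis using pos by (simp add: field_simps)
qed

text \<open>Convergence to equilibrium by an energy argument. Let \<open>\<phi> m x\<close> be the probability of \<open>y\<close> after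
\<open>m\<close> steps from \<open>x\<close>. Its second moment \<open>V m\<close> under \<open>\<pi>\<close> decreases in \<open>m\<close>, and the loss in one step is the
mean variance of \<open>\<phi> m\<close> over a step of the chain. So these variances tend to zero. As steps from \<open>x\<close> to \<open>x\<close>
and to \<open>x - 1\<close> have positive probability, neighbouring values of \<open>\<phi> m\<close> merge, and their common limit is
their mean \<open>pmf \<pi> y\<close>.\<close>

lemma iter_kernel_tendsto:
  fixes K :: "int \<Rightarrow> int pmf"
  assumes inv: "bind_pmf \<pi> K = \<pi>" and pos: "\<And>x. 0 < pmf \<pi> x"
    and stay: "\<And>x. 0 < pmf (K x) x" and down: "\<And>x. 0 < pmf (K x) (x - 1)"
  shows "(\<lambda>m. pmf (iter_kernel K m x) y) \<longlonglongrightarrow> pmf \<pi> y"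
proof -
  define \<phi> where "\<phi> m x = pmf (iter_kernel K m x) y" for m x
  have \<phi>: "0 \<le> \<phi> m x" "\<phi> m x \<le> 1" for m x by (auto simp: \<phi>_def pmf_le_1)
  then have \<phi>2: "0 \<le> (\<phi> m x)\<^sup>2" "(\<phi> m x)\<^sup>2 \<le> 1" for m x by (auto simp: power_le_one)
  have \<phi>_Suc: "\<phi> (Suc m) x = measure_pmf.expectation (K x) (\<phi> m)" for m x
    by (simp only: \<phi>_def[abs_def] iter_kernel_Suc_left pmf_bind)
  have int: "integrable (measure_pmf q) (\<phi> m)" "integrable (measure_pmf q) (\<lambda>u. (\<phi> m u)\<^sup>2)" for q m
    using \<phi> \<phi>2 by (auto intro!: integrable_pmf_bounded[of _ 1])
  \<comment> \<open>the energy of \<open>\<phi> m\<close>, and \<open>\<sigma> m x\<close> its variance over a step from \<open>x\<close>\<close>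
  define V where "V m = measure_pmf.expectation \<pi> (\<lambda>u. (\<phi> m u)\<^sup>2)" for m
  define \<sigma> where "\<sigma> m x = measure_pmf.expectation (K x) (\<lambda>u. (\<phi> m u)\<^sup>2) - (\<phi> (Suc m) x)\<^sup>2" for m x
  have \<sigma>_eq: "\<sigma> m x = measure_pmf.expectation (K x) (\<lambda>u. (\<phi> m u - \<phi> (Suc m) x)\<^sup>2)" for m x
  proof -
    have "measure_pmf.expectation (K x) (\<lambda>u. (\<phi> m u - \<phi> (Suc m) x)\<^sup>2)
        = measure_pmf.expectation (K x) (\<lambda>u. (\<phi> m u)\<^sup>2 - 2 * \<phi> (Suc m) x * \<phi> m u + (\<phi> (Suc m) x)\<^sup>2)"
      by (simp add: power2_diff algebra_simps)
    also have "\<dots> = measure_pmf.expectation (K x) (\<lambda>u. (\<phi> m u)\<^sup>2)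
        - 2 * \<phi> (Suc m) x * measure_pmf.expectation (K x) (\<phi> m) + (\<phi> (Suc m) x)\<^sup>2"
      using int by simp
    finally show ?thesis by (simp add: \<sigma>_def flip: \<phi>_Suc) (simp add: power2_eq_square)
  qed
  have sq_bd: "\<bar>(\<phi> m u - \<phi> (Suc m) x)\<^sup>2\<bar> \<le> 1" for m u x
    using \<phi>[of m u] \<phi>[of "Suc m" x] by (simp add: abs_square_le_1 abs_le_iff)
  have \<sigma>_ge: "pmf (K x) u * (\<phi> m u - \<phi> (Suc m) x)\<^sup>2 \<le> \<sigma> m x" for m u x
    unfolding \<sigma>_eq by (rule pmf_times_le_expectation) (auto intro!: integrable_pmf_bounded[of _ 1] sq_bd)
  have \<sigma>_nonneg: "0 \<le> \<sigma> m x" for m x unfolding \<sigma>_eq by simp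
  have E2_bd: "0 \<le> measure_pmf.expectation (K x) (\<lambda>u. (\<phi> m u)\<^sup>2)"
    "measure_pmf.expectation (K x) (\<lambda>u. (\<phi> m u)\<^sup>2) \<le> 1" for m x
    using \<phi>2 int by (auto intro!: measure_pmf.integral_le_const)
  have int\<sigma>: "integrable (measure_pmf \<pi>) (\<sigma> m)"
      "integrable (measure_pmf \<pi>) (\<lambda>x. measure_pmf.expectation (K x) (\<lambda>u. (\<phi> m u)\<^sup>2))" for m
  proof -
    have "\<bar>\<sigma> m x\<bar> \<le> 1" for x
      using E2_bd(2)[of x m] \<phi>2(1)[of "Suc m" x] \<sigma>_nonneg[of m x] unfolding \<sigma>_def by linarith
    then show "integrable (measure_pmf \<pi>) (\<sigma> m)" by (rule integrable_pmf_bounded)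
    show "integrable (measure_pmf \<pi>) (\<lambda>x. measure_pmf.expectation (K x) (\<lambda>u. (\<phi> m u)\<^sup>2))"
      by (rule integrable_pmf_bounded[of _ 1]) (use E2_bd in simp)
  qed
  have V_diff: "V m - V (Suc m) = measure_pmf.expectation \<pi> (\<sigma> m)" for m
  proof -
    have "V m = measure_pmf.expectation \<pi> (\<lambda>x. measure_pmf.expectation (K x) (\<lambda>u. (\<phi> m u)\<^sup>2))"
      unfolding V_def using \<phi>2 by (subst inv[symmetric], subst expectation_bind_pmf[of _ 1]) auto
    then show ?thesis using int int\<sigma>(2)[of m] by (simp add: \<sigma>_def[abs_def] V_def)
  qed
  have V_ge: "pmf \<pi> x * (pmf (K x) u * (\<phi> m u - \<phi> (Suc m) x)\<^sup>2) \<le> V m - V (Suc m)" for m x u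
  proof -
    have "pmf \<pi> x * (pmf (K x) u * (\<phi> m u - \<phi> (Suc m) x)\<^sup>2) \<le> pmf \<pi> x * \<sigma> m x"
      by (intro mult_left_mono \<sigma>_ge) auto
    also have "\<dots> \<le> V m - V (Suc m)"
      unfolding V_diff by (rule pmf_times_le_expectation) (auto intro: \<sigma>_nonneg int\<sigma>)
    finally show ?thesis .
  qed
  have V_lim: "(\<lambda>m. V m - V (Suc m)) \<longlonglongrightarrow> 0"
  proof -
    have "decseq V"
    proof (rule decseq_SucI)
      fix n
      have "0 \<le> V n - V (Suc n)" unfolding V_diff using \<sigma>_nonneg by simp
      then show "V (Suc n) \<le> V n" by simp
    qed
    moreover have "0 \<le> V m" for m unfolding V_def by simp
    ultimately obtain L where L: "V \<longlonglongrightarrow> L" by (metis decseq_convergent)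
    from tendsto_diff[OF L LIMSEQ_Suc[OF L]] show ?thesis by simp
  qed
  have near: "(\<lambda>m. \<phi> m u - \<phi> (Suc m) x) \<longlonglongrightarrow> 0" if u: "0 < pmf (K x) u" for x u
  proof -
    define c where "c = pmf \<pi> x * pmf (K x) u"
    have c: "c > 0" using u pos by (simp add: c_def)
    have "(\<lambda>m. (\<phi> m u - \<phi> (Suc m) x)\<^sup>2) \<longlonglongrightarrow> 0"
    proof (rule tendsto_sandwich[of "\<lambda>_. 0"])
      show "(\<lambda>m. (V m - V (Suc m)) / c) \<longlonglongrightarrow> 0" using tendsto_divide[OF V_lim tendsto_const[of c]] c by simp
      show "\<forall>\<^sub>F m in sequentially. (\<phi> m u - \<phi> (Suc m) x)\<^sup>2 \<le> (V m - V (Suc m)) / c"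
        using V_ge[of x u] c by (auto simp: field_simps c_def)
    qed auto
    from tendsto_real_sqrt[OF this] show ?thesis by (simp add: tendsto_rabs_zero_iff)
  qed
  have adj: "(\<lambda>m. \<phi> m x - \<phi> m (x - 1)) \<longlonglongrightarrow> 0" for x
    using tendsto_diff[OF near[OF stay[of x]] near[OF down[of x]]] by simp
  have near0: "(\<lambda>m. \<phi> m u - \<phi> m x) \<longlonglongrightarrow> 0" for u
  proof (induction u rule: int_induct[where k = x])
    case base
    show ?case by simp
  next
    case (step1 i)
    from tendsto_add[OF step1(2) adj[of "i + 1"]] show ?case by simp
  next
    case (step2 i)
    from tendsto_diff[OF step2(2) adj[of i]] show ?case by simp
  qed
  have "(\<lambda>m. measure_pmf.expectation \<pi> (\<lambda>u. \<phi> m u - \<phi> m x)) \<longlonglongrightarrow> measure_pmf.expectation \<pi> (\<lambda>u. 0)"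
  proof (rule integral_dominated_convergence[where w = "\<lambda>_. 1"])
    show "AE u in measure_pmf \<pi>. norm (\<phi> m u - \<phi> m x) \<le> 1" for m
      using \<phi>[of m x] \<phi>[of m] by (auto simp: abs_le_iff intro!: AE_I2) (smt (verit))+
  qed (use near0 in auto)
  moreover have "measure_pmf.expectation \<pi> (\<lambda>u. \<phi> m u - \<phi> m x) = pmf \<pi> y - \<phi> m x" for m
  proof -
    have "measure_pmf.expectation \<pi> (\<phi> m) = pmf (bind_pmf \<pi> (iter_kernel K m)) y"
      by (simp add: \<phi>_def[abs_def] pmf_bind)
    then show ?thesis using int(1)[of \<pi> m] by (simp add: iter_kernel_invariant[OF inv])
  qed
  ultimately have "(\<lambda>m. pmf \<pi> y - \<phi> m x) \<longlonglongrightarrow> 0" by simp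
  from tendsto_diff[OF tendsto_const[of "pmf \<pi> y"] this] show ?thesis by (simp add: \<phi>_def)
qed

lemma nn_integral_iter_kernel_le:
  assumes inv: "bind_pmf \<pi> K = \<pi>" and pos: "0 < pmf \<pi> x"
  shows "(\<integral>\<^sup>+y. f y \<partial>iter_kernel K m x) \<le> ennreal (1 / pmf \<pi> x) * (\<integral>\<^sup>+y. f y \<partial>\<pi>)"
proof -
  have "(\<integral>\<^sup>+y. f y \<partial>iter_kernel K m x) \<le> (\<integral>\<^sup>+y. ennreal (1 / pmf \<pi> x) * (ennreal (pmf \<pi> y) * f y) \<partial>count_space UNIV)"
    unfolding nn_integral_measure_pmf
    using pmf_iter_kernel_le[OF inv pos] pos
    by (intro nn_integral_mono)
      (auto simp flip: mult.assoc ennreal_mult intro!: mult_right_mono ennreal_leI)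
  also have "\<dots> = ennreal (1 / pmf \<pi> x) * (\<integral>\<^sup>+y. f y \<partial>\<pi>)"
    unfolding nn_integral_measure_pmf by (rule nn_integral_cmult) simp
  finally show ?thesis .
qed

text \<open>The law of the number of up exits before the \<open>z\<close>-th down exit, for a fresh site: after \<open>z\<close> down
exits the difference \<open>b\<close> corresponds to \<open>b + z\<close> up exits.\<close>

definition ups_law :: "(int \<Rightarrow> real) \<Rightarrow> nat \<Rightarrow> nat pmf" where
  "ups_law w z = map_pmf (\<lambda>b. nat (b + int z)) (iter_kernel (down_kernel w) z 0)"

text \<open>Deviation of the number of up exits from its asymptotic mean \<open>z - 1 / 2\<close>.\<close>

definition dev :: "nat \<Rightarrow> nat \<Rightarrow> real" where
  "dev z u = real u - real z + 1 / 2"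

context repelling_weight
begin

lemma iter_down_kernel_ge: "b \<in> set_pmf (iter_kernel (down_kernel w) z x) \<Longrightarrow> x - int z \<le> b"
proof (induction z arbitrary: b)
  case (Suc z)
  then obtain c where c: "c \<in> set_pmf (iter_kernel (down_kernel w) z x)" "b \<in> set_pmf (down_kernel w c)"
    by auto
  then have "c - 1 \<le> b" by (auto simp: down_kernel_def)
  then show ?case using Suc.IH[OF c(1)] by simp
qed simp

lemma nn_integral_ups_law_dev:
  "(\<integral>\<^sup>+u. ennreal (f (dev z u)) \<partial>ups_law w z)
     = (\<integral>\<^sup>+b. ennreal (f (real_of_int b + 1 / 2)) \<partial>iter_kernel (down_kernel w) z 0)"
  unfolding ups_law_def nn_integral_map_pmf
proof (rule nn_integral_cong_AE)
  show "AE b in iter_kernel (down_kernel w) z 0. ennreal (f (dev z (nat (b + int z)))) = ennreal (f (real_of_int b + 1 / 2))"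
    by (rule AE_pmfI) (auto dest!: iter_down_kernel_ge simp: dev_def)
qed

lemma expectation_ups_law_dev:
  "measure_pmf.expectation (ups_law w z) (\<lambda>u. f (dev z u))
     = measure_pmf.expectation (iter_kernel (down_kernel w) z 0) (\<lambda>b. f (real_of_int b + 1 / 2) :: real)"
  unfolding ups_law_def integral_map_pmf
proof (rule integral_cong_AE)
  show "AE b in iter_kernel (down_kernel w) z 0. f (dev z (nat (b + int z))) = f (real_of_int b + 1 / 2)"
    by (rule AE_pmfI) (auto dest!: iter_down_kernel_ge simp: dev_def)
qed auto

lemma ups_law_exp_moment:
  "\<exists>\<theta>>0. \<exists>C>0. \<forall>z. (\<integral>\<^sup>+u. ennreal (exp (\<theta> * \<bar>dev z u\<bar>)) \<partial>ups_law w z) \<le> ennreal C"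
proof -
  obtain \<theta> where \<theta>: "\<theta> > 0" "(\<integral>\<^sup>+d. ennreal (exp (\<theta> * \<bar>real_of_int d\<bar>)) \<partial>edge_law w) < \<infinity>"
    using edge_law_exp_moment by blast
  define S where "S = (\<integral>\<^sup>+d. ennreal (exp (\<theta> * \<bar>real_of_int d\<bar>)) \<partial>edge_law w)"
  define T where "T = ennreal (1 / pmf (edge_law w) 0) * (ennreal (exp \<theta>) * S)"
  have T: "T < \<infinity>" using \<theta>(2) unfolding T_def S_def by (simp add: ennreal_mult_less_top)
  have "(\<integral>\<^sup>+u. ennreal (exp (\<theta> * \<bar>dev z u\<bar>)) \<partial>ups_law w z) \<le> T" for z
  proof -
    have "(\<integral>\<^sup>+u. ennreal (exp (\<theta> * \<bar>dev z u\<bar>)) \<partial>ups_law w z)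
        = (\<integral>\<^sup>+b. ennreal (exp (\<theta> * \<bar>real_of_int b + 1 / 2\<bar>)) \<partial>iter_kernel (down_kernel w) z 0)"
      by (rule nn_integral_ups_law_dev)
    also have "\<dots> \<le> ennreal (1 / pmf (edge_law w) 0) * (\<integral>\<^sup>+b. ennreal (exp (\<theta> * \<bar>real_of_int b + 1 / 2\<bar>)) \<partial>edge_law w)"
      by (rule nn_integral_iter_kernel_le[OF edge_law_invariant edge_law_pos])
    also have "(\<integral>\<^sup>+b. ennreal (exp (\<theta> * \<bar>real_of_int b + 1 / 2\<bar>)) \<partial>edge_law w)
        \<le> (\<integral>\<^sup>+b. ennreal (exp \<theta>) * ennreal (exp (\<theta> * \<bar>real_of_int b\<bar>)) \<partial>edge_law w)"
    proof (intro nn_integral_mono)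
      fix b :: int
      have "\<theta> * \<bar>real_of_int b + 1 / 2\<bar> \<le> \<theta> * (1 + \<bar>real_of_int b\<bar>)"
        using \<theta>(1) by (intro mult_left_mono) auto
      then show "ennreal (exp (\<theta> * \<bar>real_of_int b + 1 / 2\<bar>)) \<le> ennreal (exp \<theta>) * ennreal (exp (\<theta> * \<bar>real_of_int b\<bar>))"
        by (simp add: algebra_simps flip: ennreal_mult exp_add)
    qed
    also have "\<dots> = ennreal (exp \<theta>) * S"
      unfolding S_def by (rule nn_integral_cmult) simp
    finally show ?thesis by (simp add: T_def mult_left_mono)
  qed
  moreover obtain C where "0 \<le> C" "T = ennreal C" using T by (cases T) auto
  moreover have "ennreal C \<le> ennreal (C + 1)" by (rule ennreal_leI) simp
  ultimately have "(\<integral>\<^sup>+u. ennreal (exp (\<theta> * \<bar>dev z u\<bar>)) \<partial>ups_law w z) \<le> ennreal (C + 1)" for z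
    by (metis order_trans)
  moreover have "0 < C + 1" using \<open>0 \<le> C\<close> by simp
  ultimately show ?thesis using \<theta>(1) by blast
qed

text \<open>The difference after \<open>z\<close> down exits converges to the edge law, whose mean is \<open>- 1 / 2\<close>; the
bound \<open>pmf_iter_kernel_le\<close> dominates the expectations.\<close>

lemma ups_law_mean_tendsto:
  "(\<lambda>z. measure_pmf.expectation (ups_law w z) (dev z)) \<longlonglongrightarrow> 0"
proof -
  let ?\<pi> = "edge_law w" and ?B = "\<lambda>z. iter_kernel (down_kernel w) z 0"
  obtain \<theta> where \<theta>: "\<theta> > 0" "(\<integral>\<^sup>+d. ennreal (exp (\<theta> * \<bar>real_of_int d\<bar>)) \<partial>edge_law w) < \<infinity>"
    using edge_law_exp_moment by blast
  have int_exp: "integrable ?\<pi> (\<lambda>d. exp (\<theta> * \<bar>real_of_int d\<bar>))"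
    using \<theta>(2) by (intro integrableI_bounded) auto
  have int_id: "integrable ?\<pi> real_of_int"
  proof (rule Bochner_Integration.integrable_bound[OF integrable_divide[OF int_exp, of \<theta>]])
    show "AE d in ?\<pi>. norm (real_of_int d) \<le> norm (exp (\<theta> * \<bar>real_of_int d\<bar>) / \<theta>)"
    proof (rule AE_I2)
      fix d
      have "\<theta> * \<bar>real_of_int d\<bar> \<le> exp (\<theta> * \<bar>real_of_int d\<bar>)"
        using exp_ge_add_one_self[of "\<theta> * \<bar>real_of_int d\<bar>"] by linarith
      then show "norm (real_of_int d) \<le> norm (exp (\<theta> * \<bar>real_of_int d\<bar>) / \<theta>)"
        using \<theta>(1) by (simp add: field_simps)
    qed
  qed simp
  then have int_dev: "integrable ?\<pi> (\<lambda>d. real_of_int d + 1 / 2)" by simp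
  have mean: "measure_pmf.expectation ?\<pi> (\<lambda>d. real_of_int d + 1 / 2) = 0"
  proof -
    have "measure_pmf.expectation ?\<pi> (\<lambda>d. real_of_int d + 1 / 2)
        = measure_pmf.expectation ?\<pi> (\<lambda>d. - (real_of_int d + 1 / 2))"
      by (subst edge_law_symmetric[symmetric]) (simp add: algebra_simps)
    also have "\<dots> = - measure_pmf.expectation ?\<pi> (\<lambda>d. real_of_int d + 1 / 2)"
      by (rule Bochner_Integration.integral_minus)
    finally show ?thesis by simp
  qed
  have to_count: "measure_pmf.expectation q f = (\<integral>d. pmf q d * f d \<partial>count_space UNIV)" for q :: "int pmf" and f :: "int \<Rightarrow> real"
    unfolding measure_pmf_eq_density by (simp add: integral_density)
  have "(\<lambda>z. \<integral>d. pmf (?B z) d * (real_of_int d + 1 / 2) \<partial>count_space UNIV)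
      \<longlonglongrightarrow> (\<integral>d. pmf ?\<pi> d * (real_of_int d + 1 / 2) \<partial>count_space UNIV)"
  proof (rule integral_dominated_convergence[where w = "\<lambda>d. pmf ?\<pi> d * \<bar>real_of_int d + 1 / 2\<bar> / pmf ?\<pi> 0"])
    have "integrable ?\<pi> (\<lambda>d. \<bar>real_of_int d + 1 / 2\<bar>)" using int_dev by (rule integrable_abs)
    then have "integrable (count_space UNIV) (\<lambda>d. pmf ?\<pi> d * \<bar>real_of_int d + 1 / 2\<bar>)"
      unfolding measure_pmf_eq_density by (subst (asm) integrable_density) auto
    then show "integrable (count_space UNIV) (\<lambda>d. pmf ?\<pi> d * \<bar>real_of_int d + 1 / 2\<bar> / pmf ?\<pi> 0)"
      by (rule integrable_divide)
    show "AE d in count_space UNIV. norm (pmf (?B z) d * (real_of_int d + 1 / 2))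
        \<le> pmf ?\<pi> d * \<bar>real_of_int d + 1 / 2\<bar> / pmf ?\<pi> 0" for z
    proof (rule AE_I2)
      fix d
      have "pmf (?B z) d * \<bar>real_of_int d + 1 / 2\<bar> \<le> (pmf ?\<pi> d / pmf ?\<pi> 0) * \<bar>real_of_int d + 1 / 2\<bar>"
        by (intro mult_right_mono pmf_iter_kernel_le edge_law_invariant edge_law_pos) auto
      then show "norm (pmf (?B z) d * (real_of_int d + 1 / 2)) \<le> pmf ?\<pi> d * \<bar>real_of_int d + 1 / 2\<bar> / pmf ?\<pi> 0"
        by (simp add: abs_mult)
    qed
    show "AE d in count_space UNIV. (\<lambda>z. pmf (?B z) d * (real_of_int d + 1 / 2)) \<longlonglongrightarrow> pmf ?\<pi> d * (real_of_int d + 1 / 2)"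
      by (intro AE_I2 tendsto_mult tendsto_const iter_kernel_tendsto edge_law_invariant edge_law_pos pmf_down_kernel_pos) auto
  qed auto
  then have "(\<lambda>z. measure_pmf.expectation (?B z) (\<lambda>d. real_of_int d + 1 / 2)) \<longlonglongrightarrow> 0"
    using mean by (simp add: to_count)
  then show ?thesis
    using expectation_ups_law_dev[of _ "\<lambda>x. x"] by simp
qed

lemma ups_law_0: "ups_law w 0 = return_pmf 0"
  by (simp add: ups_law_def)

lemma ups_law_pos_0: "0 < pmf (ups_law w z) 0"
proof -
  have "- int z \<in> set_pmf (iter_kernel (down_kernel w) z 0)"
  proof (induction z)
    case (Suc z)
    have "- int (Suc z) \<in> set_pmf (down_kernel w (- int z))"
      using pmf_down_kernel_pos[of "- int z" "- int (Suc z)"] by (simp add: set_pmf_iff)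
    then show ?case using Suc by auto
  qed simp
  then have "0 \<in> set_pmf (ups_law w z)" unfolding ups_law_def by (force simp: image_iff)
  then show ?thesis by (rule pmf_positive)
qed

end

section \<open>Discounted sums along a balanced chain\<close>

text \<open>For a chain with values \<open>c 0 = z\<close>, \<open>c 1\<close>, ... that moves by \<open>Q\<close>, after an increase by one in each of the first
\<open>k\<close> steps, this is the expectation of \<open>exp (- \<beta> * \<Sum>i<m. 2 * c i + [i < k])\<close> on the event that the
chain is at \<open>0\<close> after \<open>m\<close> steps. The exponent counts the crossings of \<open>m\<close> consecutive edges:
\<open>c i\<close> one way and \<open>c i + [i < k]\<close> the other way.\<close>

primrec chain_transform :: "(nat \<Rightarrow> nat pmf) \<Rightarrow> real \<Rightarrow> nat \<Rightarrow> nat \<Rightarrow> nat \<Rightarrow> real" where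
  "chain_transform Q \<beta> 0 k z = of_bool (z = 0)"
| "chain_transform Q \<beta> (Suc m) k z =
     exp (- \<beta> * (2 * real z + of_bool (0 < k))) *
     measure_pmf.expectation (Q (z + of_bool (0 < k))) (chain_transform Q \<beta> m (k - 1))"

text \<open>Once the increases are over, \<open>0\<close> is absorbing, and the truncated transforms increase with \<open>m\<close>;
the index \<open>m + k\<close> starts after the last increase.\<close>

definition full_transform :: "(nat \<Rightarrow> nat pmf) \<Rightarrow> real \<Rightarrow> nat \<Rightarrow> nat \<Rightarrow> real" where
  "full_transform Q \<beta> k z = lim (\<lambda>m. chain_transform Q \<beta> (m + k) k z)"

text \<open>The discount collected by the deterministic chain that grows by \<open>1 / 2\<close> in each of the first \<open>j\<close> steps
and decreases by \<open>1 / 2\<close> afterwards until it reaches \<open>0\<close>, up to lower order terms in the exponent.\<close>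

definition gauss :: "real \<Rightarrow> real \<Rightarrow> real \<Rightarrow> real" where
  "gauss \<beta> j y = exp (- \<beta> * (2 * y\<^sup>2 + 4 * y * j + j\<^sup>2))"

lemma sq_le_exp: "0 \<le> y \<Longrightarrow> y\<^sup>2 \<le> 4 * exp (y::real)"
proof -
  assume y: "0 \<le> y"
  have "y / 2 \<le> exp (y / 2)" using exp_ge_add_one_self[of "y / 2"] by linarith
  then have "(y / 2)\<^sup>2 \<le> (exp (y / 2))\<^sup>2" using y by (intro power_mono) auto
  also have "\<dots> = exp y" by (simp flip: exp_double)
  finally show ?thesis by (simp add: power_divide)
qed

lemma exp_le_convex: "0 \<le> r \<Longrightarrow> r \<le> 1 \<Longrightarrow> exp (r * a) \<le> 1 + r * exp (a::real)"
proof -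
  assume r: "0 \<le> r" "r \<le> 1"
  have "exp ((1 - r) *\<^sub>R 0 + r *\<^sub>R a) \<le> (1 - r) * exp 0 + r * exp a"
    using convex_onD[OF exp_convex, of r 0 a] r by simp
  then show ?thesis using r by simp
qed

lemma exp_le_quadratic: "exp x \<le> 1 + x + x\<^sup>2 * exp \<bar>x :: real\<bar>"
proof -
  let ?S = "{- \<bar>x\<bar>..\<bar>x\<bar>}"
  have "norm (exp x - (\<Sum>i\<le>1. exp 0 * (x - 0) ^ i / fact i)) \<le> exp \<bar>x\<bar> * norm (x - 0) ^ (Suc 1) / fact 1"
    by (rule field_Taylor[where S = ?S and f = "\<lambda>_. exp"]) (auto intro!: derivative_eq_intros)
  then show ?thesis by (simp add: power2_eq_square abs_le_iff algebra_simps)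
qed

text \<open>The properties of \<open>ups_law\<close> from which the Gaussian limit follows.\<close>

locale balanced_kernel =
  fixes Q :: "nat \<Rightarrow> nat pmf" and \<theta>\<^sub>0 C\<^sub>0 :: real
  assumes Q_0: "Q 0 = return_pmf 0"
    and \<theta>\<^sub>0_pos: "0 < \<theta>\<^sub>0" and C\<^sub>0_pos: "0 < C\<^sub>0"
    and exp_moment: "\<And>z. (\<integral>\<^sup>+u. ennreal (exp (\<theta>\<^sub>0 * \<bar>dev z u\<bar>)) \<partial>Q z) \<le> ennreal C\<^sub>0"
    and mean_tendsto: "(\<lambda>z. measure_pmf.expectation (Q z) (dev z)) \<longlonglongrightarrow> 0"
    and Q_pos_0: "\<And>z. 0 < pmf (Q z) 0"
begin

abbreviation "E z \<equiv> measure_pmf.expectation (Q z)"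

definition "bias z = E z (dev z)"

definition "V = 4 * C\<^sub>0 / \<theta>\<^sub>0\<^sup>2"

lemma V_pos: "0 < V" using \<theta>\<^sub>0_pos C\<^sub>0_pos by (simp add: V_def)

lemma integrable_exp: "integrable (Q z) (\<lambda>u. exp (\<theta>\<^sub>0 * \<bar>dev z u\<bar>))"
  using exp_moment[of z] by (intro integrableI_bounded) (auto intro: le_less_trans)

lemma expectation_exp_le: "E z (\<lambda>u. exp (\<theta>\<^sub>0 * \<bar>dev z u\<bar>)) \<le> C\<^sub>0"
proof -
  have "ennreal (E z (\<lambda>u. exp (\<theta>\<^sub>0 * \<bar>dev z u\<bar>))) \<le> ennreal C\<^sub>0"
    using exp_moment[of z] nn_integral_eq_integral[OF integrable_exp[of z]] by simp
  then show ?thesis using C\<^sub>0_pos by (simp add: ennreal_le_iff)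
qed

text \<open>All moments needed below come from the exponential moment through this bound.\<close>

lemma dominated_by_exp:
  assumes "\<And>u. \<bar>f u\<bar> \<le> c * exp (\<theta>\<^sub>0 * \<bar>dev z u\<bar>)"
  shows "integrable (Q z) f" "\<bar>E z f\<bar> \<le> c * C\<^sub>0"
proof -
  have c: "0 \<le> c"
    using order_trans[OF abs_ge_zero assms[of 0]] by (simp add: zero_le_mult_iff)
  show int: "integrable (Q z) f"
    by (rule Bochner_Integration.integrable_bound[OF integrable_mult_right[OF integrable_exp[of z], of c]])
      (use assms in \<open>auto intro!: AE_I2 order_trans[OF assms]\<close>)
  have "\<bar>E z f\<bar> \<le> E z (\<lambda>u. \<bar>f u\<bar>)" by (rule integral_abs_bound)
  also have "\<dots> \<le> E z (\<lambda>u. c * exp (\<theta>\<^sub>0 * \<bar>dev z u\<bar>))"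
    using int assms integrable_exp by (intro integral_mono) auto
  also have "\<dots> \<le> c * C\<^sub>0" using expectation_exp_le[of z] c by (simp add: mult_left_mono)
  finally show "\<bar>E z f\<bar> \<le> c * C\<^sub>0" .
qed

lemma sq_dev_le: "(dev z u)\<^sup>2 \<le> 4 / \<theta>\<^sub>0\<^sup>2 * exp (\<theta>\<^sub>0 * \<bar>dev z u\<bar>)"
  using sq_le_exp[of "\<theta>\<^sub>0 * \<bar>dev z u\<bar>"] \<theta>\<^sub>0_pos by (simp add: power_mult_distrib field_simps)

lemma sq_dev: "integrable (Q z) (\<lambda>u. (dev z u)\<^sup>2)" "E z (\<lambda>u. (dev z u)\<^sup>2) \<le> V"
  using dominated_by_exp[of "\<lambda>u. (dev z u)\<^sup>2" "4 / \<theta>\<^sub>0\<^sup>2" z] sq_dev_le by (auto simp: V_def)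

lemma dev_le: "\<bar>dev z u\<bar> \<le> 1 / \<theta>\<^sub>0 * exp (\<theta>\<^sub>0 * \<bar>dev z u\<bar>)"
proof -
  have "\<theta>\<^sub>0 * \<bar>dev z u\<bar> \<le> exp (\<theta>\<^sub>0 * \<bar>dev z u\<bar>)"
    using exp_ge_add_one_self[of "\<theta>\<^sub>0 * \<bar>dev z u\<bar>"] by linarith
  then show ?thesis using \<theta>\<^sub>0_pos by (simp add: field_simps)
qed

lemma integrable_dev: "integrable (Q z) (dev z)" and bias_le: "\<bar>bias z\<bar> \<le> C\<^sub>0 / \<theta>\<^sub>0"
  using dominated_by_exp[of "dev z" "1 / \<theta>\<^sub>0" z] dev_le by (auto simp: bias_def)

lemma bias_tendsto: "bias \<longlonglongrightarrow> 0"
  using mean_tendsto by (simp add: bias_def[abs_def])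

lemma bias_small: "0 < e \<Longrightarrow> \<exists>M. \<forall>z\<ge>M. \<bar>bias z\<bar> \<le> e"
  using LIMSEQ_D[OF bias_tendsto, of e] by (auto intro: less_imp_le)

abbreviation "tw \<equiv> chain_transform Q"
abbreviation "lw \<equiv> full_transform Q"

lemma tw_bounds: "0 \<le> \<beta> \<Longrightarrow> 0 \<le> tw \<beta> m k z \<and> tw \<beta> m k z \<le> 1"
proof (induction m arbitrary: k z)
  case (Suc m)
  have "0 \<le> E (z + of_bool (0 < k)) (tw \<beta> m (k - 1))" "E (z + of_bool (0 < k)) (tw \<beta> m (k - 1)) \<le> 1"
    using Suc by (auto intro!: measure_pmf.integral_le_const integrable_pmf_bounded[of _ 1])
  moreover have "exp (- \<beta> * (2 * real z + of_bool (0 < k))) \<le> 1"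
    using Suc.prems by simp
  ultimately show ?case
    using mult_le_one[of "exp (- \<beta> * (2 * real z + of_bool (0 < k)))"] by simp
qed simp

lemma integrable_tw: "0 \<le> \<beta> \<Longrightarrow> integrable (measure_pmf q) (tw \<beta> m k)"
  using tw_bounds by (intro integrable_pmf_bounded[of _ 1]) auto

lemma tw_step_mono:
  assumes "0 \<le> \<beta>" "\<And>z. tw \<beta> m (k - 1) z \<le> tw \<beta> m' (k - 1) z"
  shows "tw \<beta> (Suc m) k z \<le> tw \<beta> (Suc m') k z"
  using assms by (auto intro!: mult_left_mono integral_mono integrable_tw)

lemma tw_mono_Suc:
  assumes \<beta>: "0 \<le> \<beta>"
  shows "tw \<beta> (m + k) k z \<le> tw \<beta> (Suc m + k) k z"
proof (induction k arbitrary: z)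
  case 0
  show ?case
  proof (induction m arbitrary: z)
    case 0
    show ?case
    proof (cases "z = 0")
      case True
      then show ?thesis by (simp add: Q_0)
    next
      case False
      then show ?thesis using tw_bounds[OF \<beta>, of "Suc 0" 0 z] by simp
    qed
  next
    case (Suc m)
    then show ?case using tw_step_mono[OF \<beta>, of "m" 0 "Suc m" z] by simp
  qed
next
  case (Suc k)
  then show ?case using tw_step_mono[OF \<beta>, of "m + k" "Suc k" "Suc m + k" z] by simp
qed

lemma tw_mono: "0 \<le> \<beta> \<Longrightarrow> mono (\<lambda>m. tw \<beta> (m + k) k z)"
  using tw_mono_Suc by (intro incseq_SucI) auto

lemma tw_tendsto: "0 \<le> \<beta> \<Longrightarrow> (\<lambda>m. tw \<beta> (m + k) k z) \<longlonglongrightarrow> lw \<beta> k z"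
proof -
  assume \<beta>: "0 \<le> \<beta>"
  have "convergent (\<lambda>m. tw \<beta> (m + k) k z)"
    by (rule Bseq_mono_convergent)
      (use tw_bounds[OF \<beta>] monoD[OF tw_mono[OF \<beta>]] in \<open>auto intro!: BseqI'[of _ 1]\<close>)
  then show ?thesis by (simp add: full_transform_def convergent_LIMSEQ_iff)
qed

lemma lw_bounds: assumes "0 \<le> \<beta>" shows "0 \<le> lw \<beta> k z" "lw \<beta> k z \<le> 1"
  using LIMSEQ_le_const[OF tw_tendsto[OF assms]] LIMSEQ_le_const2[OF tw_tendsto[OF assms]] tw_bounds[OF assms]
  by blast+

lemma integrable_lw: "0 \<le> \<beta> \<Longrightarrow> integrable (measure_pmf q) (lw \<beta> k)"
  using lw_bounds by (intro integrable_pmf_bounded[of _ 1]) auto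

lemma lw_step:
  assumes \<beta>: "0 \<le> \<beta>"
  shows "lw \<beta> k z = exp (- \<beta> * (2 * real z + of_bool (0 < k))) * E (z + of_bool (0 < k)) (lw \<beta> (k - 1))"
proof -
  define c where "c = exp (- \<beta> * (2 * real z + of_bool (0 < k)))"
  define z' where "z' = z + (of_bool (0 < k) :: nat)"
  have conv: "(\<lambda>m. E z' (tw \<beta> (m + (k - 1)) (k - 1))) \<longlonglongrightarrow> E z' (lw \<beta> (k - 1))"
  proof (rule integral_dominated_convergence[where w = "\<lambda>_. 1"])
    show "AE x in Q z'. (\<lambda>m. tw \<beta> (m + (k - 1)) (k - 1) x) \<longlonglongrightarrow> lw \<beta> (k - 1) x"
      using tw_tendsto[OF \<beta>] by simp
  qed (use tw_bounds[OF \<beta>] in auto)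
  have "(\<lambda>m. tw \<beta> (Suc (m + (k - 1))) k z) \<longlonglongrightarrow> c * E z' (lw \<beta> (k - 1))"
    using tendsto_mult[OF tendsto_const[of c] conv] by (simp add: c_def z'_def)
  moreover have "(\<lambda>m. tw \<beta> (Suc (m + (k - 1))) k z) \<longlonglongrightarrow> lw \<beta> k z"
  proof (cases k)
    case 0
    then show ?thesis using LIMSEQ_Suc[OF tw_tendsto[OF \<beta>, of 0 z]] by simp
  next
    case (Suc j)
    then show ?thesis using tw_tendsto[OF \<beta>, of k z] by simp
  qed
  ultimately show ?thesis unfolding c_def z'_def by (rule LIMSEQ_unique[rotated])
qed

lemma lw_0_step: "0 \<le> \<beta> \<Longrightarrow> lw \<beta> 0 z = exp (- (2 * \<beta> * real z)) * E z (lw \<beta> 0)"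
  using lw_step[of \<beta> 0 z] by (simp add: mult.assoc mult.left_commute)

lemma lw_Suc_step: "0 \<le> \<beta> \<Longrightarrow> lw \<beta> (Suc k) z = exp (- (\<beta> * (2 * real z + 1))) * E (Suc z) (lw \<beta> k)"
  using lw_step[of \<beta> "Suc k" z] by simp

lemma lw_0_0: "0 \<le> \<beta> \<Longrightarrow> lw \<beta> 0 0 = 1"
proof -
  have "tw \<beta> m 0 0 = 1" for m by (induction m) (simp_all add: Q_0)
  then show "lw \<beta> 0 0 = 1" by (simp add: full_transform_def)
qed

text \<open>A maximum principle. Each step from a state \<open>z \<ge> 1\<close> is discounted by at least \<open>exp (- 2 * \<beta>)\<close>, so
iterating the inequality makes the upper bound \<open>B\<close> arbitrarily small.\<close>

lemma comparison:
  assumes \<beta>: "0 < \<beta>" and B: "\<And>z. \<bar>H z\<bar> \<le> B" and H0: "H 0 \<le> 0"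
    and sub: "\<And>z. 1 \<le> z \<Longrightarrow> H z \<le> exp (- (2 * \<beta> * real z)) * E z H"
  shows "H z \<le> 0"
proof -
  have B0: "0 \<le> B" using B[of 0] by linarith
  have int: "integrable (Q z) H" for z by (rule integrable_pmf_bounded[OF B])
  have bound: "H z \<le> B * exp (- (2 * \<beta>)) ^ m" for m z
  proof (induction m arbitrary: z)
    case 0
    show ?case using B[of z] by (simp add: abs_le_iff)
  next
    case (Suc m)
    show ?case
    proof (cases "z = 0")
      case True
      then show ?thesis using H0 B0 by (simp add: order_trans[OF H0])
    next
      case False
      have "E z H \<le> B * exp (- (2 * \<beta>)) ^ m"
        by (intro measure_pmf.integral_le_const int) (auto simp: Suc)
      then have "exp (- (2 * \<beta> * real z)) * E z H \<le> exp (- (2 * \<beta> * real z)) * (B * exp (- (2 * \<beta>)) ^ m)"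
        by (intro mult_left_mono) auto
      also have "\<dots> \<le> exp (- (2 * \<beta>)) * (B * exp (- (2 * \<beta>)) ^ m)"
        using False B0 \<beta> by (intro mult_right_mono) auto
      finally show ?thesis using sub[of z] False by (simp add: mult.left_commute)
    qed
  qed
  have "(\<lambda>m. B * exp (- (2 * \<beta>)) ^ m) \<longlonglongrightarrow> B * 0"
    by (intro tendsto_mult tendsto_const LIMSEQ_power_zero) (use \<beta> in auto)
  then show ?thesis using LIMSEQ_le_const[of _ 0 "H z"] bound by auto
qed

lemma gauss_bounds: "0 \<le> \<beta> \<Longrightarrow> 0 \<le> y \<Longrightarrow> 0 \<le> j \<Longrightarrow> 0 \<le> gauss \<beta> j y \<and> gauss \<beta> j y \<le> 1"
  by (simp add: gauss_def)

lemma gauss_le: "0 \<le> \<beta> \<Longrightarrow> 0 \<le> y \<Longrightarrow> 0 \<le> j \<Longrightarrow> gauss \<beta> j y \<le> exp (- (\<beta> * (y + j)\<^sup>2))"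
proof -
  assume a: "0 \<le> \<beta>" "0 \<le> y" "0 \<le> j"
  have "(y + j)\<^sup>2 \<le> 2 * y\<^sup>2 + 4 * y * j + j\<^sup>2"
    using a by (simp add: power2_sum)
  from mult_left_mono[OF this a(1)] show ?thesis by (simp add: gauss_def)
qed

lemma x_exp_le: "0 \<le> x \<Longrightarrow> x * exp (- x) \<le> (1::real)"
proof -
  have "x \<le> exp x" using exp_ge_add_one_self[of x] by linarith
  then show ?thesis by (simp add: exp_minus field_simps)
qed

lemma gauss_deriv_bound:
  assumes a: "0 < \<beta>" "0 \<le> y" "0 \<le> j"
  shows "\<bar>- (4 * \<beta> * (y + j)) * gauss \<beta> j y\<bar> \<le> 4 * sqrt \<beta>"
proof -
  define t where "t = sqrt \<beta> * (y + j)"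
  have t: "0 \<le> t" "t\<^sup>2 = \<beta> * (y + j)\<^sup>2" using a by (auto simp: t_def power_mult_distrib)
  have "t \<le> 1 + t\<^sup>2" using zero_le_power2[of "t - 1"] t by (simp add: power2_diff)
  then have "t \<le> exp (t\<^sup>2)" using exp_ge_add_one_self[of "t\<^sup>2"] by linarith
  then have t1: "t * exp (- t\<^sup>2) \<le> 1" by (simp add: exp_minus field_simps)
  have "\<bar>- (4 * \<beta> * (y + j)) * gauss \<beta> j y\<bar> = 4 * (\<beta> * (y + j)) * gauss \<beta> j y"
    using a gauss_bounds[of \<beta> y j] by (simp add: abs_mult)
  also have "\<dots> \<le> 4 * (\<beta> * (y + j)) * exp (- t\<^sup>2)"
    unfolding t(2) using a by (intro mult_left_mono gauss_le) auto
  also have "\<beta> * (y + j) = sqrt \<beta> * t" using a by (simp add: t_def flip: mult.assoc)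
  also have "4 * (sqrt \<beta> * t) * exp (- t\<^sup>2) = 4 * sqrt \<beta> * (t * exp (- t\<^sup>2))" by simp
  also have "\<dots> \<le> 4 * sqrt \<beta> * 1" using a by (intro mult_left_mono t1) auto
  finally show ?thesis by simp
qed

lemma gauss_deriv2_bound:
  assumes a: "0 < \<beta>" "0 \<le> y" "0 \<le> j"
  shows "\<bar>((4 * \<beta> * (y + j))\<^sup>2 - 4 * \<beta>) * gauss \<beta> j y\<bar> \<le> 20 * \<beta>"
proof -
  define x where "x = \<beta> * (y + j)\<^sup>2"
  have x: "0 \<le> x" using a by (simp add: x_def)
  have e: "(4 * \<beta> * (y + j))\<^sup>2 - 4 * \<beta> = 16 * \<beta> * x - 4 * \<beta>"
    by (simp add: x_def power2_eq_square algebra_simps)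
  have "\<bar>16 * \<beta> * x - 4 * \<beta>\<bar> \<le> 16 * \<beta> * x + 4 * \<beta>" using a x by (simp add: abs_le_iff)
  then have "\<bar>((4 * \<beta> * (y + j))\<^sup>2 - 4 * \<beta>) * gauss \<beta> j y\<bar> \<le> (16 * \<beta> * x + 4 * \<beta>) * gauss \<beta> j y"
    unfolding e using a gauss_bounds[of \<beta> y j] by (simp add: abs_mult mult_right_mono)
  also have "\<dots> \<le> (16 * \<beta> * x + 4 * \<beta>) * exp (- x)"
    unfolding x_def using a by (intro mult_left_mono gauss_le) auto
  also have "\<dots> = 16 * \<beta> * (x * exp (- x)) + 4 * \<beta> * exp (- x)" by (simp add: algebra_simps)
  also have "\<dots> \<le> 16 * \<beta> * 1 + 4 * \<beta> * 1"
    using a x by (intro add_mono mult_left_mono x_exp_le) auto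
  finally show ?thesis by simp
qed

lemma gauss_Taylor:
  assumes \<beta>: "0 < \<beta>" and y: "0 \<le> y" "0 \<le> c" and j: "0 \<le> j"
  shows "\<bar>gauss \<beta> j y - gauss \<beta> j c + 4 * \<beta> * (c + j) * gauss \<beta> j c * (y - c)\<bar> \<le> 20 * \<beta> * (y - c)\<^sup>2"
proof -
  define f where "f i x = (if i = 0 then gauss \<beta> j x
     else if i = 1 then - (4 * \<beta> * (x + j)) * gauss \<beta> j x
     else ((4 * \<beta> * (x + j))\<^sup>2 - 4 * \<beta>) * gauss \<beta> j x)" for i :: nat and x
  have "norm (f 0 y - (\<Sum>i\<le>1. f i c * (y - c) ^ i / fact i)) \<le> 20 * \<beta> * norm (y - c) ^ (Suc 1) / fact 1"
  proof (rule field_Taylor[where S = "{0..}"])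
    fix i :: nat and x :: real assume "x \<in> {0..}" "i \<le> 1"
    then consider "i = 0" | "i = 1" by linarith
    then show "(f i has_field_derivative f (Suc i) x) (at x within {0..})"
    proof cases
      case 1
      then show ?thesis
        by (auto simp: f_def[abs_def] gauss_def power2_eq_square algebra_simps intro!: derivative_eq_intros)
    next
      case 2
      then show ?thesis
        by (auto simp: f_def[abs_def] gauss_def power2_eq_square algebra_simps intro!: derivative_eq_intros)
    qed
  qed (use \<beta> y j gauss_deriv2_bound in \<open>auto simp: f_def\<close>)
  then show ?thesis by (simp add: f_def power2_eq_square algebra_simps)
qed

text \<open>Second order expansion around \<open>z - 1 / 2\<close>: the first order term sees only the bias of the kernel,
the second order term only its variance.\<close>

lemma expectation_gauss:
  assumes \<beta>: "0 < \<beta>" and z: "1 \<le> z" and j: "0 \<le> j" and c: "c = real z - 1 / 2"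
  shows "\<bar>E z (\<lambda>u. gauss \<beta> j (real u)) - gauss \<beta> j c + 4 * \<beta> * (c + j) * gauss \<beta> j c * bias z\<bar> \<le> 20 * \<beta> * V"
proof -
  have c0: "0 \<le> c" using z c by simp
  define a where "a = 4 * \<beta> * (c + j) * gauss \<beta> j c"
  have int: "integrable (Q z) (\<lambda>u. gauss \<beta> j (real u))"
    by (rule integrable_pmf_bounded[of _ 1]) (use gauss_bounds[of \<beta> _ j] \<beta> j in auto)
  have dev: "dev z u = real u - c" for u by (simp add: dev_def c)
  have "E z (\<lambda>u. gauss \<beta> j (real u)) - gauss \<beta> j c + a * bias z
      = E z (\<lambda>u. gauss \<beta> j (real u) - gauss \<beta> j c + a * dev z u)"
    using int integrable_dev[of z] by (simp add: bias_def)
  also have "\<bar>\<dots>\<bar> \<le> E z (\<lambda>u. \<bar>gauss \<beta> j (real u) - gauss \<beta> j c + a * dev z u\<bar>)"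
    by (rule integral_abs_bound)
  also have "\<dots> \<le> E z (\<lambda>u. 20 * \<beta> * (dev z u)\<^sup>2)"
  proof (rule integral_mono)
    show "integrable (Q z) (\<lambda>u. \<bar>gauss \<beta> j (real u) - gauss \<beta> j c + a * dev z u\<bar>)"
      using int integrable_dev[of z] by auto
    show "integrable (Q z) (\<lambda>u. 20 * \<beta> * (dev z u)\<^sup>2)" using sq_dev(1)[of z] by auto
    show "\<bar>gauss \<beta> j (real u) - gauss \<beta> j c + a * dev z u\<bar> \<le> 20 * \<beta> * (dev z u)\<^sup>2" for u
      using gauss_Taylor[OF \<beta> _ c0 j, of "real u"] by (simp add: a_def dev)
  qed
  also have "\<dots> \<le> 20 * \<beta> * V" using sq_dev(2)[of z] \<beta> by (simp add: mult_left_mono)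
  finally show ?thesis by (simp add: a_def)
qed

end

lemma x_exp_le_one_minus: "(x::real) * exp (- x) \<le> 1 - exp (- x)"
proof -
  have "(1 + x) * exp (- x) \<le> exp x * exp (- x)"
    using exp_ge_add_one_self[of x] by (intro mult_right_mono) auto
  then show ?thesis by (simp add: algebra_simps flip: exp_add)
qed

text \<open>Truncated subtraction makes the penalty equal to \<open>1\<close> for \<open>b \<le> M\<close>; it decays exponentially above
\<open>M\<close>. It pays for the small states, where the bias of the kernel is not small.\<close>

definition penalty :: "real \<Rightarrow> nat \<Rightarrow> nat \<Rightarrow> real" where
  "penalty \<theta> M b = exp (- \<theta> * real (b - M))"

context balanced_kernel
begin

text \<open>One-step error of \<open>gauss \<beta> 0\<close>, measured in units of the discount \<open>1 - exp (- 2 * \<beta> * z)\<close>. In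
these units the errors along a path add up to at most their maximum.\<close>

definition "defect z = 2 * \<bar>bias z\<bar> + (10 * V + 1 / 4) / real z"

lemma defect_nonneg: "0 \<le> defect z"
  using V_pos by (simp add: defect_def)

lemma defect_small: "0 < e \<Longrightarrow> \<exists>M. \<forall>z\<ge>M. defect z \<le> e"
proof -
  assume e: "0 < e"
  have "(\<lambda>z. 2 * \<bar>bias z\<bar> + (10 * V + 1 / 4) / real z) \<longlonglongrightarrow> 2 * \<bar>0\<bar> + 0"
    by (intro tendsto_add tendsto_mult tendsto_const tendsto_rabs bias_tendsto lim_const_over_n)
  then have "defect \<longlonglongrightarrow> 0" by (simp add: defect_def[abs_def])
  from LIMSEQ_D[OF this e] obtain M where "\<forall>z\<ge>M. norm (defect z - 0) < e" by blast
  then have "\<forall>z\<ge>M. defect z \<le> e" by (auto simp: abs_less_iff less_imp_le)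
  then show ?thesis ..
qed

text \<open>Completing the square gives
\<open>exp (- 2 * \<beta> * z) * gauss \<beta> 0 (z - 1 / 2) = gauss \<beta> 0 z * exp (- \<beta> / 2)\<close>, and the other errors are
those of \<open>expectation_gauss\<close>. The inequality \<open>y * exp (- y) \<le> 1 - exp (- y)\<close> with \<open>y = 2 * \<beta> * z\<close>
converts them into units of the discount.\<close>

lemma right_defect:
  assumes \<beta>: "0 < \<beta>" and z: "1 \<le> z"
  shows "\<bar>exp (- (2 * \<beta> * real z)) * E z (\<lambda>u. gauss \<beta> 0 (real u)) - gauss \<beta> 0 (real z)\<bar>
     \<le> defect z * (1 - exp (- (2 * \<beta> * real z)))"
proof -
  define c where "c = real z - 1 / 2"
  define e where "e = exp (- (2 * \<beta> * real z))"
  define X where "X = E z (\<lambda>u. gauss \<beta> 0 (real u))"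
  have c: "0 \<le> c" "c \<le> real z" using z by (auto simp: c_def)
  have e: "0 \<le> e" by (simp add: e_def)
  have gc: "0 \<le> gauss \<beta> 0 c" "gauss \<beta> 0 c \<le> 1" using gauss_bounds[of \<beta> c 0] \<beta> c by auto
  have 1: "\<bar>X - gauss \<beta> 0 c + 4 * \<beta> * c * gauss \<beta> 0 c * bias z\<bar> \<le> 20 * \<beta> * V"
    using expectation_gauss[OF \<beta> z order_refl c_def] by (simp add: X_def)
  have 2: "\<bar>4 * \<beta> * c * gauss \<beta> 0 c * bias z\<bar> \<le> 4 * \<beta> * real z * \<bar>bias z\<bar>"
  proof -
    have "c * gauss \<beta> 0 c \<le> real z * 1" using c gc by (intro mult_mono) auto
    then have "(4 * \<beta>) * (c * gauss \<beta> 0 c) * \<bar>bias z\<bar> \<le> (4 * \<beta>) * (real z * 1) * \<bar>bias z\<bar>"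
      using \<beta> by (intro mult_right_mono mult_left_mono) auto
    then show ?thesis using \<beta> c gc by (simp add: abs_mult mult.assoc)
  qed
  have shift: "e * gauss \<beta> 0 c = gauss \<beta> 0 (real z) * exp (- (\<beta> / 2))"
    by (simp add: e_def gauss_def c_def power2_eq_square algebra_simps flip: exp_add)
  have gz: "gauss \<beta> 0 (real z) \<le> e" "0 \<le> gauss \<beta> 0 (real z)"
  proof -
    have "real z \<le> (real z)\<^sup>2" using z by (simp add: power2_eq_square)
    then show "gauss \<beta> 0 (real z) \<le> e" using \<beta> by (simp add: gauss_def e_def)
  qed (simp add: gauss_def)
  have 3: "\<bar>e * gauss \<beta> 0 c - gauss \<beta> 0 (real z)\<bar> \<le> e * (\<beta> / 2)"
  proof -
    have "\<bar>e * gauss \<beta> 0 c - gauss \<beta> 0 (real z)\<bar> = gauss \<beta> 0 (real z) * (1 - exp (- (\<beta> / 2)))"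
      unfolding shift using mult_nonneg_nonneg[OF gz(2), of "1 - exp (- (\<beta> / 2))"] \<beta>
      by (simp add: right_diff_distrib)
    also have "\<dots> \<le> e * (\<beta> / 2)"
      using gz \<beta> exp_ge_add_one_self[of "- (\<beta> / 2)"] by (intro mult_mono) auto
    finally show ?thesis .
  qed
  have "\<bar>e * X - gauss \<beta> 0 (real z)\<bar> = \<bar>e * (X - gauss \<beta> 0 c + 4 * \<beta> * c * gauss \<beta> 0 c * bias z)
      - e * (4 * \<beta> * c * gauss \<beta> 0 c * bias z) + (e * gauss \<beta> 0 c - gauss \<beta> 0 (real z))\<bar>"
    by (simp add: algebra_simps)
  also have "\<dots> \<le> \<bar>e * (X - gauss \<beta> 0 c + 4 * \<beta> * c * gauss \<beta> 0 c * bias z)\<bar>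
      + \<bar>e * (4 * \<beta> * c * gauss \<beta> 0 c * bias z)\<bar> + \<bar>e * gauss \<beta> 0 c - gauss \<beta> 0 (real z)\<bar>"
    by linarith
  also have "\<dots> \<le> e * (20 * \<beta> * V) + e * (4 * \<beta> * real z * \<bar>bias z\<bar>) + e * (\<beta> / 2)"
    using e mult_left_mono[OF 1 e] mult_left_mono[OF 2 e] 3
    by (intro add_mono) (simp_all add: abs_mult)
  also have "\<dots> = defect z * ((2 * \<beta> * real z) * exp (- (2 * \<beta> * real z)))"
    using z by (simp add: defect_def e_def field_simps)
  also have "\<dots> \<le> defect z * (1 - exp (- (2 * \<beta> * real z)))"
    by (intro mult_left_mono x_exp_le_one_minus defect_nonneg)
  finally show ?thesis by (simp add: e_def X_def)
qed

text \<open>The functions \<open>gauss \<plusminus> (\<epsilon> + C * \<beta> * [z > 0])\<close> are a super- and a subsolution of the one-step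
equation. For large \<open>z\<close> the defect is at most \<open>\<epsilon>\<close>, and the discount of the constant \<open>\<epsilon>\<close> compensates it. For
the finitely many small \<open>z\<close> the term \<open>C * \<beta>\<close> compensates it, because the chain jumps to \<open>0\<close> with
positive probability. Both signs are treated at once through \<open>\<sigma>\<close>.\<close>

lemma right_transform_close:
  assumes \<epsilon>: "0 < \<epsilon>"
  shows "\<exists>C\<ge>0. \<forall>\<beta>>0. \<forall>z. \<bar>lw \<beta> 0 z - gauss \<beta> 0 (real z)\<bar> \<le> \<epsilon> + C * \<beta>"
proof -
  obtain M where M: "\<And>z. M \<le> z \<Longrightarrow> defect z \<le> \<epsilon>" using defect_small[OF \<epsilon>] by blast
  \<comment> \<open>a sum of nonnegative terms, hence large enough for every \<open>z < M\<close> simultaneously\<close>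
  define C where "C = (\<Sum>z<M. 2 * real z * defect z / pmf (Q z) 0)"
  have C0: "0 \<le> C" unfolding C_def using defect_nonneg by (intro sum_nonneg) auto
  have C: "2 * real z * defect z \<le> C * pmf (Q z) 0" if "z < M" for z
  proof -
    have "2 * real z * defect z / pmf (Q z) 0 \<le> C"
      unfolding C_def using that defect_nonneg
      by (intro member_le_sum[where f = "\<lambda>z. 2 * real z * defect z / pmf (Q z) 0"]) auto
    then show ?thesis using Q_pos_0[of z] by (simp add: field_simps)
  qed
  have "\<sigma> * (lw \<beta> 0 z - gauss \<beta> 0 (real z)) \<le> \<epsilon> + C * \<beta>" if \<beta>: "0 < \<beta>" and \<sigma>: "\<sigma> = 1 \<or> \<sigma> = - 1" for \<beta> \<sigma> z
  proof -
    define H where "H z = \<sigma> * (lw \<beta> 0 z - gauss \<beta> 0 (real z)) - \<epsilon> - C * \<beta> * of_bool (0 < z)" for z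
    have lwb: "0 \<le> lw \<beta> 0 z" "lw \<beta> 0 z \<le> 1" for z using lw_bounds[of \<beta>] \<beta> by auto
    have gb: "0 \<le> gauss \<beta> 0 (real z)" "gauss \<beta> 0 (real z) \<le> 1" for z using gauss_bounds[of \<beta> "real z" 0] \<beta> by auto
    have "H z \<le> 0"
    proof (rule comparison[OF \<beta>])
      show "\<bar>H z\<bar> \<le> 1 + \<epsilon> + C * \<beta>" for z
      proof -
        have "\<bar>\<sigma> * (lw \<beta> 0 z - gauss \<beta> 0 (real z))\<bar> \<le> 1"
          using lwb[of z] gb[of z] \<sigma> by (auto simp: abs_le_iff)
        moreover have "0 \<le> C * \<beta>" using C0 \<beta> by simp
        ultimately show ?thesis using \<epsilon> unfolding H_def of_bool_def by (auto simp: abs_le_iff split: if_splits)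
      qed
      show "H 0 \<le> 0" using \<epsilon> lw_0_0[of \<beta>] \<beta> by (simp add: H_def gauss_def)
      fix z :: nat assume z: "1 \<le> z"
      define e where "e = exp (- (2 * \<beta> * real z))"
      have e: "0 \<le> e" "e \<le> 1" "1 - e \<le> 2 * \<beta> * real z"
        using \<beta> exp_ge_add_one_self[of "- (2 * \<beta> * real z)"] by (auto simp: e_def)
      define q where "q = pmf (Q z) 0"
      have q: "0 \<le> q" "q \<le> 1" by (auto simp: q_def pmf_le_1)
      define X where "X = E z (\<lambda>u. gauss \<beta> 0 (real u))"
      have pos: "E z (\<lambda>u. of_bool (0 < u)) = 1 - q"
      proof -
        have "E z (\<lambda>u. of_bool (0 < u)) = E z (\<lambda>u. 1 - indicator {0} u)"
          by (intro Bochner_Integration.integral_cong) (auto simp: indicator_def)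
        also have "\<dots> = 1 - q"
          by (subst Bochner_Integration.integral_diff)
            (auto intro!: integrable_pmf_bounded[of _ 1] simp: q_def measure_pmf_single split: split_indicator)
        finally show ?thesis .
      qed
      have ig: "integrable (Q z) (\<lambda>u. gauss \<beta> 0 (real u))" by (rule integrable_pmf_bounded[of _ 1]) (use gb in auto)
      have il: "integrable (Q z) (lw \<beta> 0)" using \<beta> by (intro integrable_lw) simp
      have ib: "integrable (Q z) (\<lambda>u. of_bool (0 < u) :: real)" by (rule integrable_pmf_bounded[of _ 1]) auto
      have EH: "E z H = \<sigma> * (E z (lw \<beta> 0) - X) - \<epsilon> - C * \<beta> * (1 - q)"
        unfolding H_def X_def using ig il ib by (simp add: pos)
      have fix_point: "lw \<beta> 0 z = e * E z (lw \<beta> 0)" using lw_0_step[of \<beta> z] \<beta> by (simp add: e_def)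
      have d: "\<bar>e * X - gauss \<beta> 0 (real z)\<bar> \<le> defect z * (1 - e)"
        using right_defect[OF \<beta> z] by (simp add: e_def X_def)
      then have d': "- (defect z * (1 - e)) \<le> \<sigma> * (gauss \<beta> 0 (real z) - e * X)"
        using \<sigma> by (auto simp: abs_le_iff)
      have "e * E z H - H z = \<sigma> * (gauss \<beta> 0 (real z) - e * X) + \<epsilon> * (1 - e) + C * \<beta> * (1 - e * (1 - q))"
        unfolding EH using z by (simp add: H_def fix_point algebra_simps)
      moreover have "C * \<beta> * q \<le> C * \<beta> * (1 - e * (1 - q))"
      proof (intro mult_left_mono)
        have "e * (1 - q) \<le> 1 * (1 - q)" using e q by (intro mult_right_mono) auto
        then show "q \<le> 1 - e * (1 - q)" by simp
        show "0 \<le> C * \<beta>" using C0 \<beta> by simp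
      qed
      moreover have "defect z * (1 - e) \<le> \<epsilon> * (1 - e) + C * \<beta> * q"
      proof (cases "z < M")
        case True
        have "defect z * (1 - e) \<le> defect z * (2 * \<beta> * real z)"
          by (intro mult_left_mono e defect_nonneg)
        also have "\<dots> = \<beta> * (2 * real z * defect z)" by simp
        also have "\<dots> \<le> \<beta> * (C * q)" using C[OF True] \<beta> unfolding q_def by (intro mult_left_mono) auto
        finally have "defect z * (1 - e) \<le> C * \<beta> * q" by (simp add: mult_ac)
        moreover have "0 \<le> \<epsilon> * (1 - e)" using \<epsilon> e by simp
        ultimately show ?thesis by linarith
      next
        case False
        then have "defect z * (1 - e) \<le> \<epsilon> * (1 - e)" using M[of z] e by (intro mult_right_mono) auto
        moreover have "0 \<le> C * \<beta> * q" using C0 \<beta> q by simp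
        ultimately show ?thesis by linarith
      qed
      ultimately have "0 \<le> e * E z H - H z" using d' by linarith
      then show "H z \<le> exp (- (2 * \<beta> * real z)) * E z H" by (simp add: e_def)
    qed
    moreover have "C * \<beta> * of_bool (0 < z) \<le> C * \<beta>" using C0 \<beta> by simp
    ultimately show ?thesis unfolding H_def by linarith
  qed
  from this[of _ 1] this[of _ "- 1"] have "\<bar>lw \<beta> 0 z - gauss \<beta> 0 (real z)\<bar> \<le> \<epsilon> + C * \<beta>" if "0 < \<beta>" for \<beta> z
    using that by (simp add: abs_le_iff)
  then show ?thesis using C0 by blast
qed

text \<open>The same expansion as in \<open>right_defect\<close> for a step with an added crossing. Here the discount is not
needed: only about \<open>\<beta> powr (- 1 / 2)\<close> such steps occur, and the error is \<open>sqrt \<beta>\<close> times the bias up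
to terms of order \<open>\<beta>\<close>.\<close>

lemma left_defect:
  assumes \<beta>: "0 < \<beta>" and j: "0 \<le> j"
  shows "\<bar>exp (- (\<beta> * (2 * real b + 1))) * E (Suc b) (\<lambda>u. gauss \<beta> j (real u)) - gauss \<beta> (j + 1) (real b)\<bar>
     \<le> \<beta> / 2 + 4 * sqrt \<beta> * \<bar>bias (Suc b)\<bar> + 20 * \<beta> * V"
proof -
  define c where "c = real (Suc b) - 1 / 2"
  define e where "e = exp (- (\<beta> * (2 * real b + 1)))"
  define X where "X = E (Suc b) (\<lambda>u. gauss \<beta> j (real u))"
  have c: "0 \<le> c" by (auto simp: c_def)
  have e: "0 \<le> e" "e \<le> 1" using \<beta> by (auto simp: e_def)
  have 1: "\<bar>X - gauss \<beta> j c + 4 * \<beta> * (c + j) * gauss \<beta> j c * bias (Suc b)\<bar> \<le> 20 * \<beta> * V"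
    using expectation_gauss[OF \<beta> _ j c_def] by (simp add: X_def)
  have 2: "\<bar>4 * \<beta> * (c + j) * gauss \<beta> j c * bias (Suc b)\<bar> \<le> 4 * sqrt \<beta> * \<bar>bias (Suc b)\<bar>"
    using mult_right_mono[OF gauss_deriv_bound[OF \<beta> c j] abs_ge_zero[of "bias (Suc b)"]]
    by (simp add: abs_mult)
  have shift: "e * gauss \<beta> j c = gauss \<beta> (j + 1) (real b) * exp (- (\<beta> / 2))"
    by (simp add: e_def gauss_def c_def power2_eq_square algebra_simps flip: exp_add)
  have gz: "gauss \<beta> (j + 1) (real b) \<le> 1" "0 \<le> gauss \<beta> (j + 1) (real b)"
    using gauss_bounds[of \<beta> "real b" "j + 1"] \<beta> j by auto
  have 3: "\<bar>e * gauss \<beta> j c - gauss \<beta> (j + 1) (real b)\<bar> \<le> \<beta> / 2"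
  proof -
    have "\<bar>e * gauss \<beta> j c - gauss \<beta> (j + 1) (real b)\<bar> = gauss \<beta> (j + 1) (real b) * (1 - exp (- (\<beta> / 2)))"
      unfolding shift using mult_nonneg_nonneg[OF gz(2), of "1 - exp (- (\<beta> / 2))"] \<beta>
      by (simp add: right_diff_distrib)
    also have "\<dots> \<le> 1 * (\<beta> / 2)"
      using gz \<beta> exp_ge_add_one_self[of "- (\<beta> / 2)"] by (intro mult_mono) auto
    finally show ?thesis by simp
  qed
  let ?A = "X - gauss \<beta> j c + 4 * \<beta> * (c + j) * gauss \<beta> j c * bias (Suc b)"
  let ?B = "4 * \<beta> * (c + j) * gauss \<beta> j c * bias (Suc b)"
  have "e * X - gauss \<beta> (j + 1) (real b) = e * ?A - e * ?B + (e * gauss \<beta> j c - gauss \<beta> (j + 1) (real b))"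
    by (simp add: algebra_simps)
  moreover have "\<bar>e * ?A\<bar> \<le> 20 * \<beta> * V" "\<bar>e * ?B\<bar> \<le> 4 * sqrt \<beta> * \<bar>bias (Suc b)\<bar>"
    using mult_mono[OF e(2) 1] mult_mono[OF e(2) 2] e by (auto simp: abs_mult)
  ultimately show ?thesis using 3 unfolding e_def X_def by linarith
qed

lemma expectation_exp_dev:
  assumes \<theta>: "0 \<le> \<theta>" "\<theta> \<le> \<theta>\<^sub>0 / 2"
  shows "integrable (Q z) (\<lambda>u. exp (- (\<theta> * dev z u)))"
    and "E z (\<lambda>u. exp (- (\<theta> * dev z u))) \<le> 1 - \<theta> * bias z + \<theta>\<^sup>2 * (16 * C\<^sub>0 / \<theta>\<^sub>0\<^sup>2)"
proof -
  have le: "\<bar>exp (- (\<theta> * dev z u))\<bar> \<le> 1 * exp (\<theta>\<^sub>0 * \<bar>dev z u\<bar>)" for u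
  proof -
    have "\<theta> * (- dev z u) \<le> \<theta>\<^sub>0 * \<bar>dev z u\<bar>"
    proof -
      have "\<theta> * (- dev z u) \<le> \<theta> * \<bar>dev z u\<bar>" using \<theta> by (intro mult_left_mono) auto
      also have "\<dots> \<le> \<theta>\<^sub>0 * \<bar>dev z u\<bar>" using \<theta> \<theta>\<^sub>0_pos by (intro mult_right_mono) auto
      finally show ?thesis .
    qed
    then show ?thesis by simp
  qed
  show int: "integrable (Q z) (\<lambda>u. exp (- (\<theta> * dev z u)))"
    by (rule dominated_by_exp(1)[OF le])
  have quad: "\<bar>(dev z u)\<^sup>2 * exp (\<theta> * \<bar>dev z u\<bar>)\<bar> \<le> 16 / \<theta>\<^sub>0\<^sup>2 * exp (\<theta>\<^sub>0 * \<bar>dev z u\<bar>)" for u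
  proof -
    have "(\<theta>\<^sub>0 / 2 * \<bar>dev z u\<bar>)\<^sup>2 \<le> 4 * exp (\<theta>\<^sub>0 / 2 * \<bar>dev z u\<bar>)"
      using \<theta>\<^sub>0_pos by (intro sq_le_exp) auto
    then have "(dev z u)\<^sup>2 \<le> 16 / \<theta>\<^sub>0\<^sup>2 * exp (\<theta>\<^sub>0 / 2 * \<bar>dev z u\<bar>)"
      using \<theta>\<^sub>0_pos by (simp add: power_mult_distrib power_divide field_simps)
    moreover have "exp (\<theta> * \<bar>dev z u\<bar>) \<le> exp (\<theta>\<^sub>0 / 2 * \<bar>dev z u\<bar>)"
      using mult_right_mono[OF \<theta>(2) abs_ge_zero[of "dev z u"]] by simp
    ultimately have "(dev z u)\<^sup>2 * exp (\<theta> * \<bar>dev z u\<bar>)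
        \<le> (16 / \<theta>\<^sub>0\<^sup>2 * exp (\<theta>\<^sub>0 / 2 * \<bar>dev z u\<bar>)) * exp (\<theta>\<^sub>0 / 2 * \<bar>dev z u\<bar>)"
      by (intro mult_mono) auto
    also have "\<dots> = 16 / \<theta>\<^sub>0\<^sup>2 * exp (\<theta>\<^sub>0 * \<bar>dev z u\<bar>)"
      by (simp flip: exp_add)
    finally show ?thesis by simp
  qed
  note q = dominated_by_exp[OF quad]
  have "E z (\<lambda>u. exp (- (\<theta> * dev z u))) \<le> E z (\<lambda>u. 1 - \<theta> * dev z u + \<theta>\<^sup>2 * ((dev z u)\<^sup>2 * exp (\<theta> * \<bar>dev z u\<bar>)))"
  proof (rule integral_mono[OF int])
    show "integrable (Q z) (\<lambda>u. 1 - \<theta> * dev z u + \<theta>\<^sup>2 * ((dev z u)\<^sup>2 * exp (\<theta> * \<bar>dev z u\<bar>)))"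
      using q(1) integrable_dev[of z] by simp
    show "exp (- (\<theta> * dev z u)) \<le> 1 - \<theta> * dev z u + \<theta>\<^sup>2 * ((dev z u)\<^sup>2 * exp (\<theta> * \<bar>dev z u\<bar>))" for u
      using exp_le_quadratic[of "- (\<theta> * dev z u)"] \<theta> by (simp add: abs_mult power_mult_distrib mult.assoc)
  qed
  also have "\<dots> = 1 - \<theta> * bias z + \<theta>\<^sup>2 * E z (\<lambda>u. (dev z u)\<^sup>2 * exp (\<theta> * \<bar>dev z u\<bar>))"
    using q(1) integrable_dev[of z] by (simp add: bias_def)
  also have "\<dots> \<le> 1 - \<theta> * bias z + \<theta>\<^sup>2 * (16 * C\<^sub>0 / \<theta>\<^sub>0\<^sup>2)"
    using q(2) by (intro add_left_mono mult_left_mono) (auto simp: abs_le_iff)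
  finally show "E z (\<lambda>u. exp (- (\<theta> * dev z u))) \<le> 1 - \<theta> * bias z + \<theta>\<^sup>2 * (16 * C\<^sub>0 / \<theta>\<^sub>0\<^sup>2)" .
qed

lemma penalty_bounds: "0 \<le> \<theta> \<Longrightarrow> 0 \<le> penalty \<theta> M b \<and> penalty \<theta> M b \<le> 1"
  by (simp add: penalty_def)

text \<open>With an added crossing the chain drifts upwards by about \<open>1 / 2\<close> from every large state, so a slowly
decaying exponential decreases on average. In states below \<open>M\<close> the penalty has its maximal value \<open>1\<close>.\<close>

lemma penalty_superharmonic:
  "\<exists>\<theta>>0. \<exists>M\<^sub>0. \<forall>M\<ge>M\<^sub>0. \<forall>b. E (Suc b) (penalty \<theta> M) \<le> penalty \<theta> M b"
proof -
  \<comment> \<open>\<open>K\<close> bounds the second order term of \<open>expectation_exp_dev\<close>; \<open>\<theta>\<close> is so small that this term and the bias together stay below \<open>\<theta> / 2\<close>, the gain from the upward drift\<close>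
  define K where "K = 16 * C\<^sub>0 / \<theta>\<^sub>0\<^sup>2"
  have K: "0 < K" using C\<^sub>0_pos \<theta>\<^sub>0_pos by (simp add: K_def)
  define \<theta> where "\<theta> = min (\<theta>\<^sub>0 / 2) (1 / (4 * K))"
  have \<theta>: "0 < \<theta>" "\<theta> \<le> \<theta>\<^sub>0 / 2" "\<theta> * K \<le> 1 / 4"
    using \<theta>\<^sub>0_pos K by (auto simp: \<theta>_def min_def field_simps)
  obtain M\<^sub>0 where M\<^sub>0: "\<And>z. M\<^sub>0 \<le> z \<Longrightarrow> \<bar>bias z\<bar> \<le> 1 / 4" using bias_small[of "1 / 4"] by auto
  have "E (Suc b) (penalty \<theta> M) \<le> penalty \<theta> M b" if M: "M\<^sub>0 \<le> M" for M b
  proof (cases "b < M")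
    case True
    have "E (Suc b) (penalty \<theta> M) \<le> 1"
      using penalty_bounds[of \<theta> M] \<theta>(1)
      by (intro measure_pmf.integral_le_const integrable_pmf_bounded[of _ 1]) auto
    then show ?thesis using True by (simp add: penalty_def)
  next
    case False
    define a where "a = exp (- \<theta> * real (b - M)) * exp (- (\<theta> / 2))"
    have ptw: "penalty \<theta> M u \<le> a * exp (- (\<theta> * dev (Suc b) u))" for u
    proof -
      have "- \<theta> * real (u - M) \<le> - \<theta> * (real u - real M)"
        using \<theta>(1) by (simp add: of_nat_diff_if)
      also have "\<dots> = - \<theta> * real (b - M) + - (\<theta> / 2) + - (\<theta> * dev (Suc b) u)"
        using False by (simp add: dev_def of_nat_diff algebra_simps)
      finally show ?thesis by (simp add: penalty_def a_def flip: exp_add)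
    qed
    have "E (Suc b) (penalty \<theta> M) \<le> E (Suc b) (\<lambda>u. a * exp (- (\<theta> * dev (Suc b) u)))"
      using penalty_bounds[of \<theta> M] \<theta> ptw
      by (intro integral_mono integrable_pmf_bounded[of _ 1] integrable_mult_right expectation_exp_dev) auto
    also have "\<dots> = a * E (Suc b) (\<lambda>u. exp (- (\<theta> * dev (Suc b) u)))" by simp
    also have "\<dots> \<le> a * exp (\<theta> / 2)"
    proof (intro mult_left_mono)
      have "E (Suc b) (\<lambda>u. exp (- (\<theta> * dev (Suc b) u))) \<le> 1 - \<theta> * bias (Suc b) + \<theta>\<^sup>2 * K"
        unfolding K_def using \<theta> by (intro expectation_exp_dev) auto
      also have "\<dots> \<le> 1 + \<theta> * (1 / 4) + \<theta> * (1 / 4)"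
      proof -
        have "\<theta> * (- bias (Suc b)) \<le> \<theta> * (1 / 4)"
          using M\<^sub>0[of "Suc b"] M False \<theta>(1) by (intro mult_left_mono) (auto simp: abs_le_iff)
        moreover have "\<theta> * (\<theta> * K) \<le> \<theta> * (1 / 4)" using \<theta> by (intro mult_left_mono) auto
        ultimately show ?thesis by (simp add: power2_eq_square mult.assoc)
      qed
      also have "\<dots> \<le> exp (\<theta> / 2)" using exp_ge_add_one_self[of "\<theta> / 2"] by linarith
      finally show "E (Suc b) (\<lambda>u. exp (- (\<theta> * dev (Suc b) u))) \<le> exp (\<theta> / 2)" .
    qed (simp add: a_def)
    also have "\<dots> = penalty \<theta> M b" by (simp add: a_def penalty_def flip: exp_add)
    finally show ?thesis .
  qed
  then show ?thesis using \<theta>(1) by blast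
qed

text \<open>The errors of \<open>j\<close> steps accumulate linearly. In small states the bias is only bounded, which costs
\<open>sqrt \<beta>\<close> times the penalty; as the penalty is superharmonic, the cost of later visits to small states is
bounded by the penalty of the starting point, which is negligible when \<open>b\<close> is large.\<close>

lemma left_transform_close:
  assumes \<epsilon>: "0 < \<epsilon>"
  shows "\<exists>\<theta>>0. \<exists>M C. 0 \<le> C \<and> (\<forall>\<beta>>0. \<forall>j b. \<bar>lw \<beta> j b - gauss \<beta> (real j) (real b)\<bar>
     \<le> \<epsilon> + C * \<beta> + real j * (\<epsilon> * sqrt \<beta> + C * \<beta>) + C * (real j * sqrt \<beta>) * penalty \<theta> M b)"
proof -
  obtain \<theta> M\<^sub>0 where \<theta>: "0 < \<theta>" and M\<^sub>0: "\<And>M b. M\<^sub>0 \<le> M \<Longrightarrow> E (Suc b) (penalty \<theta> M) \<le> penalty \<theta> M b"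
    using penalty_superharmonic by blast
  obtain M\<^sub>1 where M\<^sub>1: "\<And>z. M\<^sub>1 \<le> z \<Longrightarrow> \<bar>bias z\<bar> \<le> \<epsilon> / 4" using bias_small[of "\<epsilon> / 4"] \<epsilon> by auto
  define M where "M = max M\<^sub>0 M\<^sub>1"
  obtain C\<^sub>R where C\<^sub>R: "0 \<le> C\<^sub>R" "\<And>\<beta> z. 0 < \<beta> \<Longrightarrow> \<bar>lw \<beta> 0 z - gauss \<beta> 0 (real z)\<bar> \<le> \<epsilon> + C\<^sub>R * \<beta>"
    using right_transform_close[OF \<epsilon>] by blast
  define C where "C = C\<^sub>R + (20 * V + 1 / 2) + 4 * (C\<^sub>0 / \<theta>\<^sub>0)"
  have C: "0 \<le> C" "C\<^sub>R \<le> C" "20 * V + 1 / 2 \<le> C" "4 * (C\<^sub>0 / \<theta>\<^sub>0) \<le> C"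
    using C\<^sub>R V_pos C\<^sub>0_pos \<theta>\<^sub>0_pos by (auto simp: C_def)
  let ?\<phi> = "penalty \<theta> M"
  have \<phi>: "0 \<le> ?\<phi> b" "?\<phi> b \<le> 1" for b using penalty_bounds[of \<theta> M b] \<theta> by auto
  have bias_bd: "4 * \<bar>bias (Suc b)\<bar> \<le> \<epsilon> + C * ?\<phi> b" for b
  proof (cases "b < M")
    case True
    then show ?thesis using bias_le[of "Suc b"] C(4) \<epsilon> by (simp add: penalty_def)
  next
    case False
    then have "\<bar>bias (Suc b)\<bar> \<le> \<epsilon> / 4" by (intro M\<^sub>1) (auto simp: M_def)
    moreover have "0 \<le> C * ?\<phi> b" using C \<phi> by simp
    ultimately show ?thesis by linarith
  qed
  have "\<bar>lw \<beta> j b - gauss \<beta> (real j) (real b)\<bar>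
     \<le> \<epsilon> + C * \<beta> + real j * (\<epsilon> * sqrt \<beta> + C * \<beta>) + C * (real j * sqrt \<beta>) * ?\<phi> b" if \<beta>: "0 < \<beta>" for \<beta> j b
  proof (induction j arbitrary: b)
    case 0
    have "C\<^sub>R * \<beta> \<le> C * \<beta>" using C \<beta> by (intro mult_right_mono) auto
    then show ?case using C\<^sub>R(2)[OF \<beta>, of b] by simp
  next
    case (Suc j)
    define e where "e = exp (- (\<beta> * (2 * real b + 1)))"
    have e: "0 \<le> e" "e \<le> 1" using \<beta> by (auto simp: e_def)
    have gb: "0 \<le> gauss \<beta> (real j) (real u)" "gauss \<beta> (real j) (real u) \<le> 1" for u
      using gauss_bounds[of \<beta> "real u" "real j"] \<beta> by auto
    have ig: "integrable (measure_pmf q) (\<lambda>u. gauss \<beta> (real j) (real u))" for q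
      by (rule integrable_pmf_bounded[of _ 1]) (use gb in auto)
    have il: "integrable (measure_pmf q) (lw \<beta> j)" for q using \<beta> by (intro integrable_lw) simp
    have ip: "integrable (measure_pmf q) ?\<phi>" for q by (rule integrable_pmf_bounded[of _ 1]) (use \<phi> in auto)
    let ?D = "\<lambda>u. lw \<beta> j u - gauss \<beta> (real j) (real u)"
    let ?c = "\<epsilon> + C * \<beta> + real j * (\<epsilon> * sqrt \<beta> + C * \<beta>)"
    have "\<bar>E (Suc b) ?D\<bar> \<le> E (Suc b) (\<lambda>u. \<bar>?D u\<bar>)" by (rule integral_abs_bound)
    also have "\<dots> \<le> E (Suc b) (\<lambda>u. ?c + C * (real j * sqrt \<beta>) * ?\<phi> u)"
      using ig il ip Suc by (intro integral_mono) auto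
    also have "\<dots> = ?c + C * (real j * sqrt \<beta>) * E (Suc b) ?\<phi>"
      using ip by simp
    also have "\<dots> \<le> ?c + C * (real j * sqrt \<beta>) * ?\<phi> b"
      using C \<beta> by (intro add_left_mono mult_left_mono M\<^sub>0) (auto simp: M_def)
    finally have 1: "\<bar>E (Suc b) ?D\<bar> \<le> ?c + C * (real j * sqrt \<beta>) * ?\<phi> b" .
    have 2: "\<bar>e * E (Suc b) ?D\<bar> \<le> \<bar>E (Suc b) ?D\<bar>"
      using mult_right_mono[OF e(2) abs_ge_zero[of "E (Suc b) ?D"]] e by (simp add: abs_mult)
    have 3: "\<bar>e * E (Suc b) (\<lambda>u. gauss \<beta> (real j) (real u)) - gauss \<beta> (real (Suc j)) (real b)\<bar>
        \<le> \<beta> / 2 + 4 * sqrt \<beta> * \<bar>bias (Suc b)\<bar> + 20 * \<beta> * V"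
      using left_defect[OF \<beta>, of "real j" b] by (simp add: e_def add.commute)
    have 4: "\<beta> / 2 + 20 * \<beta> * V \<le> C * \<beta>"
      using mult_right_mono[OF C(3) less_imp_le[OF \<beta>]] by (simp add: algebra_simps)
    have 5: "4 * sqrt \<beta> * \<bar>bias (Suc b)\<bar> \<le> \<epsilon> * sqrt \<beta> + C * sqrt \<beta> * ?\<phi> b"
      using mult_left_mono[OF bias_bd[of b], of "sqrt \<beta>"] \<beta> by (simp add: algebra_simps)
    have "lw \<beta> (Suc j) b - gauss \<beta> (real (Suc j)) (real b)
        = e * E (Suc b) ?D + (e * E (Suc b) (\<lambda>u. gauss \<beta> (real j) (real u)) - gauss \<beta> (real (Suc j)) (real b))"
      using lw_Suc_step[of \<beta> j b] \<beta> ig il by (simp add: e_def algebra_simps)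
    then have "\<bar>lw \<beta> (Suc j) b - gauss \<beta> (real (Suc j)) (real b)\<bar>
        \<le> (?c + C * (real j * sqrt \<beta>) * ?\<phi> b) + (C * \<beta> + (\<epsilon> * sqrt \<beta> + C * sqrt \<beta> * ?\<phi> b))"
      using 1 2 3 4 5 by linarith
    also have "\<dots> = \<epsilon> + C * \<beta> + real (Suc j) * (\<epsilon> * sqrt \<beta> + C * \<beta>) + C * (real (Suc j) * sqrt \<beta>) * ?\<phi> b"
      by (simp add: algebra_simps)
    finally show ?case .
  qed
  then show ?thesis using \<theta> C(1) by blast
qed

text \<open>The function \<open>min 1 (exp (c - sqrt \<beta> * z))\<close> is a supersolution: a step multiplies the exponential by
\<open>exp (C' * sqrt \<beta>)\<close> at most, and where the minimum is below \<open>1\<close> the discount \<open>exp (- 2 * \<beta> * z)\<close>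
makes up for this factor.\<close>

lemma right_transform_decay:
  "\<exists>c \<beta>\<^sub>1. 0 < \<beta>\<^sub>1 \<and> (\<forall>\<beta>>0. \<beta> \<le> \<beta>\<^sub>1 \<longrightarrow> (\<forall>z. lw \<beta> 0 z \<le> exp (c - sqrt \<beta> * real z)))"
proof -
  define C' where "C' = 1 / 2 + C\<^sub>0 / \<theta>\<^sub>0"
  have C': "0 < C'" using C\<^sub>0_pos \<theta>\<^sub>0_pos by (simp add: C'_def add_pos_pos)
  have "lw \<beta> 0 z \<le> exp (C' / 2 - sqrt \<beta> * real z)" if \<beta>: "0 < \<beta>" "\<beta> \<le> \<theta>\<^sub>0\<^sup>2" for \<beta> z
  proof -
    define \<theta> where "\<theta> = sqrt \<beta>"
    have \<theta>: "0 < \<theta>" "\<theta> \<le> \<theta>\<^sub>0" "\<theta> * \<theta> = \<beta>"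
      using \<beta> \<theta>\<^sub>0_pos by (auto simp: \<theta>_def intro: real_le_lsqrt)
    define G where "G z = min 1 (exp (C' / 2 - \<theta> * real z))" for z
    have G: "0 \<le> G z" "G z \<le> 1" for z by (auto simp: G_def)
    have iG: "integrable (measure_pmf q) G" for q by (rule integrable_pmf_bounded[of _ 1]) (use G in auto)
    have il: "integrable (measure_pmf q) (lw \<beta> 0)" for q using \<beta> by (intro integrable_lw) simp
    have lwb: "0 \<le> lw \<beta> 0 z" "lw \<beta> 0 z \<le> 1" for z using lw_bounds[of \<beta>] \<beta> by auto
    have super: "exp (- (2 * \<beta> * real z)) * E z G \<le> G z" for z
    proof (cases "\<theta> * real z \<le> C' / 2")
      case True
      have "E z G \<le> 1" by (intro measure_pmf.integral_le_const iG) (use G in auto)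
      moreover have "0 \<le> E z G" using G by simp
      ultimately have "exp (- (2 * \<beta> * real z)) * E z G \<le> 1" using \<beta> by (intro mult_le_one) auto
      then show ?thesis using True by (simp add: G_def)
    next
      case False
      define a where "a = exp (C' / 2 - \<theta> * real z) * exp (\<theta> / 2)"
      have ptw: "G u \<le> a * (1 + \<theta> / \<theta>\<^sub>0 * exp (\<theta>\<^sub>0 * \<bar>dev z u\<bar>))" for u
      proof -
        have "exp (- (\<theta> * dev z u)) \<le> exp ((\<theta> / \<theta>\<^sub>0) * (\<theta>\<^sub>0 * \<bar>dev z u\<bar>))"
          using \<theta> \<theta>\<^sub>0_pos by (simp add: abs_if)
        also have "\<dots> \<le> 1 + \<theta> / \<theta>\<^sub>0 * exp (\<theta>\<^sub>0 * \<bar>dev z u\<bar>)"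
          using \<theta> \<theta>\<^sub>0_pos by (intro exp_le_convex) auto
        finally have *: "exp (- (\<theta> * dev z u)) \<le> 1 + \<theta> / \<theta>\<^sub>0 * exp (\<theta>\<^sub>0 * \<bar>dev z u\<bar>)" .
        have "G u \<le> exp (C' / 2 - \<theta> * real u)" by (simp add: G_def)
        also have "\<dots> = a * exp (- (\<theta> * dev z u))"
          by (simp add: a_def dev_def algebra_simps flip: exp_add)
        also have "\<dots> \<le> a * (1 + \<theta> / \<theta>\<^sub>0 * exp (\<theta>\<^sub>0 * \<bar>dev z u\<bar>))"
          by (intro mult_left_mono *) (simp add: a_def)
        finally show ?thesis .
      qed
      have "E z G \<le> E z (\<lambda>u. a * (1 + \<theta> / \<theta>\<^sub>0 * exp (\<theta>\<^sub>0 * \<bar>dev z u\<bar>)))"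
        using ptw iG integrable_exp[of z] by (intro integral_mono) auto
      also have "\<dots> = a * (1 + \<theta> / \<theta>\<^sub>0 * E z (\<lambda>u. exp (\<theta>\<^sub>0 * \<bar>dev z u\<bar>)))"
        using integrable_exp[of z] by simp
      also have "\<dots> \<le> a * (1 + \<theta> / \<theta>\<^sub>0 * C\<^sub>0)"
        using \<theta> \<theta>\<^sub>0_pos expectation_exp_le[of z]
        by (intro mult_left_mono add_left_mono) (auto simp: a_def)
      also have "\<dots> \<le> a * exp (\<theta> / \<theta>\<^sub>0 * C\<^sub>0)"
        by (intro mult_left_mono exp_ge_add_one_self) (simp add: a_def)
      finally have "exp (- (2 * \<beta> * real z)) * E z G \<le> exp (- (2 * \<beta> * real z)) * (a * exp (\<theta> / \<theta>\<^sub>0 * C\<^sub>0))"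
        by (intro mult_left_mono) auto
      also have "\<dots> = exp (C' / 2 - \<theta> * real z + (\<theta> * C' - 2 * \<beta> * real z))"
        by (simp add: a_def C'_def algebra_simps flip: exp_add)
      also have "\<dots> \<le> exp (C' / 2 - \<theta> * real z)"
      proof -
        have "\<theta> * C' \<le> \<theta> * (2 * (\<theta> * real z))" using False \<theta> by (intro mult_left_mono) auto
        also have "\<dots> = 2 * \<beta> * real z" using \<theta>(3) by (simp add: algebra_simps)
        finally show ?thesis by simp
      qed
      finally show ?thesis using False by (simp add: G_def)
    qed
    have "lw \<beta> 0 z - G z \<le> 0"
    proof (rule comparison[OF \<beta>(1), of "\<lambda>z. lw \<beta> 0 z - G z"])
      show "\<bar>lw \<beta> 0 z - G z\<bar> \<le> 1" for z using G[of z] lwb[of z] by (auto simp: abs_le_iff)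
      show "lw \<beta> 0 0 - G 0 \<le> 0" using lw_0_0[of \<beta>] \<beta> C' by (simp add: G_def)
      show "lw \<beta> 0 z - G z \<le> exp (- (2 * \<beta> * real z)) * E z (\<lambda>z. lw \<beta> 0 z - G z)" for z
        using super[of z] lw_0_step[of \<beta> z] \<beta> iG il by (simp add: right_diff_distrib)
    qed
    then show ?thesis by (simp add: G_def \<theta>_def)
  qed
  moreover have "0 < \<theta>\<^sub>0\<^sup>2" using \<theta>\<^sub>0_pos by simp
  ultimately show ?thesis by blast
qed

end

section \<open>Joint law of the position and the local times\<close>

text \<open>The probability that the first \<open>u + d\<close> exits from a site consist of \<open>u\<close> up and \<open>d\<close> down exits,
decomposed according to the last exit.\<close>

fun site_prob :: "(int \<Rightarrow> real) \<Rightarrow> nat \<Rightarrow> nat \<Rightarrow> real" where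
  "site_prob w 0 0 = 1"
| "site_prob w (Suc u) 0 = site_prob w u 0 * up_prob w (int u)"
| "site_prob w 0 (Suc d) = site_prob w 0 d * up_prob w (int d)"
| "site_prob w (Suc u) (Suc d) = site_prob w u (Suc d) * up_prob w (int u - int (Suc d))
     + site_prob w (Suc u) d * up_prob w (int d - int (Suc u))"

text \<open>The part of \<open>site_prob w u d\<close> in which the last exit is an up exit. The value for \<open>u = 0\<close> is
chosen so that unvisited sites contribute the factor \<open>1\<close>. The part with a last down exit is
\<open>exit_prob w d u\<close>, by symmetry.\<close>

definition exit_prob :: "(int \<Rightarrow> real) \<Rightarrow> nat \<Rightarrow> nat \<Rightarrow> real" where
  "exit_prob w u d = (case u of 0 \<Rightarrow> of_bool (d = 0)
     | Suc v \<Rightarrow> site_prob w v d * up_prob w (int v - int d))"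

lemma exit_prob_simps [simp]:
  "exit_prob w 0 d = of_bool (d = 0)"
  "exit_prob w (Suc u) d = site_prob w u d * up_prob w (int u - int d)"
  by (simp_all add: exit_prob_def)

lemma site_prob_commute: "site_prob w u d = site_prob w d u"
  by (induction w u d rule: site_prob.induct) simp_all

lemma site_prob_eq_exit:
  "0 < u \<or> 0 < d \<Longrightarrow> site_prob w u d = exit_prob w u d + exit_prob w d u"
  by (cases u; cases d) (simp_all add: site_prob_commute)

text \<open>The probability that the difference climbs from \<open>b\<close> to \<open>y\<close> by up exits only.\<close>

definition reach_prob :: "(int \<Rightarrow> real) \<Rightarrow> int \<Rightarrow> int \<Rightarrow> real" where
  "reach_prob w b y = (if b \<le> y then \<Prod>i<nat (y - b). up_prob w (b + int i) else 0)"

context repelling_weight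
begin

lemma site_prob_nonneg: "0 \<le> site_prob w u d"
proof (induction "u + d" arbitrary: u d)
  case 0
  then show ?case by simp
next
  case (Suc n)
  show ?case
    by (cases u; cases d) (use Suc in \<open>auto intro!: add_nonneg_nonneg mult_nonneg_nonneg simp del: of_nat_Suc\<close>)
qed

lemma pmf_down_kernel_reach: "pmf (down_kernel w b) y = reach_prob w b (y + 1) * p (- (y + 1))"
  by (simp add: pmf_down_kernel reach_prob_def)

lemma reach_prob_Suc: "reach_prob w b (y + 1) = reach_prob w b y * p y + of_bool (b = y + 1)"
proof -
  consider "b = y + 1" | "y + 1 < b" | "b \<le> y" by linarith
  then show ?thesis
  proof cases
    case 3
    then have "nat (y + 1 - b) = Suc (nat (y - b))" by auto
    then show ?thesis using 3 by (simp add: reach_prob_def)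
  qed (auto simp: reach_prob_def)
qed

lemma reach_prob_bounds: "0 \<le> reach_prob w b y \<and> reach_prob w b y \<le> 1"
  by (auto simp: reach_prob_def intro!: prod_nonneg prod_le_1 less_imp_le[OF p_less_1])

text \<open>By the symmetry between up and down, \<open>exit_prob w z u\<close> is also the probability that \<open>u\<close> up exits
precede the \<open>z\<close>-th down exit. Splitting at the preceding down exit gives the recursion of
the chain of differences after down exits.\<close>

lemma exit_prob_eq_iter_kernel:
  "exit_prob w z u = pmf (iter_kernel (down_kernel w) z 0) (int u - int z)"
proof (induction z arbitrary: u)
  case 0
  show ?case by (simp add: indicator_def)
next
  case (Suc z)
  let ?B = "iter_kernel (down_kernel w) z 0"
  have ir: "integrable ?B (\<lambda>b. reach_prob w b y)" for y
    by (rule integrable_pmf_bounded[of _ 1]) (use reach_prob_bounds[of _ y] in auto)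
  have ii: "integrable ?B (\<lambda>b. of_bool (b = y) :: real)" for y :: int
    by (rule integrable_pmf_bounded[of _ 1]) auto
  have ei: "measure_pmf.expectation ?B (\<lambda>b. of_bool (b = y)) = pmf ?B y" for y
  proof -
    have "measure_pmf.expectation ?B (\<lambda>b. of_bool (b = y)) = measure_pmf.expectation ?B (indicator {y})"
      by (intro Bochner_Integration.integral_cong) (auto simp: indicator_def)
    also have "\<dots> = pmf ?B y" by (simp add: measure_pmf_single)
    finally show ?thesis .
  qed
  have site: "site_prob w z u = measure_pmf.expectation ?B (\<lambda>b. reach_prob w b (int u - int z))" for u
  proof (induction u)
    case 0
    have "measure_pmf.expectation ?B (\<lambda>b. reach_prob w b (- int z))
        = measure_pmf.expectation ?B (\<lambda>b. of_bool (b = - int z))"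
    proof (rule integral_cong_AE)
      show "AE b in ?B. reach_prob w b (- int z) = of_bool (b = - int z)"
        by (rule AE_pmfI) (auto dest!: iter_down_kernel_ge simp: reach_prob_def)
    qed auto
    also have "\<dots> = exit_prob w z 0" using Suc.IH[of 0] by (simp add: ei)
    also have "\<dots> = site_prob w z 0" by (cases z) auto
    finally show ?case by simp
  next
    case (Suc u)
    have "measure_pmf.expectation ?B (\<lambda>b. reach_prob w b (int (Suc u) - int z))
        = measure_pmf.expectation ?B (\<lambda>b. reach_prob w b (int u - int z) * p (int u - int z) + of_bool (b = int (Suc u) - int z))"
      using reach_prob_Suc[of _ "int u - int z"] by (simp add: algebra_simps)
    also have "\<dots> = site_prob w z u * p (int u - int z) + exit_prob w z (Suc u)"
      using ir ii by (simp only: Bochner_Integration.integral_add integrable_mult_left integral_mult_left_zero ei Suc.IH \<open>\<And>u. exit_prob w z u = pmf ?B (int u - int z)\<close>)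
    also have "\<dots> = site_prob w z (Suc u)"
      using site_prob_eq_exit[of z "Suc u" w] by (simp add: site_prob_commute[of w u z])
    finally show ?case by simp
  qed
  have "pmf (iter_kernel (down_kernel w) (Suc z) 0) (int u - int (Suc z))
      = measure_pmf.expectation ?B (\<lambda>b. reach_prob w b (int u - int z) * p (int z - int u))"
    by (simp add: pmf_bind pmf_down_kernel_reach)
  also have "\<dots> = exit_prob w (Suc z) u" by (simp add: site)
  finally show ?case by simp
qed

lemma exit_prob_eq_ups_law: "exit_prob w z u = pmf (ups_law w z) u"
proof -
  let ?B = "iter_kernel (down_kernel w) z 0"
  have "pmf (ups_law w z) u = measure ?B ((\<lambda>b. nat (b + int z)) -` {u})"
    by (simp add: ups_law_def pmf_map)
  also have "\<dots> = measure ?B {int u - int z}"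
    by (rule measure_pmf.finite_measure_eq_AE) (auto intro!: AE_pmfI dest!: iter_down_kernel_ge)
  finally show ?thesis by (simp add: exit_prob_eq_iter_kernel measure_pmf_single)
qed

end

text \<open>Conservation of crossings: along a path from \<open>0\<close> to \<open>k\<close>, the edge from \<open>j\<close> to \<open>j + 1\<close> is crossed
upwards once more than downwards if it lies between \<open>0\<close> and \<open>k > 0\<close>, once less if it lies between
\<open>k < 0\<close> and \<open>0\<close>, and equally often otherwise.\<close>

definition local_flow :: "int \<Rightarrow> (int \<Rightarrow> nat) \<Rightarrow> (int \<Rightarrow> nat) \<Rightarrow> bool" where
  "local_flow k u d \<longleftrightarrow> (\<forall>j. int (u j) - int (d (j + 1)) = of_bool (0 \<le> j \<and> j < k) - of_bool (k \<le> j \<and> j < 0))"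

definition site_factor :: "(int \<Rightarrow> real) \<Rightarrow> int \<Rightarrow> (int \<Rightarrow> nat) \<Rightarrow> (int \<Rightarrow> nat) \<Rightarrow> int \<Rightarrow> real" where
  "site_factor w k u d j = (if j < k then exit_prob w (u j) (d j)
     else if k < j then exit_prob w (d j) (u j) else site_prob w (u j) (d j))"

lemma local_time_plus_Suc:
  "local_time_plus q (Suc n) k = local_time_plus q n k + of_bool (q n = k \<and> q (Suc n) = k + 1)"
proof -
  have "{j. j < Suc n \<and> q j = k \<and> q (Suc j) = k + 1} =
      {j. j < n \<and> q j = k \<and> q (Suc j) = k + 1} \<union> (if q n = k \<and> q (Suc n) = k + 1 then {n} else {})"
    by (auto simp: less_Suc_eq)
  then show ?thesis by (simp add: local_time_plus_def card_insert_if)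
qed

lemma local_time_minus_Suc:
  "local_time_minus q (Suc n) k = local_time_minus q n k + of_bool (q n = k \<and> q (Suc n) = k - 1)"
proof -
  have "{j. j < Suc n \<and> q j = k \<and> q (Suc j) = k - 1} =
      {j. j < n \<and> q j = k \<and> q (Suc j) = k - 1} \<union> (if q n = k \<and> q (Suc n) = k - 1 then {n} else {})"
    by (auto simp: less_Suc_eq)
  then show ?thesis by (simp add: local_time_minus_def card_insert_if)
qed

lemma local_time_0 [simp]: "local_time_plus q 0 k = 0" "local_time_minus q 0 k = 0"
  by (simp_all add: local_time_plus_def local_time_minus_def)

lemma local_time_cong:
  assumes "\<And>j. j \<le> n \<Longrightarrow> q j = q' j"
  shows "local_time_plus q n k = local_time_plus q' n k" "local_time_minus q n k = local_time_minus q' n k"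
  unfolding local_time_plus_def local_time_minus_def using assms
  by (auto intro!: arg_cong[where f = card] simp: Suc_le_eq)

sublocale self_repelling_walk \<subseteq> repelling_weight w
  by unfold_locales (rule weight)

context self_repelling_walk
begin

abbreviation "traj \<omega> \<equiv> (\<lambda>i. X i \<omega>)"

definition state_event :: "nat \<Rightarrow> int \<Rightarrow> (int \<Rightarrow> nat) \<Rightarrow> (int \<Rightarrow> nat) \<Rightarrow> 'a set" where
  "state_event n k u d = {\<omega> \<in> space M. X n \<omega> = k \<and>
     (\<forall>j. local_time_plus (traj \<omega>) n j = u j) \<and> (\<forall>j. local_time_minus (traj \<omega>) n j = d j)}"

lemma space_history [simp]: "space (history M X n) = space M"
  unfolding history_def by (rule space_measure_of_conv)

lemma sets_history: "sets (history M X n) = sigma_sets (space M) {X j -` B \<inter> space M | j B. j \<le> n}"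
  unfolding history_def by (rule sets_measure_of) auto

lemma subalgebra_history: "subalgebra M (history M X n)"
proof -
  have "{X j -` B \<inter> space M | j B. j \<le> n} \<subseteq> sets M"
    using measurable_walk by (auto intro: measurable_sets)
  then show ?thesis
    unfolding subalgebra_def sets_history by (auto intro: sets.sigma_sets_subset[THEN subsetD])
qed

text \<open>A path up to time \<open>n\<close> takes only countably many values, so every property of it is measurable with
respect to the history.\<close>

lemma history_event:
  assumes "\<And>q q'. (\<And>j. j \<le> n \<Longrightarrow> q j = q' j) \<Longrightarrow> P q = P q'"
  shows "{\<omega> \<in> space M. P (traj \<omega>)} \<in> sets (history M X n)"
proof -
  let ?f = "\<lambda>l :: int list. \<lambda>j. if j \<le> n then l ! j else 0"
  let ?L = "{l. length l = Suc n \<and> P (?f l)}"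
  have "{\<omega> \<in> space M. P (traj \<omega>)} = (\<Union>l\<in>?L. \<Inter>j\<in>{..n}. X j -` {l ! j} \<inter> space M)"
  proof (intro set_eqI iffI)
    fix \<omega> assume "\<omega> \<in> {\<omega> \<in> space M. P (traj \<omega>)}"
    moreover define l where "l = map (traj \<omega>) [0..<Suc n]"
    moreover have "P (?f l) = P (traj \<omega>)" by (rule assms) (auto simp: l_def nth_append simp del: upt_Suc)
    ultimately show "\<omega> \<in> (\<Union>l\<in>?L. \<Inter>j\<in>{..n}. X j -` {l ! j} \<inter> space M)"
      by (intro UN_I[of l]) (auto simp del: upt_Suc)
  next
    fix \<omega> assume "\<omega> \<in> (\<Union>l\<in>?L. \<Inter>j\<in>{..n}. X j -` {l ! j} \<inter> space M)"
    then obtain l where l: "l \<in> ?L" "\<omega> \<in> space M" "\<And>j. j \<le> n \<Longrightarrow> X j \<omega> = l ! j" by auto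
    moreover have "P (?f l) = P (traj \<omega>)" by (rule assms) (use l in auto)
    ultimately show "\<omega> \<in> {\<omega> \<in> space M. P (traj \<omega>)}" by auto
  qed
  moreover have "(\<Union>l\<in>?L. \<Inter>j\<in>{..n}. X j -` {l ! j} \<inter> space M) \<in> sets (history M X n)"
  proof (rule sets.countable_UN''[OF countableI_type])
    fix l
    have "X j -` {l ! j} \<inter> space M \<in> sets (history M X n)" if "j \<in> {..n}" for j
      unfolding sets_history using that by (intro sigma_sets.Basic) auto
    then show "(\<Inter>j\<in>{..n}. X j -` {l ! j} \<inter> space M) \<in> sets (history M X n)"
      by (intro sets.finite_INT) auto
  qed
  ultimately show ?thesis by simp
qed

lemma state_event_history: "state_event n k u d \<in> sets (history M X n)"
proof -
  have "state_event n k u d = {\<omega> \<in> space M. (\<lambda>q. q n = k \<and>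
     (\<forall>j. local_time_plus q n j = u j) \<and> (\<forall>j. local_time_minus q n j = d j)) (traj \<omega>)}"
    by (simp add: state_event_def)
  also have "\<dots> \<in> sets (history M X n)"
  proof (rule history_event)
    fix q q' :: "nat \<Rightarrow> int" assume "\<And>j. j \<le> n \<Longrightarrow> q j = q' j"
    then show "(q n = k \<and> (\<forall>j. local_time_plus q n j = u j) \<and> (\<forall>j. local_time_minus q n j = d j)) =
      (q' n = k \<and> (\<forall>j. local_time_plus q' n j = u j) \<and> (\<forall>j. local_time_minus q' n j = d j))"
      using local_time_cong[of n q q'] by simp
  qed
  finally show ?thesis .
qed

lemma state_event_sets [measurable]: "state_event n k u d \<in> sets M"
  using state_event_history subalgebra_history unfolding subalgebra_def by blast

lemma step_sets [measurable]: "{\<omega> \<in> space M. X (Suc n) \<omega> = X n \<omega> + c} \<in> sets M"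
proof -
  have [measurable]: "X n \<in> measurable M (count_space UNIV)" "X (Suc n) \<in> measurable M (count_space UNIV)"
    by (rule measurable_walk)+
  show ?thesis by measurable
qed

text \<open>The defining property of the conditional expectation, for an event on which it is constant.\<close>

lemma measure_step:
  assumes A: "A \<in> sets (history M X n)" and B: "B \<in> sets M"
    and c: "AE \<omega> in M. \<omega> \<in> A \<longrightarrow> real_cond_exp M (history M X n) (indicat_real B) \<omega> = c"
  shows "measure M (A \<inter> B) = measure M A * c"
proof -
  interpret finite_measure_subalgebra M "history M X n"
    by unfold_locales (rule subalgebra_history)
  have AM: "A \<in> sets M" using A subalgebra_history by (auto simp: subalgebra_def)
  have "measure M (A \<inter> B) = (\<integral>\<omega>\<in>A. indicat_real B \<omega> \<partial>M)"
    using AM B by (simp add: set_lebesgue_integral_def flip: indicator_inter_arith)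
  also have "\<dots> = (\<integral>\<omega>\<in>A. real_cond_exp M (history M X n) (indicat_real B) \<omega> \<partial>M)"
    using A B by (intro real_cond_exp_intA integrable_const_bound[of _ 1]) (auto split: split_indicator)
  also have "\<dots> = (\<integral>\<omega>\<in>A. c \<partial>M)"
    unfolding set_lebesgue_integral_def using AM c
    by (intro integral_cong_AE) (auto split: split_indicator)
  also have "\<dots> = measure M A * c"
    using AM by (simp add: set_lebesgue_integral_def)
  finally show ?thesis .
qed

lemma local_drift_state:
  "\<omega> \<in> state_event n k u d \<Longrightarrow> local_drift (traj \<omega>) n = int (u k) - int (d k)"
  by (auto simp: state_event_def local_drift_def)

lemma state_event_step_up:
  "measure M (state_event n k u d \<inter> {\<omega> \<in> space M. X (Suc n) \<omega> = X n \<omega> + 1})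
     = measure M (state_event n k u d) * p (int (u k) - int (d k))"
proof (rule measure_step[OF state_event_history step_sets])
  show "AE \<omega> in M. \<omega> \<in> state_event n k u d \<longrightarrow> real_cond_exp M (history M X n)
      (indicat_real {\<omega> \<in> space M. X (Suc n) \<omega> = X n \<omega> + 1}) \<omega> = p (int (u k) - int (d k))"
    using step_right[of n] by eventually_elim (auto simp: local_drift_state up_prob_def Let_def)
qed

lemma state_event_step_down:
  "measure M (state_event n k u d \<inter> {\<omega> \<in> space M. X (Suc n) \<omega> = X n \<omega> + (- 1)})
     = measure M (state_event n k u d) * p (int (d k) - int (u k))"
proof (rule measure_step[OF state_event_history step_sets])
  show "AE \<omega> in M. \<omega> \<in> state_event n k u d \<longrightarrow> real_cond_exp M (history M X n)
      (indicat_real {\<omega> \<in> space M. X (Suc n) \<omega> = X n \<omega> + (- 1)}) \<omega> = p (int (d k) - int (u k))"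
    using step_left[of n] by eventually_elim (auto simp: local_drift_state up_prob_def Let_def add.commute)
qed

lemma local_flow_pred_up:
  "local_flow k u d \<Longrightarrow> 0 < u (k - 1) \<Longrightarrow> local_flow (k - 1) (u(k - 1 := u (k - 1) - 1)) d"
  unfolding local_flow_def
proof
  fix j assume "\<forall>j. int (u j) - int (d (j + 1)) = of_bool (0 \<le> j \<and> j < k) - of_bool (k \<le> j \<and> j < 0)" "0 < u (k - 1)"
  note * = this(1)[rule_format, of j] this(2)
  show "int ((u(k - 1 := u (k - 1) - 1)) j) - int (d (j + 1)) = of_bool (0 \<le> j \<and> j < k - 1) - of_bool (k - 1 \<le> j \<and> j < 0)"
    using * by (cases "j = k - 1") (auto simp: of_nat_diff of_bool_def split: if_splits)
qed

lemma local_flow_pred_down: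
  "local_flow k u d \<Longrightarrow> 0 < d (k + 1) \<Longrightarrow> local_flow (k + 1) u (d(k + 1 := d (k + 1) - 1))"
  unfolding local_flow_def
proof
  fix j assume "\<forall>j. int (u j) - int (d (j + 1)) = of_bool (0 \<le> j \<and> j < k) - of_bool (k \<le> j \<and> j < 0)" "0 < d (k + 1)"
  note * = this(1)[rule_format, of j] this(2)
  show "int (u j) - int ((d(k + 1 := d (k + 1) - 1)) (j + 1)) = of_bool (0 \<le> j \<and> j < k + 1) - of_bool (k + 1 \<le> j \<and> j < 0)"
    using * by (cases "j = k") (auto simp: of_nat_diff of_bool_def split: if_splits)
qed

text \<open>If the walk is at \<open>0\<close> and has never left \<open>0\<close>, then a profile of positive weight is zero: by the
conservation law no crossing reaches the neighbours of \<open>0\<close>, which are therefore not left in the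
direction away from \<open>0\<close> either, and so on. Profiles with disconnected loops have weight zero.\<close>

lemma chain_zero:
  assumes flow: "local_flow 0 u d" and u0: "u 0 = 0" and d0: "d 0 = 0"
    and nonzero: "\<And>j. j \<in> I \<Longrightarrow> site_factor w 0 u d j \<noteq> 0"
    and supp: "\<And>j. j \<notin> I \<Longrightarrow> u j = 0 \<and> d j = 0"
  shows "u j = 0" "d j = 0"
proof -
  have fl: "u j = d (j + 1)" for j using flow[unfolded local_flow_def, rule_format, of j] by auto
  have "u (int m) = 0 \<and> d (int m) = 0" for m
  proof (induction m)
    case (Suc m)
    then have d: "d (int (Suc m)) = 0" using fl[of "int m"] by (simp add: add.commute)
    have "u (int (Suc m)) = 0"
    proof (cases "int (Suc m) \<in> I")
      case True
      from nonzero[OF True] d show ?thesis by (simp add: site_factor_def split: if_splits)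
    qed (use supp in auto)
    with d show ?case by simp
  qed (use u0 d0 in auto)
  moreover have "u (- int m) = 0 \<and> d (- int m) = 0" for m
  proof (induction m)
    case (Suc m)
    then have u: "u (- int (Suc m)) = 0" using fl[of "- int (Suc m)"] by simp
    have "d (- int (Suc m)) = 0"
    proof (cases "- int (Suc m) \<in> I")
      case True
      from nonzero[OF True] u show ?thesis by (simp add: site_factor_def split: if_splits)
    qed (use supp in auto)
    with u show ?case by simp
  qed (use u0 d0 in auto)
  ultimately show "u j = 0" "d j = 0" by (metis int_cases2)+
qed

lemma state_event_0:
  assumes flow: "local_flow k u d" and fin: "finite I" and supp: "\<And>j. j \<notin> I \<Longrightarrow> u j = 0 \<and> d j = 0"
  shows "measure M (state_event 0 k u d) = (if (\<Sum>j\<in>I. u j + d j) = 0 then \<Prod>j\<in>I. site_factor w k u d j else 0)"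
proof (cases "(\<Sum>j\<in>I. u j + d j) = 0")
  case True
  then have z: "u j = 0" "d j = 0" for j using fin supp by (cases "j \<in> I"; auto)+
  have k: "k = 0"
    using flow[unfolded local_flow_def, rule_format, of 0] flow[unfolded local_flow_def, rule_format, of "- 1"] z
    by (auto simp: of_bool_def split: if_splits)
  have "prob (state_event 0 k u d) = 1"
    using start state_event_sets[of 0 k u d] by (subst prob_eq_1) (auto simp: state_event_def z k)
  moreover have "site_factor w k u d j = 1" for j by (simp add: site_factor_def z)
  ultimately show ?thesis using True by simp
next
  case False
  then obtain j where "u j \<noteq> 0 \<or> d j \<noteq> 0" using fin by auto
  then have "state_event 0 k u d = {}" by (auto simp: state_event_def)
  then show ?thesis using False by simp
qed

text \<open>The last step came either from below or from above.\<close>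

lemma state_event_Suc_AE:
  "AE \<omega> in M. \<omega> \<in> state_event (Suc n) k u d \<longleftrightarrow>
     (0 < u (k - 1) \<and> \<omega> \<in> state_event n (k - 1) (u(k - 1 := u (k - 1) - 1)) d \<inter> {\<omega> \<in> space M. X (Suc n) \<omega> = X n \<omega> + 1}) \<or>
     (0 < d (k + 1) \<and> \<omega> \<in> state_event n (k + 1) u (d(k + 1 := d (k + 1) - 1)) \<inter> {\<omega> \<in> space M. X (Suc n) \<omega> = X n \<omega> + (- 1)})"
  using nearest_neighbour[of n] AE_space
proof eventually_elim
  case (elim \<omega>)
  then consider "X (Suc n) \<omega> = X n \<omega> + 1" | "X (Suc n) \<omega> = X n \<omega> - 1" by linarith
  then show ?case
  proof cases
    case 1
    then have inc: "local_time_plus (traj \<omega>) (Suc n) j = local_time_plus (traj \<omega>) n j + of_bool (j = X n \<omega>)"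
      "local_time_minus (traj \<omega>) (Suc n) j = local_time_minus (traj \<omega>) n j" for j
      by (auto simp: local_time_plus_Suc local_time_minus_Suc)
    have "\<omega> \<in> state_event (Suc n) k u d \<longleftrightarrow>
        X n \<omega> = k - 1 \<and> (\<forall>j. local_time_plus (traj \<omega>) n j + of_bool (j = k - 1) = u j) \<and> (\<forall>j. local_time_minus (traj \<omega>) n j = d j)"
      using elim 1 by (auto simp: state_event_def inc)
    also have "\<dots> \<longleftrightarrow> 0 < u (k - 1) \<and> X n \<omega> = k - 1 \<and>
        (\<forall>j. local_time_plus (traj \<omega>) n j = (u(k - 1 := u (k - 1) - 1)) j) \<and> (\<forall>j. local_time_minus (traj \<omega>) n j = d j)"
      by (auto simp: of_bool_def split: if_splits)
    finally show ?thesis using elim 1 by (auto simp: state_event_def)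
  next
    case 2
    then have inc: "local_time_plus (traj \<omega>) (Suc n) j = local_time_plus (traj \<omega>) n j"
      "local_time_minus (traj \<omega>) (Suc n) j = local_time_minus (traj \<omega>) n j + of_bool (j = X n \<omega>)" for j
      by (auto simp: local_time_plus_Suc local_time_minus_Suc)
    have "\<omega> \<in> state_event (Suc n) k u d \<longleftrightarrow>
        X n \<omega> = k + 1 \<and> (\<forall>j. local_time_plus (traj \<omega>) n j = u j) \<and> (\<forall>j. local_time_minus (traj \<omega>) n j + of_bool (j = k + 1) = d j)"
      using elim 2 by (auto simp: state_event_def inc)
    also have "\<dots> \<longleftrightarrow> 0 < d (k + 1) \<and> X n \<omega> = k + 1 \<and>
        (\<forall>j. local_time_plus (traj \<omega>) n j = u j) \<and> (\<forall>j. local_time_minus (traj \<omega>) n j = (d(k + 1 := d (k + 1) - 1)) j)"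
      by (auto simp: of_bool_def split: if_splits)
    finally show ?thesis using elim 2 by (auto simp: state_event_def)
  qed
qed

text \<open>Induction over time. The last step enters \<open>k\<close> either upwards from \<open>k - 1\<close> or downwards from
\<open>k + 1\<close>. In the first case the weight of the previous state times the step probability turns the factor
of \<open>k - 1\<close> into that of a site left upwards, while \<open>k\<close> keeps the factor of a site last left downwards.
The second case is symmetric, and by \<open>site_prob_eq_exit\<close> the two contributions add up to the factor
\<open>site_prob\<close> of the current site. The set \<open>I\<close> is any finite window that contains all visited sites.\<close>

lemma state_law:
  assumes "local_flow k u d" and fin: "finite I" and "\<And>j. j \<notin> I \<Longrightarrow> u j = 0 \<and> d j = 0"
  shows "measure M (state_event n k u d) = (if (\<Sum>j\<in>I. u j + d j) = n then \<Prod>j\<in>I. site_factor w k u d j else 0)"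
  using assms(1,3)
proof (induction n arbitrary: k u d)
  case 0
  then show ?case using state_event_0[OF _ fin] by simp
next
  case (Suc n)
  let ?up = "{\<omega> \<in> space M. X (Suc n) \<omega> = X n \<omega> + 1}"
  let ?down = "{\<omega> \<in> space M. X (Suc n) \<omega> = X n \<omega> + (- 1)}"
  let ?u = "u(k - 1 := u (k - 1) - 1)" and ?d = "d(k + 1 := d (k + 1) - 1)"
  define A1 where "A1 = (if 0 < u (k - 1) then state_event n (k - 1) ?u d \<inter> ?up else {})"
  define A2 where "A2 = (if 0 < d (k + 1) then state_event n (k + 1) u ?d \<inter> ?down else {})"
  \<comment> \<open>site factors after a last step upwards (\<open>F1\<close>) and downwards (\<open>F2\<close>); they differ only at \<open>k\<close>\<close>
  define F1 where "F1 j = (if j < k then exit_prob w (u j) (d j) else exit_prob w (d j) (u j))" for j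
  define F2 where "F2 j = (if j \<le> k then exit_prob w (u j) (d j) else exit_prob w (d j) (u j))" for j
  define S where "S = (\<Sum>j\<in>I. u j + d j)"
  have A12 [measurable]: "A1 \<in> sets M" "A2 \<in> sets M"
    using sets.Int[OF state_event_sets step_sets, of n _ _ _ n] by (simp_all only: A1_def A2_def sets.empty_sets split: if_split) simp_all
  have "measure M (state_event (Suc n) k u d) = measure M (A1 \<union> A2)"
  proof (rule finite_measure_eq_AE)
    show "AE \<omega> in M. \<omega> \<in> state_event (Suc n) k u d \<longleftrightarrow> \<omega> \<in> A1 \<union> A2"
      using state_event_Suc_AE[of n k u d] by eventually_elim (simp add: A1_def A2_def)
  qed auto
  also have "\<dots> = measure M A1 + measure M A2"
    by (rule finite_measure_Union[OF A12]) (auto simp: A1_def A2_def state_event_def)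
  finally have split: "measure M (state_event (Suc n) k u d) = measure M A1 + measure M A2" .
  have mA1: "measure M A1 = (if S = Suc n then prod F1 I else 0)" if pos: "0 < u (k - 1)"
  proof -
    have kI: "k - 1 \<in> I" using Suc.prems(2) pos by fastforce
    have sum: "S = Suc (\<Sum>j\<in>I. ?u j + d j)"
      using pos by (simp add: S_def sum.remove[OF fin kI])
    have "measure M A1 = (if S = Suc n then (\<Prod>j\<in>I. site_factor w (k - 1) ?u d j) else 0) * p (int (u (k - 1) - 1) - int (d (k - 1)))"
    proof -
      have supp: "j \<notin> I \<Longrightarrow> ?u j = 0 \<and> d j = 0" for j using Suc.prems(2) by auto
      have law: "measure M (state_event n (k - 1) ?u d)
          = (if (\<Sum>j\<in>I. ?u j + d j) = n then \<Prod>j\<in>I. site_factor w (k - 1) ?u d j else 0)"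
        by (rule Suc.IH[OF local_flow_pred_up[OF Suc.prems(1) pos]]) (rule supp)
      have "(S = Suc n) = ((\<Sum>j\<in>I. ?u j + d j) = n)" unfolding sum by blast
      moreover have "A1 = state_event n (k - 1) ?u d \<inter> ?up" using pos by (simp only: A1_def if_True)
      ultimately show ?thesis
        using state_event_step_up[of n "k - 1" ?u d] law by (simp only: fun_upd_same)
    qed
    moreover have "(\<Prod>j\<in>I. site_factor w (k - 1) ?u d j) * p (int (u (k - 1) - 1) - int (d (k - 1))) = prod F1 I"
    proof -
      obtain v where v: "u (k - 1) = Suc v" using pos by (cases "u (k - 1)") auto
      have "(\<Prod>j\<in>I - {k - 1}. site_factor w (k - 1) ?u d j) = prod F1 (I - {k - 1})"
        by (intro prod.cong) (auto simp: site_factor_def F1_def)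
      then show ?thesis
        by (simp add: prod.remove[OF fin kI] site_factor_def F1_def v)
    qed
    ultimately show ?thesis by simp
  qed
  have mA2: "measure M A2 = (if S = Suc n then prod F2 I else 0)" if pos: "0 < d (k + 1)"
  proof -
    have kI: "k + 1 \<in> I" using Suc.prems(2) pos by fastforce
    have sum: "S = Suc (\<Sum>j\<in>I. u j + ?d j)"
      using pos by (simp add: S_def sum.remove[OF fin kI])
    have "measure M A2 = (if S = Suc n then (\<Prod>j\<in>I. site_factor w (k + 1) u ?d j) else 0) * p (int (d (k + 1) - 1) - int (u (k + 1)))"
    proof -
      have supp: "j \<notin> I \<Longrightarrow> u j = 0 \<and> ?d j = 0" for j using Suc.prems(2) by auto
      have law: "measure M (state_event n (k + 1) u ?d)
          = (if (\<Sum>j\<in>I. u j + ?d j) = n then \<Prod>j\<in>I. site_factor w (k + 1) u ?d j else 0)"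
        by (rule Suc.IH[OF local_flow_pred_down[OF Suc.prems(1) pos]]) (rule supp)
      have "(S = Suc n) = ((\<Sum>j\<in>I. u j + ?d j) = n)" unfolding sum by blast
      moreover have "A2 = state_event n (k + 1) u ?d \<inter> ?down" using pos by (simp only: A2_def if_True)
      ultimately show ?thesis
        using state_event_step_down[of n "k + 1" u ?d] law by (simp only: fun_upd_same)
    qed
    moreover have "(\<Prod>j\<in>I. site_factor w (k + 1) u ?d j) * p (int (d (k + 1) - 1) - int (u (k + 1))) = prod F2 I"
    proof -
      obtain v where v: "d (k + 1) = Suc v" using pos by (cases "d (k + 1)") auto
      have "(\<Prod>j\<in>I - {k + 1}. site_factor w (k + 1) u ?d j) = prod F2 (I - {k + 1})"
        by (intro prod.cong) (auto simp: site_factor_def F2_def)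
      then show ?thesis
        by (simp add: prod.remove[OF fin kI] site_factor_def F2_def v site_prob_commute[of w v])
    qed
    ultimately show ?thesis by simp
  qed
  have flow1: "int (u (k - 1)) - int (d k) = of_bool (0 < k)"
    using Suc.prems(1)[unfolded local_flow_def, rule_format, of "k - 1"] by (auto simp: of_bool_def split: if_splits)
  have flow2: "int (u k) - int (d (k + 1)) = - of_bool (k < 0)"
    using Suc.prems(1)[unfolded local_flow_def, rule_format, of k] by (auto simp: of_bool_def split: if_splits)
  have mA1_0: "measure M A1 = 0" if "u (k - 1) = 0" using that by (simp add: A1_def)
  have mA2_0: "measure M A2 = 0" if "d (k + 1) = 0" using that by (simp add: A2_def)
  have prod_k: "prod G I = G k * prod (site_factor w k u d) (I - {k})"
    if "k \<in> I" "\<And>j. j \<noteq> k \<Longrightarrow> G j = site_factor w k u d j" for G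
    using that by (simp add: prod.remove[OF fin that(1)] cong: prod.cong_simp)
  \<comment> \<open>A site without exits has both \<open>exit_prob\<close> factors equal to \<open>1\<close>. For \<open>k \<noteq> 0\<close> it is entered for the first time, from the side of \<open>0\<close>, so only one of the two contributions occurs. For \<open>k = 0\<close> none occurs, and \<open>chain_zero\<close> shows that the weight vanishes.\<close>
  show ?case
  proof (cases "u k = 0 \<and> d k = 0")
    case False
    then have kI: "k \<in> I" using Suc.prems(2) by blast
    let ?R = "prod (site_factor w k u d) (I - {k})"
    have 1: "prod F1 I = exit_prob w (d k) (u k) * ?R"
      by (subst prod_k[OF kI]) (auto simp: F1_def site_factor_def)
    have 2: "prod F2 I = exit_prob w (u k) (d k) * ?R"
      by (subst prod_k[OF kI]) (auto simp: F2_def site_factor_def)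
    have 3: "prod (site_factor w k u d) I = site_prob w (u k) (d k) * ?R"
      by (subst prod_k[OF kI]) (auto simp: site_factor_def)
    have "prod F1 I = 0" if "u (k - 1) = 0"
    proof -
      have "d k = 0" using flow1 that by (auto simp: of_bool_def split: if_splits)
      then show ?thesis using False by (simp add: 1)
    qed
    moreover have "prod F2 I = 0" if "d (k + 1) = 0"
    proof -
      have "u k = 0" using flow2 that by (auto simp: of_bool_def split: if_splits)
      then show ?thesis using False by (simp add: 2)
    qed
    ultimately have "measure M A1 = (if S = Suc n then prod F1 I else 0)" "measure M A2 = (if S = Suc n then prod F2 I else 0)"
      using mA1 mA2 mA1_0 mA2_0 by (metis gr0I)+
    moreover have "site_prob w (u k) (d k) = exit_prob w (u k) (d k) + exit_prob w (d k) (u k)"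
      using False by (intro site_prob_eq_exit) auto
    ultimately show ?thesis unfolding split by (simp add: 1 2 3 S_def algebra_simps)
  next
    case True
    have Feq: "F1 = site_factor w k u d" "F2 = site_factor w k u d"
      using True by (auto simp: F1_def F2_def site_factor_def fun_eq_iff)
    consider "0 < k" | "k < 0" | "k = 0" by linarith
    then show ?thesis
    proof cases
      case 1
      then have "u (k - 1) = 1" "d (k + 1) = 0" using flow1 flow2 True by auto
      then show ?thesis using mA1 mA2_0 unfolding split by (simp add: Feq S_def)
    next
      case 2
      then have "u (k - 1) = 0" "d (k + 1) = 1" using flow1 flow2 True by auto
      then show ?thesis using mA2 mA1_0 unfolding split by (simp add: Feq S_def)
    next
      case 3
      then have "u (k - 1) = 0" "d (k + 1) = 0" using flow1 flow2 True by auto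
      then have "measure M A1 + measure M A2 = 0" using mA1_0 mA2_0 by simp
      moreover have "prod (site_factor w k u d) I = 0" if S: "S = Suc n"
      proof (rule ccontr)
        assume "prod (site_factor w k u d) I \<noteq> 0"
        then have nz: "\<And>j. j \<in> I \<Longrightarrow> site_factor w 0 u d j \<noteq> 0" using fin 3 by auto
        have "u j = 0 \<and> d j = 0" for j
          using chain_zero[OF Suc.prems(1)[unfolded 3] _ _ nz Suc.prems(2)] True 3 by auto
        then show False using S by (simp add: S_def)
      qed
      ultimately show ?thesis unfolding split by (simp add: S_def)
    qed
  qed
qed

end

section \<open>The Green function of the walk\<close>

lemma nn_integral_count_space_swap:
  "(\<integral>\<^sup>+x. \<integral>\<^sup>+y. f x y \<partial>count_space UNIV \<partial>count_space UNIV)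
     = (\<integral>\<^sup>+y. \<integral>\<^sup>+x. f x y \<partial>count_space UNIV \<partial>count_space UNIV)"
  using nn_integral_fst_count_space[of "\<lambda>(x, y). f x y"] nn_integral_snd_count_space[of "\<lambda>(x, y). f x y"]
  by simp

lemma nn_integral_count_space_point:
  "(\<integral>\<^sup>+y. f y * indicator {a} y \<partial>count_space UNIV) = f a"
  using nn_integral_indicator_singleton[of a "count_space UNIV" f] by simp

lemma nn_integral_fiber:
  "(\<integral>\<^sup>+c. g (\<pi> c) * h c \<partial>count_space UNIV)
     = (\<integral>\<^sup>+a. g a * (\<integral>\<^sup>+c. h c * indicator {a} (\<pi> c) \<partial>count_space UNIV) \<partial>count_space UNIV)"
proof -
  have "(\<integral>\<^sup>+c. g (\<pi> c) * h c \<partial>count_space UNIV)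
      = (\<integral>\<^sup>+c. \<integral>\<^sup>+a. (g a * h c) * indicator {\<pi> c} a \<partial>count_space UNIV \<partial>count_space UNIV)"
    by (simp only: nn_integral_count_space_point)
  also have "\<dots> = (\<integral>\<^sup>+a. \<integral>\<^sup>+c. (g a * h c) * indicator {\<pi> c} a \<partial>count_space UNIV \<partial>count_space UNIV)"
    by (rule nn_integral_count_space_swap)
  also have "\<dots> = (\<integral>\<^sup>+a. \<integral>\<^sup>+c. g a * (h c * indicator {a} (\<pi> c)) \<partial>count_space UNIV \<partial>count_space UNIV)"
    by (intro nn_integral_cong) (auto simp: indicator_def)
  also have "\<dots> = (\<integral>\<^sup>+a. g a * (\<integral>\<^sup>+c. h c * indicator {a} (\<pi> c) \<partial>count_space UNIV) \<partial>count_space UNIV)"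
    by (intro nn_integral_cong nn_integral_cmult) auto
  finally show ?thesis .
qed

definition seqs :: "nat \<Rightarrow> (nat \<Rightarrow> nat) set" where
  "seqs m = {c. \<forall>i\<ge>m. c i = 0}"

text \<open>The discounted weight of a single path of the chain whose expectation is \<open>chain_transform\<close>.\<close>

definition chain_weight :: "(nat \<Rightarrow> nat pmf) \<Rightarrow> real \<Rightarrow> nat \<Rightarrow> nat \<Rightarrow> (nat \<Rightarrow> nat) \<Rightarrow> real" where
  "chain_weight Q \<beta> m k c = (\<Prod>i<m. exp (- \<beta> * (2 * real (c i) + of_bool (i < k))) *
     pmf (Q (c i + of_bool (i < k))) (c (Suc i)))"

lemma chain_weight_nonneg: "0 \<le> chain_weight Q \<beta> m k c"
  unfolding chain_weight_def by (intro prod_nonneg) auto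

lemma chain_weight_Suc:
  "chain_weight Q \<beta> (Suc m) k (case_nat x c) = exp (- \<beta> * (2 * real x + of_bool (0 < k))) *
     pmf (Q (x + of_bool (0 < k))) (c 0) * chain_weight Q \<beta> m (k - 1) c"
proof -
  have "(Suc i < k) = (i < k - 1)" for i by auto
  then show ?thesis unfolding chain_weight_def by (subst prod.lessThan_Suc_shift) simp
qed

lemma seqs_case_nat: "case_nat x c \<in> seqs (Suc m) \<longleftrightarrow> c \<in> seqs m"
proof -
  have "(\<forall>i\<ge>Suc m. case_nat x c i = 0) \<longleftrightarrow> (\<forall>i\<ge>m. c i = 0)"
    by (metis Suc_le_D Suc_le_mono old.nat.simps(5))
  then show ?thesis by (simp add: seqs_def)
qed

lemma countable_seqs: "countable (seqs m)"
proof -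
  have "seqs m \<subseteq> range (\<lambda>l i. if i < length l then l ! i else (0::nat))"
  proof
    fix c assume "c \<in> seqs m"
    then have "c = (\<lambda>i. if i < length (map c [0..<m]) then map c [0..<m] ! i else 0)"
      by (auto simp: seqs_def fun_eq_iff)
    then show "c \<in> range (\<lambda>l i. if i < length l then l ! i else 0)" by (rule range_eqI)
  qed
  then show ?thesis by (rule countable_subset) simp
qed

context balanced_kernel
begin

text \<open>The recursion of \<open>chain_transform\<close> splits off the first step of the path.\<close>

lemma chain_transform_eq_sum:
  assumes \<beta>: "0 \<le> \<beta>"
  shows "ennreal (tw \<beta> m k z) =
     (\<integral>\<^sup>+c. (ennreal (chain_weight Q \<beta> m k c) * indicator (seqs m) c) * indicator {z} (c 0) \<partial>count_space UNIV)"
proof (induction m arbitrary: k z)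
  case 0
  have "(\<integral>\<^sup>+c. (ennreal (chain_weight Q \<beta> 0 k c) * indicator (seqs 0) c) * indicator {z} (c 0) \<partial>count_space UNIV)
      = (\<integral>\<^sup>+c. of_bool (z = 0) * indicator {\<lambda>_. 0} (c :: nat \<Rightarrow> nat) \<partial>count_space UNIV)"
    by (intro nn_integral_cong) (auto simp: chain_weight_def seqs_def indicator_def fun_eq_iff)
  then show ?case by (simp only: nn_integral_count_space_point) simp
next
  case (Suc m)
  define z' where "z' = z + (of_bool (0 < k) :: nat)"
  define e where "e = exp (- \<beta> * (2 * real z + of_bool (0 < k)))"
  define h where "h c = ennreal (chain_weight Q \<beta> m (k - 1) c) * indicator (seqs m) c" for c
  define f where "f c = (ennreal (chain_weight Q \<beta> (Suc m) k c) * indicator (seqs (Suc m)) c) * indicator {z} (c 0)" for c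
  have bij: "bij_betw (\<lambda>(x, c). case_nat x c) UNIV (UNIV :: (nat \<Rightarrow> nat) set)"
    by (rule bij_betwI[where g = "\<lambda>c. (c 0, \<lambda>i. c (Suc i))"]) (auto simp: fun_eq_iff split: nat.splits)
  have f: "f (case_nat x c) = (ennreal e * (ennreal (pmf (Q z') (c 0)) * h c)) * indicator {z} x" for x c
    by (auto simp: f_def h_def chain_weight_Suc seqs_case_nat e_def z'_def indicator_def ennreal_mult chain_weight_nonneg mult.assoc)
  have "(\<integral>\<^sup>+c. f c \<partial>count_space UNIV) = (\<integral>\<^sup>+xc. f ((\<lambda>(x, c). case_nat x c) xc) \<partial>count_space UNIV)"
    by (rule nn_integral_bij_count_space[OF bij, symmetric])
  also have "\<dots> = (\<integral>\<^sup>+x. \<integral>\<^sup>+c. f (case_nat x c) \<partial>count_space UNIV \<partial>count_space UNIV)"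
    by (subst nn_integral_fst_count_space[symmetric]) simp
  also have "\<dots> = (\<integral>\<^sup>+x. (\<integral>\<^sup>+c. ennreal e * (ennreal (pmf (Q z') (c 0)) * h c) \<partial>count_space UNIV) * indicator {z} x \<partial>count_space UNIV)"
    unfolding f by (intro nn_integral_cong nn_integral_multc) auto
  also have "\<dots> = ennreal e * (\<integral>\<^sup>+c. ennreal (pmf (Q z') (c 0)) * h c \<partial>count_space UNIV)"
    unfolding nn_integral_count_space_point by (rule nn_integral_cmult) auto
  also have "(\<integral>\<^sup>+c. ennreal (pmf (Q z') (c 0)) * h c \<partial>count_space UNIV)
      = (\<integral>\<^sup>+y. ennreal (pmf (Q z') y) * (\<integral>\<^sup>+c. h c * indicator {y} (c 0) \<partial>count_space UNIV) \<partial>count_space UNIV)"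
    by (rule nn_integral_fiber[where \<pi> = "\<lambda>c. c 0" and g = "\<lambda>y. ennreal (pmf (Q z') y)"])
  also have "\<dots> = (\<integral>\<^sup>+y. ennreal (tw \<beta> m (k - 1) y) \<partial>Q z')"
    unfolding h_def Suc.IH[symmetric] by (rule nn_integral_measure_pmf[symmetric])
  also have "\<dots> = ennreal (E z' (tw \<beta> m (k - 1)))"
    using tw_bounds[OF \<beta>] by (intro nn_integral_eq_integral integrable_tw \<beta>) auto
  also have "ennreal e * ennreal (E z' (tw \<beta> m (k - 1))) = ennreal (tw \<beta> (Suc m) k z)"
    using tw_bounds[OF \<beta>] by (simp add: e_def z'_def ennreal_mult)
  finally show ?case by (simp add: f_def)
qed

end

lemma sum_around:
  fixes f :: "int \<Rightarrow> 'b::comm_monoid_add"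
  shows "sum f {k - int m..k + int m} = f k + (\<Sum>i<m. f (k + 1 + int i)) + (\<Sum>i<m. f (k - 1 - int i))"
proof (induction m)
  case (Suc m)
  have "{k - int (Suc m)..k + int (Suc m)} = insert (k + 1 + int m) (insert (k - 1 - int m) {k - int m..k + int m})"
    by auto
  then show ?case using Suc by (simp add: ac_simps)
qed simp

lemma prod_around:
  fixes f :: "int \<Rightarrow> 'b::comm_monoid_mult"
  shows "prod f {k - int m..k + int m} = f k * (\<Prod>i<m. f (k + 1 + int i)) * (\<Prod>i<m. f (k - 1 - int i))"
proof (induction m)
  case (Suc m)
  have "{k - int (Suc m)..k + int (Suc m)} = insert (k + 1 + int m) (insert (k - 1 - int m) {k - int m..k + int m})"
    by auto
  then show ?case using Suc by (simp add: ac_simps)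
qed simp

text \<open>Local times seen from the end point \<open>k \<ge> 0\<close>: \<open>R i\<close> is the number of up exits from \<open>k + i\<close> and \<open>L i\<close> the
number of down exits from \<open>k - i\<close>. By conservation of crossings these determine all other local times; on
the edges between \<open>0\<close> and \<open>k\<close> there is one more up crossing than down crossings.\<close>

definition ups_profile :: "nat \<Rightarrow> (nat \<Rightarrow> nat) \<Rightarrow> (nat \<Rightarrow> nat) \<Rightarrow> int \<Rightarrow> nat" where
  "ups_profile k R L j = (if int k \<le> j then R (nat (j - int k))
     else L (nat (int k - 1 - j)) + of_bool (0 \<le> j))"

definition downs_profile :: "nat \<Rightarrow> (nat \<Rightarrow> nat) \<Rightarrow> (nat \<Rightarrow> nat) \<Rightarrow> int \<Rightarrow> nat" where
  "downs_profile k R L j = (if int k < j then R (nat (j - int k - 1)) else L (nat (int k - j)))"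

lemma local_flow_profile: "local_flow (int k) (ups_profile k R L) (downs_profile k R L)"
  unfolding local_flow_def
proof
  fix j
  show "int (ups_profile k R L j) - int (downs_profile k R L (j + 1))
      = of_bool (0 \<le> j \<and> j < int k) - of_bool (int k \<le> j \<and> j < 0)"
    by (cases "int k \<le> j") (auto simp: ups_profile_def downs_profile_def algebra_simps)
qed

lemma profile_of_flow:
  assumes "local_flow (int k) u d"
  shows "ups_profile k (\<lambda>i. u (int k + int i)) (\<lambda>i. d (int k - int i)) = u"
    "downs_profile k (\<lambda>i. u (int k + int i)) (\<lambda>i. d (int k - int i)) = d"
proof -
  note fl = assms[unfolded local_flow_def, rule_format]
  show "ups_profile k (\<lambda>i. u (int k + int i)) (\<lambda>i. d (int k - int i)) = u"
  proof
    fix j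
    show "ups_profile k (\<lambda>i. u (int k + int i)) (\<lambda>i. d (int k - int i)) j = u j"
      using fl[of j] by (cases "int k \<le> j") (auto simp: ups_profile_def of_bool_def add.commute split: if_splits)
  qed
  show "downs_profile k (\<lambda>i. u (int k + int i)) (\<lambda>i. d (int k - int i)) = d"
  proof
    fix j
    show "downs_profile k (\<lambda>i. u (int k + int i)) (\<lambda>i. d (int k - int i)) j = d j"
      using fl[of "j - 1"] by (cases "int k < j") (auto simp: downs_profile_def of_bool_def split: if_splits)
  qed
qed

lemma profile_inj:
  "R i = ups_profile k R L (int k + int i)" "L i = downs_profile k R L (int k - int i)"
  by (simp_all add: ups_profile_def downs_profile_def)

text \<open>The length of a path with the given profile, if the sequences vanish from \<open>m\<close> on.\<close>

definition profile_length :: "nat \<Rightarrow> nat \<Rightarrow> (nat \<Rightarrow> nat) \<Rightarrow> (nat \<Rightarrow> nat) \<Rightarrow> nat" where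
  "profile_length k m R L = (\<Sum>i<m. 2 * R i) + (\<Sum>i<m. 2 * L i + of_bool (i < k))"

lemma local_flow_trajectory:
  assumes "q 0 = 0" "\<And>i. \<bar>q (Suc i) - q i\<bar> = 1"
  shows "local_flow (q n) (local_time_plus q n) (local_time_minus q n)"
proof (induction n)
  case 0
  show ?case using assms(1) by (auto simp: local_flow_def)
next
  case (Suc n)
  from assms(2)[of n] consider "q (Suc n) = q n + 1" | "q (Suc n) = q n - 1" by linarith
  then show ?case
  proof cases
    case 1
    show ?thesis unfolding local_flow_def local_time_plus_Suc local_time_minus_Suc
    proof
      fix j
      show "int (local_time_plus q n j + of_bool (q n = j \<and> q (Suc n) = j + 1)) -
          int (local_time_minus q n (j + 1) + of_bool (q n = j + 1 \<and> q (Suc n) = j + 1 - 1))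
        = of_bool (0 \<le> j \<and> j < q (Suc n)) - of_bool (q (Suc n) \<le> j \<and> j < 0)"
        using Suc[unfolded local_flow_def, rule_format, of j] 1
        by (auto simp: of_bool_def split: if_splits)
    qed
  next
    case 2
    show ?thesis unfolding local_flow_def local_time_plus_Suc local_time_minus_Suc
    proof
      fix j
      show "int (local_time_plus q n j + of_bool (q n = j \<and> q (Suc n) = j + 1)) -
          int (local_time_minus q n (j + 1) + of_bool (q n = j + 1 \<and> q (Suc n) = j + 1 - 1))
        = of_bool (0 \<le> j \<and> j < q (Suc n)) - of_bool (q (Suc n) \<le> j \<and> j < 0)"
        using Suc[unfolded local_flow_def, rule_format, of j] 2
        by (auto simp: of_bool_def split: if_splits)
    qed
  qed
qed

lemma local_time_support:
  assumes "q 0 = 0" "\<And>i. \<bar>q (Suc i) - q i\<bar> = 1" "int n \<le> \<bar>j\<bar>"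
  shows "local_time_plus q n j = 0" "local_time_minus q n j = 0"
proof -
  have "\<bar>q i\<bar> \<le> int i" for i
  proof (induction i)
    case (Suc i)
    then show ?case using assms(2)[of i] by linarith
  qed (use assms in simp)
  then have "q i \<noteq> j" if "i < n" for i using assms(3) that by (smt (verit) of_nat_less_iff)
  then show "local_time_plus q n j = 0" "local_time_minus q n j = 0"
    by (auto simp: local_time_plus_def local_time_minus_def)
qed

lemma (in repelling_weight) balanced_ups_law: "\<exists>\<theta> C. balanced_kernel (ups_law w) \<theta> C"
proof -
  obtain \<theta> C where "\<theta> > 0" "C > 0" "\<And>z. (\<integral>\<^sup>+u. ennreal (exp (\<theta> * \<bar>dev z u\<bar>)) \<partial>ups_law w z) \<le> ennreal C"
    using ups_law_exp_moment by blast
  then have "balanced_kernel (ups_law w) \<theta> C"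
    using ups_law_0 ups_law_mean_tendsto ups_law_pos_0 by unfold_locales
  then show ?thesis by blast
qed

context self_repelling_walk
begin

abbreviation "W \<equiv> chain_weight (ups_law w)"

text \<open>Along each half line the site factors of \<open>state_law\<close> are transition probabilities of the chains
\<open>R\<close> and \<open>L\<close>, and the discount factorizes because the length of the path is the sum of all local times.\<close>

lemma profile_law:
  assumes m: "k \<le> m" and R: "R \<in> seqs m" and L: "L \<in> seqs m"
  shows "ennreal (exp (- \<beta> * real n)) * emeasure M (state_event n (int k) (ups_profile k R L) (downs_profile k R L))
     = ennreal (site_prob w (R 0) (L 0) * W \<beta> m 0 R * W \<beta> m k L) * indicator {profile_length k m R L} n"
proof -
  let ?u = "ups_profile k R L" and ?d = "downs_profile k R L"
  let ?I = "{int k - int m..int k + int m}"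
  have supp: "?u j = 0 \<and> ?d j = 0" if "j \<notin> ?I" for j
    using that R L m by (auto simp: ups_profile_def downs_profile_def seqs_def)
  have at: "?u (int k) = R 0" "?d (int k) = L 0"
    "?u (int k + 1 + int i) = R (Suc i)" "?d (int k + 1 + int i) = R i"
    "?u (int k - 1 - int i) = L i + of_bool (i < k)" "?d (int k - 1 - int i) = L (Suc i)" for i
    by (auto simp: ups_profile_def downs_profile_def nat_add_distrib Suc_nat_eq_nat_zadd1 algebra_simps)
  have total: "(\<Sum>j\<in>?I. ?u j + ?d j) = profile_length k m R L"
  proof -
    have shift: "c 0 + (\<Sum>i<m. c (Suc i)) = (\<Sum>i<m. c i)" if "c \<in> seqs m" for c :: "nat \<Rightarrow> nat"
      using sum.lessThan_Suc_shift[of c m] that by (simp add: seqs_def)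
    have "(\<Sum>j\<in>?I. ?u j + ?d j) = (R 0 + L 0) + (\<Sum>i<m. R (Suc i) + R i) + (\<Sum>i<m. L i + of_bool (i < k) + L (Suc i))"
      unfolding sum_around at ..
    also have "\<dots> = (R 0 + (\<Sum>i<m. R (Suc i))) + (\<Sum>i<m. R i) + ((L 0 + (\<Sum>i<m. L (Suc i))) + (\<Sum>i<m. L i) + (\<Sum>i<m. of_bool (i < k)))"
      by (simp add: sum.distrib)
    also have "\<dots> = profile_length k m R L"
      unfolding shift[OF R] shift[OF L] profile_length_def by (simp add: sum.distrib sum_distrib_left[symmetric])
    finally show ?thesis .
  qed
  define \<Pi>R where "\<Pi>R = (\<Prod>i<m. pmf (ups_law w (R i)) (R (Suc i)))"
  define \<Pi>L where "\<Pi>L = (\<Prod>i<m. pmf (ups_law w (L i + of_bool (i < k))) (L (Suc i)))"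
  have factors: "(\<Prod>j\<in>?I. site_factor w (int k) ?u ?d j) = site_prob w (R 0) (L 0) * \<Pi>R * \<Pi>L"
    unfolding prod_around site_factor_def at \<Pi>R_def \<Pi>L_def exit_prob_eq_ups_law by simp
  have exps: "exp (- \<beta> * real (profile_length k m R L)) * (site_prob w (R 0) (L 0) * \<Pi>R * \<Pi>L)
      = site_prob w (R 0) (L 0) * W \<beta> m 0 R * W \<beta> m k L"
  proof -
    have pe: "(\<Prod>i<m. exp (- \<beta> * f i)) = exp (- \<beta> * (\<Sum>i<m. f i))" for f :: "nat \<Rightarrow> real"
      by (simp only: sum_distrib_left exp_sum finite_lessThan)
    have "real (profile_length k m R L)
        = (\<Sum>i<m. 2 * real (R i) + of_bool (i < 0)) + (\<Sum>i<m. 2 * real (L i) + of_bool (i < k))"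
      by (simp add: profile_length_def)
    then show ?thesis
      unfolding chain_weight_def prod.distrib \<Pi>R_def \<Pi>L_def pe by (simp add: distrib_left) (simp add: mult_exp_exp)
  qed
  have law: "measure M (state_event n (int k) ?u ?d) = (if profile_length k m R L = n then site_prob w (R 0) (L 0) * \<Pi>R * \<Pi>L else 0)"
    using state_law[OF local_flow_profile, of ?I k R L n] supp unfolding total factors by auto
  show ?thesis
    unfolding emeasure_eq_measure law
    by (auto simp: indicator_def exps[symmetric] ennreal_mult'[symmetric])
qed

lemma start_nn_AE: "AE \<omega> in M. X 0 \<omega> = 0 \<and> (\<forall>i. \<bar>X (Suc i) \<omega> - X i \<omega>\<bar> = 1)"
  using start nearest_neighbour by (simp add: AE_all_countable)

text \<open>Truncation to the profiles that vanish from \<open>m\<close> on, which turns the half lines into chains with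
\<open>m\<close> steps. For a fixed time \<open>n\<close> it has no effect once \<open>m > n + k\<close>.\<close>

definition bounded_event :: "nat \<Rightarrow> nat \<Rightarrow> nat \<Rightarrow> 'a set" where
  "bounded_event n k m = (\<Union>RL\<in>seqs m \<times> seqs m.
     state_event n (int k) (ups_profile k (fst RL) (snd RL)) (downs_profile k (fst RL) (snd RL)))"

lemma countable_seqs_pair: "countable (seqs m \<times> seqs m)"
  by (intro countable_SIGMA countable_seqs)

lemma bounded_event_sets [measurable]: "bounded_event n k m \<in> sets M"
  unfolding bounded_event_def by (intro sets.countable_UN'' countable_seqs_pair state_event_sets)

lemma bounded_event_mono: "m \<le> m' \<Longrightarrow> bounded_event n k m \<subseteq> bounded_event n k m'"
  unfolding bounded_event_def seqs_def by (intro UN_mono) auto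

lemma bounded_event_eventually:
  assumes "n + k < m"
  shows "emeasure M (bounded_event n k m) = emeasure M {\<omega> \<in> space M. X n \<omega> = int k}"
proof (rule emeasure_eq_AE)
  show "AE \<omega> in M. \<omega> \<in> bounded_event n k m \<longleftrightarrow> \<omega> \<in> {\<omega> \<in> space M. X n \<omega> = int k}"
    using start_nn_AE AE_space
  proof eventually_elim
    case (elim \<omega>)
    show ?case
    proof
      assume "\<omega> \<in> {\<omega> \<in> space M. X n \<omega> = int k}"
      then have k: "X n \<omega> = int k" by simp
      let ?u = "local_time_plus (traj \<omega>) n" and ?d = "local_time_minus (traj \<omega>) n"
      have "local_flow (int k) ?u ?d"
        using local_flow_trajectory[of "traj \<omega>" n] elim k by simp
      note prof = profile_of_flow[OF this]
      have "(\<lambda>i. ?u (int k + int i)) \<in> seqs m" "(\<lambda>i. ?d (int k - int i)) \<in> seqs m"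
        using local_time_support[of "traj \<omega>" n] elim assms by (auto simp: seqs_def)
      then show "\<omega> \<in> bounded_event n k m"
        unfolding bounded_event_def using elim k prof
        by (intro UN_I[of "(\<lambda>i. ?u (int k + int i), \<lambda>i. ?d (int k - int i))"]) (auto simp: state_event_def)
    qed (auto simp: bounded_event_def state_event_def)
  qed
qed (use measurable_sets[OF measurable_walk, of "{int k}" n] in \<open>auto simp: vimage_def Int_def conj_commute\<close>)

lemma bounded_event_emeasure:
  "emeasure M (bounded_event n k m) = (\<integral>\<^sup>+R. \<integral>\<^sup>+L.
     emeasure M (state_event n (int k) (ups_profile k R L) (downs_profile k R L)) * (indicator (seqs m) R * indicator (seqs m) L)
     \<partial>count_space UNIV \<partial>count_space UNIV)"
proof -
  let ?S = "\<lambda>RL. state_event n (int k) (ups_profile k (fst RL) (snd RL)) (downs_profile k (fst RL) (snd RL))"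
  have "disjoint_family_on ?S (seqs m \<times> seqs m)"
    unfolding disjoint_family_on_def
  proof (intro ballI impI)
    fix a b :: "(nat \<Rightarrow> nat) \<times> (nat \<Rightarrow> nat)" assume ne: "a \<noteq> b"
    show "?S a \<inter> ?S b = {}"
    proof (rule ccontr)
      assume "?S a \<inter> ?S b \<noteq> {}"
      then have "ups_profile k (fst a) (snd a) = ups_profile k (fst b) (snd b)"
        "downs_profile k (fst a) (snd a) = downs_profile k (fst b) (snd b)"
        by (auto simp: state_event_def fun_eq_iff)
      then have "fst a = fst b" "snd a = snd b"
        using profile_inj(1)[of "fst a" _ k "snd a"] profile_inj(1)[of "fst b" _ k "snd b"]
          profile_inj(2)[of "snd a" _ k "fst a"] profile_inj(2)[of "snd b" _ k "fst b"]
        by (auto simp: fun_eq_iff)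
      then show False using ne by (simp add: prod_eq_iff)
    qed
  qed
  then have "emeasure M (bounded_event n k m) = (\<integral>\<^sup>+RL. emeasure M (?S RL) \<partial>count_space (seqs m \<times> seqs m))"
    unfolding bounded_event_def by (intro emeasure_UN_countable countable_seqs_pair) auto
  also have "\<dots> = (\<integral>\<^sup>+RL. emeasure M (?S RL) * indicator (seqs m \<times> seqs m) RL \<partial>count_space UNIV)"
    by (subst nn_integral_count_space_indicator) auto
  also have "\<dots> = (\<integral>\<^sup>+R. \<integral>\<^sup>+L. emeasure M (?S (R, L)) * indicator (seqs m \<times> seqs m) (R, L) \<partial>count_space UNIV \<partial>count_space UNIV)"
    by (rule nn_integral_fst_count_space[symmetric])
  finally show ?thesis by (simp add: indicator_times)
qed

text \<open>Summation over all profiles: the two sequences are linked only through the factor of the site \<open>k\<close>, and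
the sum over each of them, with its first value fixed, is a chain transform.\<close>

lemma bounded_green:
  assumes m: "k \<le> m" and \<beta>: "0 \<le> \<beta>"
  shows "(\<integral>\<^sup>+n. ennreal (exp (- \<beta> * real n)) * emeasure M (bounded_event n k m) \<partial>count_space UNIV)
    = (\<integral>\<^sup>+a. \<integral>\<^sup>+b. ennreal (site_prob w a b * chain_transform (ups_law w) \<beta> m 0 a * chain_transform (ups_law w) \<beta> m k b)
        \<partial>count_space UNIV \<partial>count_space UNIV)"
proof -
  obtain \<theta> C where "balanced_kernel (ups_law w) \<theta> C" using balanced_ups_law by blast
  then interpret balanced_kernel "ups_law w" \<theta> C .
  let ?c = "count_space UNIV"
  let ?ind = "indicator (seqs m) :: (nat \<Rightarrow> nat) \<Rightarrow> ennreal"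
  let ?S = "\<lambda>n R L. state_event n (int k) (ups_profile k R L) (downs_profile k R L)"
  let ?hR = "\<lambda>R. ennreal (W \<beta> m 0 R) * ?ind R" and ?hL = "\<lambda>L. ennreal (W \<beta> m k L) * ?ind L"
  have "(\<integral>\<^sup>+n. ennreal (exp (- \<beta> * real n)) * emeasure M (bounded_event n k m) \<partial>?c)
      = (\<integral>\<^sup>+n. \<integral>\<^sup>+R. \<integral>\<^sup>+L. ennreal (exp (- \<beta> * real n)) * emeasure M (?S n R L) * (?ind R * ?ind L) \<partial>?c \<partial>?c \<partial>?c)"
    unfolding bounded_event_emeasure by (simp add: nn_integral_cmult[symmetric] mult.assoc)
  also have "\<dots> = (\<integral>\<^sup>+R. \<integral>\<^sup>+n. \<integral>\<^sup>+L. ennreal (exp (- \<beta> * real n)) * emeasure M (?S n R L) * (?ind R * ?ind L) \<partial>?c \<partial>?c \<partial>?c)"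
    by (rule nn_integral_count_space_swap)
  also have "\<dots> = (\<integral>\<^sup>+R. \<integral>\<^sup>+L. \<integral>\<^sup>+n. ennreal (exp (- \<beta> * real n)) * emeasure M (?S n R L) * (?ind R * ?ind L) \<partial>?c \<partial>?c \<partial>?c)"
    by (intro nn_integral_cong nn_integral_count_space_swap)
  also have "\<dots> = (\<integral>\<^sup>+R. \<integral>\<^sup>+L. \<integral>\<^sup>+n. (ennreal (site_prob w (R 0) (L 0) * W \<beta> m 0 R * W \<beta> m k L) * (?ind R * ?ind L)) * indicator {profile_length k m R L} n \<partial>?c \<partial>?c \<partial>?c)"
  proof (intro nn_integral_cong)
    fix R L :: "nat \<Rightarrow> nat" and n
    show "ennreal (exp (- \<beta> * real n)) * emeasure M (?S n R L) * (?ind R * ?ind L)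
        = ennreal (site_prob w (R 0) (L 0) * W \<beta> m 0 R * W \<beta> m k L) * (?ind R * ?ind L) * indicator {profile_length k m R L} n"
    proof (cases "R \<in> seqs m \<and> L \<in> seqs m")
      case True
      then show ?thesis using profile_law[OF m, of R L \<beta> n] by simp
    qed auto
  qed
  also have "\<dots> = (\<integral>\<^sup>+R. \<integral>\<^sup>+L. ennreal (site_prob w (R 0) (L 0)) * (?hR R * ?hL L) \<partial>?c \<partial>?c)"
    unfolding nn_integral_count_space_point
    by (intro nn_integral_cong) (simp add: ennreal_mult site_prob_nonneg chain_weight_nonneg ac_simps)
  also have "\<dots> = (\<integral>\<^sup>+R. (\<integral>\<^sup>+L. ennreal (site_prob w (R 0) (L 0)) * ?hL L \<partial>?c) * ?hR R \<partial>?c)"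
    by (intro nn_integral_cong, subst nn_integral_multc[symmetric]) (auto intro!: nn_integral_cong simp: ac_simps)
  also have "\<dots> = (\<integral>\<^sup>+R. (\<integral>\<^sup>+b. ennreal (site_prob w (R 0) b) * ennreal (tw \<beta> m k b) \<partial>?c) * ?hR R \<partial>?c)"
  proof (intro nn_integral_cong)
    fix R :: "nat \<Rightarrow> nat"
    have "(\<integral>\<^sup>+L. ennreal (site_prob w (R 0) (L 0)) * ?hL L \<partial>?c) = (\<integral>\<^sup>+b. ennreal (site_prob w (R 0) b) * ennreal (tw \<beta> m k b) \<partial>?c)"
      unfolding chain_transform_eq_sum[OF \<beta>]
      by (rule nn_integral_fiber[where \<pi> = "\<lambda>c. c 0" and g = "\<lambda>b. ennreal (site_prob w (R 0) b)"])
    then show "(\<integral>\<^sup>+L. ennreal (site_prob w (R 0) (L 0)) * ?hL L \<partial>?c) * ?hR R = (\<integral>\<^sup>+b. ennreal (site_prob w (R 0) b) * ennreal (tw \<beta> m k b) \<partial>?c) * ?hR R"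
      by simp
  qed
  also have "\<dots> = (\<integral>\<^sup>+a. (\<integral>\<^sup>+b. ennreal (site_prob w a b) * ennreal (tw \<beta> m k b) \<partial>?c) * ennreal (tw \<beta> m 0 a) \<partial>?c)"
    unfolding chain_transform_eq_sum[OF \<beta>, of m 0]
    by (rule nn_integral_fiber[where \<pi> = "\<lambda>c. c 0" and g = "\<lambda>a. \<integral>\<^sup>+b. ennreal (site_prob w a b) * ennreal (tw \<beta> m k b) \<partial>?c"])
  also have "\<dots> = (\<integral>\<^sup>+a. \<integral>\<^sup>+b. ennreal (site_prob w a b * tw \<beta> m 0 a * tw \<beta> m k b) \<partial>?c \<partial>?c)"
    using tw_bounds[OF \<beta>] site_prob_nonneg
    by (intro nn_integral_cong, subst nn_integral_multc[symmetric])
      (auto intro!: nn_integral_cong simp: ennreal_mult ac_simps)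
  finally show ?thesis .
qed

lemma walk_event_sets [measurable]: "{\<omega> \<in> space M. X n \<omega> = c} \<in> sets M"
  using measurable_sets[OF measurable_walk, of "{c}" n] by (auto simp: vimage_def Int_def conj_commute)

text \<open>Monotone limit of \<open>bounded_green\<close> as the window grows.\<close>

lemma green_site:
  assumes \<beta>: "0 \<le> \<beta>"
  shows "(\<integral>\<^sup>+n. ennreal (exp (- \<beta> * real n)) * emeasure M {\<omega> \<in> space M. X n \<omega> = int k} \<partial>count_space UNIV)
    = (\<integral>\<^sup>+a. \<integral>\<^sup>+b. ennreal (site_prob w a b * full_transform (ups_law w) \<beta> 0 a * full_transform (ups_law w) \<beta> k b)
        \<partial>count_space UNIV \<partial>count_space UNIV)"
proof -
  obtain \<theta> C where "balanced_kernel (ups_law w) \<theta> C" using balanced_ups_law by blast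
  then interpret balanced_kernel "ups_law w" \<theta> C .
  let ?c = "count_space UNIV"
  have lhs: "(\<lambda>m. \<integral>\<^sup>+n. ennreal (exp (- \<beta> * real n)) * emeasure M (bounded_event n k (m + k)) \<partial>?c)
      \<longlonglongrightarrow> (\<integral>\<^sup>+n. ennreal (exp (- \<beta> * real n)) * emeasure M {\<omega> \<in> space M. X n \<omega> = int k} \<partial>?c)"
  proof (rule nn_integral_LIMSEQ)
    show "incseq (\<lambda>m n. ennreal (exp (- \<beta> * real n)) * emeasure M (bounded_event n k (m + k)))"
      by (auto simp: incseq_def le_fun_def intro!: mult_left_mono emeasure_mono bounded_event_mono)
    show "(\<lambda>m. ennreal (exp (- \<beta> * real n)) * emeasure M (bounded_event n k (m + k)))
        \<longlonglongrightarrow> ennreal (exp (- \<beta> * real n)) * emeasure M {\<omega> \<in> space M. X n \<omega> = int k}" for n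
      by (rule tendsto_eventually)
        (auto simp: eventually_sequentially bounded_event_eventually intro!: exI[of _ "Suc n"])
  qed auto
  define g where "g m a b = ennreal (site_prob w a b * tw \<beta> (m + k) 0 a * tw \<beta> (m + k) k b)" for m a b
  define G where "G a b = ennreal (site_prob w a b * lw \<beta> 0 a * lw \<beta> k b)" for a b
  have mono0: "tw \<beta> (m + k) 0 a \<le> tw \<beta> (m' + k) 0 a" if "m \<le> m'" for m m' a
    using monoD[OF tw_mono[OF \<beta>, of 0 a], of "m + k" "m' + k"] that by simp
  have monok: "tw \<beta> (m + k) k a \<le> tw \<beta> (m' + k) k a" if "m \<le> m'" for m m' a
    using monoD[OF tw_mono[OF \<beta>, of k a], of m m'] that by simp
  have g_mono: "g m a b \<le> g m' a b" if "m \<le> m'" for m m' a b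
    unfolding g_def using that tw_bounds[OF \<beta>] site_prob_nonneg[of a b]
    by (intro ennreal_leI mult_mono mono0 monok mult_nonneg_nonneg order_refl) auto
  have lim0: "(\<lambda>m. tw \<beta> (m + k) 0 a) \<longlonglongrightarrow> lw \<beta> 0 a" for a
    using LIMSEQ_ignore_initial_segment[OF tw_tendsto[OF \<beta>, of 0 a], of k] by simp
  have g_lim: "(\<lambda>m. g m a b) \<longlonglongrightarrow> G a b" for a b
    unfolding g_def G_def by (intro tendsto_ennrealI tendsto_mult tendsto_const lim0 tw_tendsto \<beta>)
  have rhs: "(\<lambda>m. \<integral>\<^sup>+a. \<integral>\<^sup>+b. g m a b \<partial>?c \<partial>?c) \<longlonglongrightarrow> (\<integral>\<^sup>+a. \<integral>\<^sup>+b. G a b \<partial>?c \<partial>?c)"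
  proof (rule nn_integral_LIMSEQ)
    show "incseq (\<lambda>m a. \<integral>\<^sup>+b. g m a b \<partial>?c)"
      using g_mono by (auto simp: incseq_def le_fun_def intro!: nn_integral_mono)
    show "(\<lambda>m. \<integral>\<^sup>+b. g m a b \<partial>?c) \<longlonglongrightarrow> (\<integral>\<^sup>+b. G a b \<partial>?c)" for a
      by (rule nn_integral_LIMSEQ) (use g_mono g_lim in \<open>auto simp: incseq_def le_fun_def\<close>)
  qed auto
  have "(\<integral>\<^sup>+n. ennreal (exp (- \<beta> * real n)) * emeasure M (bounded_event n k (m + k)) \<partial>?c) = (\<integral>\<^sup>+a. \<integral>\<^sup>+b. g m a b \<partial>?c \<partial>?c)" for m
    using bounded_green[OF _ \<beta>, of k "m + k"] by (simp add: g_def)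
  then show ?thesis using LIMSEQ_unique[OF lhs] rhs by (simp add: G_def)
qed

text \<open>Multiplying \<open>site_prob w a b\<close> by the probabilities of the next exit, which add up to one, turns it into a
sum of two transition probabilities. These are absorbed by the one-step equations of the transforms, so
that only a single sum remains.\<close>

lemma green_identity:
  assumes \<beta>: "0 \<le> \<beta>"
  shows "(\<integral>\<^sup>+n. ennreal (exp (- \<beta> * real n)) * emeasure M {\<omega> \<in> space M. X n \<omega> = int k} \<partial>count_space UNIV)
    = (\<integral>\<^sup>+a. ennreal (exp (\<beta> * (2 * real a + 1)) * full_transform (ups_law w) \<beta> 0 a * full_transform (ups_law w) \<beta> (Suc k) a
        + exp (2 * \<beta> * real (Suc a)) * full_transform (ups_law w) \<beta> 0 (Suc a) * full_transform (ups_law w) \<beta> k a) \<partial>count_space UNIV)"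
proof -
  obtain \<theta> C where "balanced_kernel (ups_law w) \<theta> C" using balanced_ups_law by blast
  then interpret balanced_kernel "ups_law w" \<theta> C .
  let ?c = "count_space UNIV"
  have lwb: "0 \<le> lw \<beta> j z" for j z using lw_bounds[OF \<beta>] by simp
  have site: "site_prob w a b = pmf (ups_law w (Suc a)) b + pmf (ups_law w (Suc b)) a" for a b
  proof -
    have "p (int a - int b) + p (int b - int a) = 1" using p_minus[of "int a - int b"] by simp
    then have "site_prob w a b = site_prob w a b * p (int a - int b) + site_prob w a b * p (int b - int a)"
      by (metis distrib_left mult.right_neutral)
    then show ?thesis by (simp flip: exit_prob_eq_ups_law add: site_prob_commute[of w b a])
  qed
  have nE: "(\<integral>\<^sup>+b. ennreal (pmf (ups_law w z) b) * ennreal (lw \<beta> j b) \<partial>?c) = ennreal (E z (lw \<beta> j))" for z j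
    unfolding nn_integral_measure_pmf[symmetric]
    using lwb by (intro nn_integral_eq_integral integrable_lw \<beta>) auto
  have E1: "E (Suc a) (lw \<beta> k) = exp (\<beta> * (2 * real a + 1)) * lw \<beta> (Suc k) a" for a
    using lw_Suc_step[OF \<beta>, of k a] by (simp flip: mult.assoc exp_add)
  have E2: "E (Suc a) (lw \<beta> 0) = exp (2 * \<beta> * real (Suc a)) * lw \<beta> 0 (Suc a)" for a
    using lw_0_step[OF \<beta>, of "Suc a"] by (simp flip: mult.assoc exp_add)
  have "(\<integral>\<^sup>+a. \<integral>\<^sup>+b. ennreal (site_prob w a b * lw \<beta> 0 a * lw \<beta> k b) \<partial>?c \<partial>?c)
      = (\<integral>\<^sup>+a. \<integral>\<^sup>+b. ennreal (pmf (ups_law w (Suc a)) b * lw \<beta> 0 a * lw \<beta> k b) + ennreal (pmf (ups_law w (Suc b)) a * lw \<beta> 0 a * lw \<beta> k b) \<partial>?c \<partial>?c)"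
    unfolding site using lwb by (simp add: distrib_right)
  also have "\<dots> = (\<integral>\<^sup>+a. \<integral>\<^sup>+b. ennreal (pmf (ups_law w (Suc a)) b * lw \<beta> 0 a * lw \<beta> k b) \<partial>?c \<partial>?c)
      + (\<integral>\<^sup>+a. \<integral>\<^sup>+b. ennreal (pmf (ups_law w (Suc b)) a * lw \<beta> 0 a * lw \<beta> k b) \<partial>?c \<partial>?c)"
    by (simp add: nn_integral_add)
  also have "(\<integral>\<^sup>+a. \<integral>\<^sup>+b. ennreal (pmf (ups_law w (Suc b)) a * lw \<beta> 0 a * lw \<beta> k b) \<partial>?c \<partial>?c)
      = (\<integral>\<^sup>+b. \<integral>\<^sup>+a. ennreal (pmf (ups_law w (Suc b)) a * lw \<beta> 0 a * lw \<beta> k b) \<partial>?c \<partial>?c)"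
    by (rule nn_integral_count_space_swap)
  also have "\<dots> = (\<integral>\<^sup>+b. ennreal (exp (2 * \<beta> * real (Suc b)) * lw \<beta> 0 (Suc b) * lw \<beta> k b) \<partial>?c)"
  proof (intro nn_integral_cong)
    fix b
    have "(\<integral>\<^sup>+a. ennreal (pmf (ups_law w (Suc b)) a * lw \<beta> 0 a * lw \<beta> k b) \<partial>?c)
        = (\<integral>\<^sup>+a. ennreal (pmf (ups_law w (Suc b)) a) * ennreal (lw \<beta> 0 a) \<partial>?c) * ennreal (lw \<beta> k b)"
      by (subst nn_integral_multc[symmetric]) (auto simp: ennreal_mult lwb)
    then show "(\<integral>\<^sup>+a. ennreal (pmf (ups_law w (Suc b)) a * lw \<beta> 0 a * lw \<beta> k b) \<partial>?c)
        = ennreal (exp (2 * \<beta> * real (Suc b)) * lw \<beta> 0 (Suc b) * lw \<beta> k b)"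
      unfolding nE E2 using lwb by (simp add: ennreal_mult)
  qed
  also have "(\<integral>\<^sup>+a. \<integral>\<^sup>+b. ennreal (pmf (ups_law w (Suc a)) b * lw \<beta> 0 a * lw \<beta> k b) \<partial>?c \<partial>?c)
      = (\<integral>\<^sup>+a. ennreal (exp (\<beta> * (2 * real a + 1)) * lw \<beta> 0 a * lw \<beta> (Suc k) a) \<partial>?c)"
  proof (intro nn_integral_cong)
    fix a
    have "(\<integral>\<^sup>+b. ennreal (pmf (ups_law w (Suc a)) b * lw \<beta> 0 a * lw \<beta> k b) \<partial>?c)
        = (\<integral>\<^sup>+b. ennreal (pmf (ups_law w (Suc a)) b) * ennreal (lw \<beta> k b) \<partial>?c) * ennreal (lw \<beta> 0 a)"
      by (subst nn_integral_multc[symmetric]) (auto simp: ennreal_mult lwb ac_simps)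
    then show "(\<integral>\<^sup>+b. ennreal (pmf (ups_law w (Suc a)) b * lw \<beta> 0 a * lw \<beta> k b) \<partial>?c)
        = ennreal (exp (\<beta> * (2 * real a + 1)) * lw \<beta> 0 a * lw \<beta> (Suc k) a)"
      unfolding nE E1 using lwb by (simp add: ennreal_mult ac_simps)
  qed
  finally show ?thesis
    unfolding green_site[OF \<beta>] using lwb by (simp add: nn_integral_add)
qed

end

section \<open>The Gaussian limit\<close>

definition gauss_tail :: "real \<Rightarrow> real \<Rightarrow> ennreal" where
  "gauss_tail s x = (\<integral>\<^sup>+u. ennreal (exp (- s * u\<^sup>2)) * indicator {x..} u \<partial>lborel)"

lemma gauss_tail_eq:
  assumes s: "0 < s"
  shows "gauss_tail s x = ennreal (sqrt (pi / s) * (1 - std_normal_cdf (sqrt (2 * s) * x)))"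
proof -
  define c where "c = sqrt (2 * s)"
  define y where "y = c * x"
  have c: "0 < c" "c\<^sup>2 = 2 * s" using s by (auto simp: c_def)
  interpret N: prob_space std_normal_distribution by (rule prob_space_normal_density) simp
  have tail: "1 - std_normal_cdf y = measure std_normal_distribution {y<..}"
  proof -
    have "measure std_normal_distribution (space std_normal_distribution - {..y}) = 1 - measure std_normal_distribution {..y}"
      by (rule N.prob_compl) simp
    moreover have "space std_normal_distribution - {..y} = {y<..}" by auto
    ultimately show ?thesis by (simp add: std_normal_cdf_eq_cdf cdf_def)
  qed
  have "ennreal (1 - std_normal_cdf y) = (\<integral>\<^sup>+u. ennreal (std_normal_density u) * indicator {y<..} u \<partial>lborel)"
    unfolding tail N.emeasure_eq_measure[symmetric] by (subst emeasure_density) auto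
  also have "\<dots> = ennreal c * (\<integral>\<^sup>+u. ennreal (std_normal_density (0 + c * u)) * indicator {y<..} (0 + c * u) \<partial>lborel)"
    using c by (subst nn_integral_real_affine[where c = c and t = 0]) auto
  also have "(\<integral>\<^sup>+u. ennreal (std_normal_density (0 + c * u)) * indicator {y<..} (0 + c * u) \<partial>lborel)
      = (\<integral>\<^sup>+u. ennreal (1 / sqrt (2 * pi)) * (ennreal (exp (- s * u\<^sup>2)) * indicator {x..} u) \<partial>lborel)"
  proof (rule nn_integral_cong_AE)
    show "AE u in lborel. ennreal (std_normal_density (0 + c * u)) * indicator {y<..} (0 + c * u)
        = ennreal (1 / sqrt (2 * pi)) * (ennreal (exp (- s * u\<^sup>2)) * indicator {x..} u)"
      using AE_lborel_singleton[of x]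
    proof eventually_elim
      case (elim u)
      have "std_normal_density (c * u) = 1 / sqrt (2 * pi) * exp (- s * u\<^sup>2)"
        using c by (simp add: std_normal_density_def power_mult_distrib)
      then show ?case
        using elim c(1) by (auto simp: indicator_def y_def ennreal_mult'[symmetric])
    qed
  qed
  also have "\<dots> = ennreal (1 / sqrt (2 * pi)) * gauss_tail s x"
    unfolding gauss_tail_def by (rule nn_integral_cmult) auto
  finally have "ennreal (1 - std_normal_cdf y) = ennreal (c / sqrt (2 * pi)) * gauss_tail s x"
    using c by (simp add: mult.assoc[symmetric] ennreal_mult'[symmetric])
  then have "ennreal (sqrt (pi / s)) * ennreal (1 - std_normal_cdf y)
      = ennreal (sqrt (pi / s) * (c / sqrt (2 * pi))) * gauss_tail s x"
    using c s by (simp add: mult.assoc[symmetric] ennreal_mult'[symmetric])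
  also have "sqrt (pi / s) * (c / sqrt (2 * pi)) = 1"
    using s by (simp add: c_def real_sqrt_divide real_sqrt_mult)
  finally show ?thesis using s by (simp add: ennreal_mult' y_def c_def)
qed

text \<open>The substitution \<open>t = u\<^sup>2\<close>, on bounded intervals first.\<close>

lemma nn_integral_subst_square:
  assumes x: "0 \<le> x"
  shows "(\<integral>\<^sup>+t. ennreal (exp (- s * t) * (1 / (2 * sqrt t))) * indicator {x\<^sup>2..} t \<partial>lborel) = gauss_tail s x"
proof -
  define f where "f t = exp (- s * t) * (1 / (2 * sqrt t))" for t
  have fin: "(\<integral>\<^sup>+t. ennreal (f t) * indicator {x\<^sup>2..(x + real n)\<^sup>2} t \<partial>lborel)
      = (\<integral>\<^sup>+u. ennreal (exp (- s * u\<^sup>2)) * indicator {x..x + real n} u \<partial>lborel)" for n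
  proof -
    have "(\<integral>\<^sup>+t. ennreal (f t * indicator {x\<^sup>2..(x + real n)\<^sup>2} t) \<partial>lborel)
        = (\<integral>\<^sup>+u. ennreal (f (u\<^sup>2) * (2 * u) * indicator {x..x + real n} u) \<partial>lborel)"
      by (rule nn_integral_substitution[where g = "\<lambda>u. u\<^sup>2" and g' = "\<lambda>u. 2 * u"])
        (use x in \<open>auto intro!: derivative_eq_intros continuous_intros simp: f_def set_borel_measurable_def\<close>)
    also have "\<dots> = (\<integral>\<^sup>+u. ennreal (exp (- s * u\<^sup>2)) * indicator {x..x + real n} u \<partial>lborel)"
    proof (rule nn_integral_cong_AE)
      show "AE u in lborel. ennreal (f (u\<^sup>2) * (2 * u) * indicator {x..x + real n} u)
          = ennreal (exp (- s * u\<^sup>2)) * indicator {x..x + real n} u"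
        using AE_lborel_singleton[of 0]
      proof eventually_elim
        case (elim u)
        then show ?case using x by (cases "0 < u") (auto simp: f_def indicator_def)
      qed
    qed
    also have "(\<integral>\<^sup>+t. ennreal (f t * indicator {x\<^sup>2..(x + real n)\<^sup>2} t) \<partial>lborel)
        = (\<integral>\<^sup>+t. ennreal (f t) * indicator {x\<^sup>2..(x + real n)\<^sup>2} t \<partial>lborel)"
      by (intro nn_integral_cong) (auto simp: indicator_def)
    finally show ?thesis by simp
  qed
  have tendsto_ind: "(\<lambda>n. c * indicator {a..b n} t) \<longlonglongrightarrow> c * indicator {a..} t"
    if "filterlim b at_top sequentially" for a t :: real and b and c :: ennreal
  proof (rule tendsto_eventually)
    have "eventually (\<lambda>n. t \<le> b n) sequentially" using that by (simp add: filterlim_at_top)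
    then show "\<forall>\<^sub>F n in sequentially. c * indicator {a..b n} t = c * indicator {a..} t"
      by eventually_elim (auto simp: indicator_def)
  qed
  have lim_u: "filterlim (\<lambda>n. x + real n) at_top sequentially"
    by (rule filterlim_tendsto_add_at_top[OF tendsto_const filterlim_real_sequentially])
  have lim_t: "filterlim (\<lambda>n. (x + real n)\<^sup>2) at_top sequentially"
    by (rule filterlim_pow_at_top[OF _ lim_u]) simp
  have [measurable]: "f \<in> borel_measurable borel" by (simp add: f_def[abs_def])
  have lim1: "(\<lambda>n. \<integral>\<^sup>+t. ennreal (f t) * indicator {x\<^sup>2..(x + real n)\<^sup>2} t \<partial>lborel)
      \<longlonglongrightarrow> (\<integral>\<^sup>+t. ennreal (f t) * indicator {x\<^sup>2..} t \<partial>lborel)"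
  proof (rule nn_integral_LIMSEQ)
    show "incseq (\<lambda>n t. ennreal (f t) * indicator {x\<^sup>2..(x + real n)\<^sup>2} t)"
      using x by (auto simp: incseq_def le_fun_def indicator_def intro: order_trans power_mono)
    show "(\<lambda>n. ennreal (f t) * indicator {x\<^sup>2..(x + real n)\<^sup>2} t) \<longlonglongrightarrow> ennreal (f t) * indicator {x\<^sup>2..} t" for t
      by (rule tendsto_ind[OF lim_t])
  qed auto
  have lim2: "(\<lambda>n. \<integral>\<^sup>+u. ennreal (exp (- s * u\<^sup>2)) * indicator {x..x + real n} u \<partial>lborel)
      \<longlonglongrightarrow> gauss_tail s x"
    unfolding gauss_tail_def
  proof (rule nn_integral_LIMSEQ)
    show "incseq (\<lambda>n u. ennreal (exp (- s * u\<^sup>2)) * indicator {x..x + real n} u)"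
      by (auto simp: incseq_def le_fun_def indicator_def)
    show "(\<lambda>n. ennreal (exp (- s * u\<^sup>2)) * indicator {x..x + real n} u) \<longlonglongrightarrow> ennreal (exp (- s * u\<^sup>2)) * indicator {x..} u" for u
      by (rule tendsto_ind[OF lim_u])
  qed auto
  show ?thesis
    using LIMSEQ_unique[OF lim1[unfolded fin] lim2] by (simp only: f_def)
qed

lemma phi_hat_eq_gauss_tail: "phi_hat s x = s * enn2real (gauss_tail s \<bar>x\<bar>)"
proof -
  define f where "f t = exp (- s * t) * (1 / (2 * sqrt t))" for t
  have [measurable]: "f \<in> borel_measurable borel" by (simp add: f_def[abs_def])
  have eq: "indicat_real {0<..} t *\<^sub>R (exp (- s * t) * (1 / (2 * sqrt t)) * indicat_real {t. \<bar>x\<bar> \<le> sqrt t} t)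
      = f t * indicat_real {\<bar>x\<bar>\<^sup>2..} t" for t
  proof -
    consider "t < 0" | "t = 0" | "0 < t" by linarith
    then show ?thesis
    proof cases
      case 1
      then have "\<not> x\<^sup>2 \<le> t" using zero_le_power2[of x] by linarith
      then show ?thesis using 1 by (simp add: indicator_def)
    next
      case 3
      then have "\<bar>x\<bar> \<le> sqrt t \<longleftrightarrow> \<bar>x\<bar>\<^sup>2 \<le> t" by (simp flip: real_sqrt_abs)
      then show ?thesis using 3 by (simp add: f_def indicator_def)
    qed (simp add: f_def)
  qed
  have nonneg: "0 \<le> f t * indicat_real {\<bar>x\<bar>\<^sup>2..} t" for t
    using order_trans[OF zero_le_power2[of "\<bar>x\<bar>"], of t] by (auto simp: f_def indicator_def)
  have "phi_hat s x = s * (\<integral>t. f t * indicat_real {\<bar>x\<bar>\<^sup>2..} t \<partial>lborel)"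
    unfolding phi_hat_def set_lebesgue_integral_def eq ..
  also have "(\<integral>t. f t * indicat_real {\<bar>x\<bar>\<^sup>2..} t \<partial>lborel) = enn2real (\<integral>\<^sup>+t. ennreal (f t * indicat_real {\<bar>x\<bar>\<^sup>2..} t) \<partial>lborel)"
    by (rule integral_eq_nn_integral) (use nonneg in auto)
  also have "(\<integral>\<^sup>+t. ennreal (f t * indicat_real {\<bar>x\<bar>\<^sup>2..} t) \<partial>lborel) = (\<integral>\<^sup>+t. ennreal (f t) * indicator {\<bar>x\<bar>\<^sup>2..} t \<partial>lborel)"
    by (intro nn_integral_cong) (auto simp: indicator_def)
  also have "\<dots> = gauss_tail s \<bar>x\<bar>"
    unfolding f_def by (rule nn_integral_subst_square) simp
  finally show ?thesis .
qed

lemma phi_hat_closed_form: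
  assumes s: "0 < s"
  shows "phi_hat s x = sqrt (s * pi) * (1 - std_normal_cdf (sqrt (2 * s) * \<bar>x\<bar>))"
proof -
  interpret N: prob_space std_normal_distribution by (rule prob_space_normal_density) simp
  have "std_normal_cdf y \<le> 1" for y by (simp add: std_normal_cdf_eq_cdf cdf_def)
  then have "phi_hat s x = (s * sqrt (pi / s)) * (1 - std_normal_cdf (sqrt (2 * s) * \<bar>x\<bar>))"
    using s by (simp add: phi_hat_eq_gauss_tail gauss_tail_eq)
  also have "s * sqrt (pi / s) = sqrt (s * pi)"
    using s by (simp add: real_sqrt_divide real_sqrt_mult field_simps)
  finally show ?thesis .
qed

text \<open>A sum as the integral of a step function, to which dominated convergence can be applied.\<close>

lemma nn_integral_count_space_floor:
  "(\<integral>\<^sup>+a. f a \<partial>count_space UNIV) = (\<integral>\<^sup>+t. f (nat \<lfloor>t :: real\<rfloor>) * indicator {0..} t \<partial>lborel)"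
proof -
  have "(\<integral>\<^sup>+t. f (nat \<lfloor>t :: real\<rfloor>) * indicator {0..} t \<partial>lborel) = (\<integral>\<^sup>+t. (\<Sum>n. f n * indicator {real n..<real n + 1} t) \<partial>lborel)"
  proof (intro nn_integral_cong)
    fix t :: real
    show "f (nat \<lfloor>t\<rfloor>) * indicator {0..} t = (\<Sum>n. f n * indicator {real n..<real n + 1} t)"
    proof (cases "0 \<le> t")
      case True
      have "t \<in> {real n..<real n + 1} \<longleftrightarrow> n = nat \<lfloor>t\<rfloor>" for n
        using True by (auto simp: floor_eq_iff nat_eq_iff)
          (metis floor_eq2 of_int_of_nat_eq nat_int)
      then have "(\<lambda>n. f n * indicator {real n..<real n + 1} t) = (\<lambda>n. if n = nat \<lfloor>t\<rfloor> then f n else 0)"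
        by (auto simp: indicator_def fun_eq_iff)
      moreover have "(\<Sum>n. if n = nat \<lfloor>t\<rfloor> then f n else 0) = f (nat \<lfloor>t\<rfloor>)"
        by (subst suminf_finite[of "{nat \<lfloor>t\<rfloor>}"]) auto
      ultimately show ?thesis using True by simp
    next
      case False
      then have "(\<lambda>n. f n * indicator {real n..<real n + 1} t) = (\<lambda>n. 0)"
        by (auto simp: indicator_def fun_eq_iff)
      then show ?thesis using False by (simp del: indicator_simps)  (simp add: indicator_def)
    qed
  qed
  also have "\<dots> = (\<Sum>n. \<integral>\<^sup>+t. f n * indicator {real n..<real n + 1} t \<partial>lborel)"
    by (rule nn_integral_suminf) auto
  also have "\<dots> = (\<Sum>n. f n)"
    by (simp add: nn_integral_cmult_indicator)
  finally show ?thesis by (simp add: nn_integral_count_space_nat)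
qed

lemma integrable_exp_half_line:
  assumes a: "0 < a"
  shows "integrable lborel (\<lambda>h. exp (c - a * h) * indicat_real {0..} h)"
proof (rule integrableI_nonneg)
  have "(\<integral>\<^sup>+h. ennreal (exp (c - a * h)) * indicator {0..} h \<partial>lborel) = ennreal (0 - (- exp (c - a * 0) / a))"
  proof (rule nn_integral_FTC_atLeast)
    show "((\<lambda>h. - exp (c - a * h) / a) has_real_derivative exp (c - a * h)) (at h)" for h
      using a by (auto intro!: derivative_eq_intros)
    have "filterlim (\<lambda>h. - c + a * h) at_top at_top"
      by (intro filterlim_tendsto_add_at_top[OF tendsto_const] filterlim_tendsto_pos_mult_at_top[OF tendsto_const a filterlim_ident])
    then have "((\<lambda>h. exp (- (- c + a * h))) \<longlongrightarrow> 0) at_top"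
      by (intro filterlim_compose[OF exp_at_bot] filterlim_uminus_at_bot_at_top[THEN filterlim_compose])
    then have "((\<lambda>h. - exp (c - a * h) / a) \<longlongrightarrow> - 0 / a) at_top"
      by (intro tendsto_divide tendsto_minus tendsto_const) (use a in \<open>auto simp: algebra_simps\<close>)
    then show "((\<lambda>h. - exp (c - a * h) / a) \<longlongrightarrow> 0) at_top" by simp
  qed auto
  moreover have "ennreal (exp (c - a * h) * indicat_real {0..} h) = ennreal (exp (c - a * h)) * indicator {0..} h" for h
    by (auto simp: indicator_def)
  ultimately show "(\<integral>\<^sup>+h. ennreal (exp (c - a * h) * indicat_real {0..} h) \<partial>lborel) < \<infinity>" by simp
qed auto

lemma inverse_sqrt_tendsto_0: "((\<lambda>A. c / sqrt A) \<longlongrightarrow> 0) at_top"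
  by (rule tendsto_divide_0[OF tendsto_const]) (auto intro: filterlim_at_top_imp_at_infinity sqrt_at_top)

lemma inverse_tendsto_0: "((\<lambda>A::real. c / A) \<longlongrightarrow> 0) at_top"
  by (rule tendsto_divide_0[OF tendsto_const]) (auto intro: filterlim_at_top_imp_at_infinity filterlim_ident)

context balanced_kernel
begin

lemma gauss_scaling: "0 < A \<Longrightarrow> gauss (s / A) (real j) (real b)
    = exp (- s * (2 * (real b / sqrt A)\<^sup>2 + 4 * (real b / sqrt A) * (real j / sqrt A) + (real j / sqrt A)\<^sup>2))"
  by (simp add: gauss_def power_divide field_simps)

text \<open>The Gaussian depends on \<open>b\<close> and \<open>j\<close> only through \<open>b / sqrt A\<close> and \<open>j / sqrt A\<close>, and the bound of
\<open>left_transform_close\<close> with \<open>\<beta> = s / A\<close> tends to \<open>\<epsilon> * (1 + sqrt s * x)\<close>. The assumption \<open>0 < h\<close>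
makes the penalty vanish.\<close>

lemma transform_limit:
  assumes s: "0 < s" and h: "0 < h"
    and b: "((\<lambda>A. real (b A) / sqrt A) \<longlongrightarrow> h) at_top"
    and j: "((\<lambda>A. real (j A) / sqrt A) \<longlongrightarrow> x) at_top"
  shows "((\<lambda>A. lw (s / A) (j A) (b A)) \<longlongrightarrow> exp (- s * (2 * h\<^sup>2 + 4 * h * x + x\<^sup>2))) at_top"
proof -
  let ?r = "\<lambda>A. real (b A) / sqrt A" and ?q = "\<lambda>A. real (j A) / sqrt A"
  have pos: "\<forall>\<^sub>F A in at_top. 0 < (A::real)" by (rule eventually_gt_at_top)
  have x: "0 \<le> x"
  proof (rule tendsto_lowerbound[OF j])
    show "\<forall>\<^sub>F A in at_top. 0 \<le> ?q A" using pos by eventually_elim simp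
  qed simp
  have main: "((\<lambda>A. gauss (s / A) (real (j A)) (real (b A))) \<longlongrightarrow> exp (- s * (2 * h\<^sup>2 + 4 * h * x + x\<^sup>2))) at_top"
  proof (rule Lim_transform_eventually)
    show "((\<lambda>A. exp (- s * (2 * (?r A)\<^sup>2 + 4 * ?r A * ?q A + (?q A)\<^sup>2))) \<longlongrightarrow> exp (- s * (2 * h\<^sup>2 + 4 * h * x + x\<^sup>2))) at_top"
      by (intro tendsto_intros b j)
    show "\<forall>\<^sub>F A in at_top. exp (- s * (2 * (?r A)\<^sup>2 + 4 * ?r A * ?q A + (?q A)\<^sup>2)) = gauss (s / A) (real (j A)) (real (b A))"
      using pos by eventually_elim (simp add: gauss_scaling)
  qed
  have b_top: "filterlim (\<lambda>A. real (b A)) at_top at_top"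
  proof -
    have "filterlim (\<lambda>A. ?r A * sqrt A) at_top at_top"
      by (rule filterlim_tendsto_pos_mult_at_top[OF b h sqrt_at_top])
    moreover have eq: "\<forall>\<^sub>F A in at_top. ?r A * sqrt A = real (b A)"
      using pos by eventually_elim simp
    ultimately show ?thesis using filterlim_cong[OF refl refl eq, of at_top] by simp
  qed
  have diff: "((\<lambda>A. lw (s / A) (j A) (b A) - gauss (s / A) (real (j A)) (real (b A))) \<longlongrightarrow> 0) at_top"
  proof (rule tendstoI)
    fix e :: real assume e: "0 < e"
    define \<epsilon> where "\<epsilon> = e / (2 * (1 + sqrt s * x))"
    have "0 \<le> sqrt s * x" using s x by simp
    then have \<epsilon>: "0 < \<epsilon>" "\<epsilon> * (1 + sqrt s * x) = e / 2" using e by (auto simp: \<epsilon>_def field_simps)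
    obtain \<theta> M C where \<theta>: "0 < \<theta>" and C: "0 \<le> C" and bound: "\<And>\<beta> j b. 0 < \<beta> \<Longrightarrow> \<bar>lw \<beta> j b - gauss \<beta> (real j) (real b)\<bar>
        \<le> \<epsilon> + C * \<beta> + real j * (\<epsilon> * sqrt \<beta> + C * \<beta>) + C * (real j * sqrt \<beta>) * penalty \<theta> M b"
      using left_transform_close[OF \<epsilon>(1)] by blast
    have pen: "((\<lambda>A. penalty \<theta> M (b A)) \<longlongrightarrow> 0) at_top"
    proof (rule tendsto_sandwich[of "\<lambda>_. 0"])
      have "filterlim (\<lambda>A. \<theta> * real (b A)) at_top at_top"
        by (rule filterlim_tendsto_pos_mult_at_top[OF tendsto_const \<theta> b_top])
      then have "((\<lambda>A. exp (- (\<theta> * real (b A)))) \<longlongrightarrow> 0) at_top"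
        by (intro filterlim_compose[OF exp_at_bot] filterlim_uminus_at_bot_at_top[THEN filterlim_compose])
      from tendsto_mult[OF tendsto_const[of "exp (\<theta> * real M)"] this]
      show "((\<lambda>A. exp (\<theta> * real M) * exp (- (\<theta> * real (b A)))) \<longlongrightarrow> 0) at_top" by simp
      show "\<forall>\<^sub>F A in at_top. penalty \<theta> M (b A) \<le> exp (\<theta> * real M) * exp (- (\<theta> * real (b A)))"
      proof (intro always_eventually allI)
        fix A
        have "\<theta> * (real (b A) - real M) \<le> \<theta> * real (b A - M)" using \<theta> by (intro mult_left_mono) auto
        then show "penalty \<theta> M (b A) \<le> exp (\<theta> * real M) * exp (- (\<theta> * real (b A)))"
          by (simp add: penalty_def algebra_simps flip: exp_add)
      qed
    qed (use penalty_bounds[of \<theta> M] \<theta> in auto)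
    have "((\<lambda>A. \<epsilon> + C * (s / A) + (\<epsilon> * (sqrt s * ?q A) + C * (?q A * (s / sqrt A))) + C * (sqrt s * ?q A) * penalty \<theta> M (b A))
        \<longlongrightarrow> \<epsilon> + C * 0 + (\<epsilon> * (sqrt s * x) + C * (x * 0)) + C * (sqrt s * x) * 0) at_top"
      by (intro tendsto_intros j pen inverse_tendsto_0 inverse_sqrt_tendsto_0)
    moreover have "\<epsilon> + C * 0 + (\<epsilon> * (sqrt s * x) + C * (x * 0)) + C * (sqrt s * x) * 0 < e"
      using \<epsilon> e by (simp add: distrib_left)
    ultimately have "\<forall>\<^sub>F A in at_top. \<epsilon> + C * (s / A) + (\<epsilon> * (sqrt s * ?q A) + C * (?q A * (s / sqrt A))) + C * (sqrt s * ?q A) * penalty \<theta> M (b A) < e"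
      by (rule order_tendstoD)
    then show "\<forall>\<^sub>F A in at_top. dist (lw (s / A) (j A) (b A) - gauss (s / A) (real (j A)) (real (b A))) 0 < e"
      using pos
    proof eventually_elim
      case (elim A)
      have 1: "real (j A) * sqrt (s / A) = sqrt s * ?q A" by (simp add: real_sqrt_divide)
      have 2: "real (j A) * (s / A) = ?q A * (s / sqrt A)" using elim by simp
      have "real (j A) * (\<epsilon> * sqrt (s / A) + C * (s / A)) = \<epsilon> * (real (j A) * sqrt (s / A)) + C * (real (j A) * (s / A))"
        by (simp add: algebra_simps)
      then show ?case using bound[of "s / A" "j A" "b A"] elim s unfolding 1 2 by simp
    qed
  qed
  from tendsto_add[OF diff main] show ?thesis by simp
qed

end

lemma floor_scaling:
  assumes "0 \<le> x"
  shows "((\<lambda>A. real (nat \<lfloor>sqrt A * x\<rfloor>) / sqrt A) \<longlongrightarrow> x) at_top"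
proof (rule tendsto_sandwich)
  have pos: "\<forall>\<^sub>F A in at_top. 0 < (A::real)" by (rule eventually_gt_at_top)
  have fl: "sqrt A * x - 1 \<le> real (nat \<lfloor>sqrt A * x\<rfloor>)" "real (nat \<lfloor>sqrt A * x\<rfloor>) \<le> sqrt A * x" if "0 < A" for A
    using assms that by (auto simp: of_nat_nat)
  show "\<forall>\<^sub>F A in at_top. x - 1 / sqrt A \<le> real (nat \<lfloor>sqrt A * x\<rfloor>) / sqrt A"
    using pos
  proof eventually_elim
    case (elim A)
    then show ?case
      using divide_right_mono[OF fl(1)[OF elim], of "sqrt A"] by (simp add: diff_divide_distrib)
  qed
  show "\<forall>\<^sub>F A in at_top. real (nat \<lfloor>sqrt A * x\<rfloor>) / sqrt A \<le> x"
    using pos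
  proof eventually_elim
    case (elim A)
    then show ?case using fl(2)[OF elim] by (simp add: field_simps)
  qed
  show "((\<lambda>A. x - 1 / sqrt A) \<longlongrightarrow> x) at_top"
    using tendsto_diff[OF tendsto_const inverse_sqrt_tendsto_0[of 1]] by simp
qed simp

lemma Suc_scaling:
  "((\<lambda>A. real (b A) / sqrt A) \<longlongrightarrow> h) at_top \<Longrightarrow> ((\<lambda>A. real (Suc (b A)) / sqrt A) \<longlongrightarrow> h) at_top"
  using tendsto_add[OF _ inverse_sqrt_tendsto_0[of 1], of "\<lambda>A. real (b A) / sqrt A" h]
  by (simp add: add_divide_distrib add.commute)

lemma geometric_rate: "((\<lambda>A::real. A * (1 - exp (- s / A))) \<longlongrightarrow> s) at_top"
proof (rule tendsto_sandwich)
  have pos: "\<forall>\<^sub>F A in at_top. 0 < (A::real)" by (rule eventually_gt_at_top)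
  show "\<forall>\<^sub>F A in at_top. s - s\<^sup>2 / A * exp \<bar>s / A\<bar> \<le> A * (1 - exp (- s / A))"
    using pos
  proof eventually_elim
    case (elim A)
    have "A * exp (- s / A) \<le> A * (1 + (- s / A) + (- s / A)\<^sup>2 * exp \<bar>- s / A\<bar>)"
      using elim by (intro mult_left_mono exp_le_quadratic) auto
    then show ?case using elim by (simp add: power_divide algebra_simps power2_eq_square)
  qed
  show "\<forall>\<^sub>F A in at_top. A * (1 - exp (- s / A)) \<le> s"
    using pos
  proof eventually_elim
    case (elim A)
    have "A * (1 + (- s / A)) \<le> A * exp (- s / A)"
      using elim by (intro mult_left_mono exp_ge_add_one_self) auto
    then show ?case using elim by (simp add: algebra_simps)
  qed
  have "((\<lambda>A. s - s\<^sup>2 / A * exp \<bar>s / A\<bar>) \<longlongrightarrow> s - 0 * exp \<bar>0\<bar>) at_top"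
    by (intro tendsto_intros inverse_tendsto_0)
  then show "((\<lambda>A. s - s\<^sup>2 / A * exp \<bar>s / A\<bar>) \<longlongrightarrow> s) at_top" by simp
qed simp

lemma gauss_tail_affine:
  assumes s: "0 < s"
  shows "(\<integral>h. 2 * exp (- s * (2 * h + x)\<^sup>2) * indicat_real {0..} h \<partial>lborel) = enn2real (gauss_tail s x)"
proof -
  have "gauss_tail s x = ennreal 2 * (\<integral>\<^sup>+h. ennreal (exp (- s * (x + 2 * h)\<^sup>2)) * indicator {x..} (x + 2 * h) \<partial>lborel)"
    unfolding gauss_tail_def by (subst nn_integral_real_affine[where c = 2 and t = x]) auto
  also have "\<dots> = (\<integral>\<^sup>+h. ennreal (2 * exp (- s * (2 * h + x)\<^sup>2) * indicat_real {0..} h) \<partial>lborel)"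
    by (subst nn_integral_cmult[symmetric])
      (auto intro!: nn_integral_cong simp: indicator_def ennreal_mult add.commute)
  finally have nn: "(\<integral>\<^sup>+h. ennreal (2 * exp (- s * (2 * h + x)\<^sup>2) * indicat_real {0..} h) \<partial>lborel) = gauss_tail s x" ..
  show "(\<integral>h. 2 * exp (- s * (2 * h + x)\<^sup>2) * indicat_real {0..} h \<partial>lborel) = enn2real (gauss_tail s x)"
    unfolding nn[symmetric] by (rule integral_eq_nn_integral) auto
qed

context self_repelling_walk
begin

definition resolvent :: "real \<Rightarrow> nat \<Rightarrow> ennreal" where
  "resolvent \<beta> k = (\<integral>\<^sup>+n. ennreal (exp (- \<beta> * real n)) * emeasure M {\<omega> \<in> space M. X n \<omega> = int k} \<partial>count_space UNIV)"

text \<open>After rescaling by \<open>sqrt A\<close> the sum in \<open>green_identity\<close> is the integral of \<open>G A h\<close> over \<open>h \<ge> 0\<close>. By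
\<open>transform_limit\<close> each of its two terms tends to
\<open>exp (- 2 * s * h\<^sup>2) * exp (- s * (2 * h\<^sup>2 + 4 * h * x + x\<^sup>2)) = exp (- s * (2 * h + x)\<^sup>2)\<close>.\<close>

lemma resolvent_limit:
  assumes s: "0 < s" and k: "((\<lambda>A. real (k A) / sqrt A) \<longlongrightarrow> x) at_top"
  shows "((\<lambda>A. sqrt A * ((1 - exp (- s / A)) * enn2real (resolvent (s / A) (k A))))
     \<longlongrightarrow> s * enn2real (gauss_tail s x)) at_top"
proof -
  obtain \<theta> C where "balanced_kernel (ups_law w) \<theta> C" using balanced_ups_law by blast
  then interpret balanced_kernel "ups_law w" \<theta> C .
  define g where "g A a = exp (s / A * (2 * real a + 1)) * lw (s / A) 0 a * lw (s / A) (Suc (k A)) a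
      + exp (2 * (s / A) * real (Suc a)) * lw (s / A) 0 (Suc a) * lw (s / A) (k A) a" for A a
  define G where "G A h = g A (nat \<lfloor>sqrt A * h\<rfloor>) * indicat_real {0..} h" for A h
  define G' where "G' h = 2 * exp (- s * (2 * h + x)\<^sup>2) * indicat_real {0..} h" for h
  have lwb: "0 \<le> lw (s / A) j z" "lw (s / A) j z \<le> 1" if "0 < A" for A j z
    using lw_bounds[of "s / A" j z] s that by auto
  have g_nonneg: "0 \<le> g A a" if "0 < A" for A a
    unfolding g_def using lwb[OF that] by (intro add_nonneg_nonneg mult_nonneg_nonneg) auto
  have G_nonneg: "0 \<le> G A h" if "0 < A" for A h
    using g_nonneg[OF that] by (simp add: G_def)
  have G_meas [measurable]: "G A \<in> borel_measurable borel" for A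
  proof -
    have "(\<lambda>h. g A (nat \<lfloor>sqrt A * h\<rfloor>)) = (\<lambda>i. g A (nat i)) \<circ> (\<lambda>h. \<lfloor>sqrt A * h\<rfloor>)" by auto
    also have "\<dots> \<in> borel_measurable borel"
      by (rule measurable_comp[where N = "count_space UNIV"]) auto
    finally show ?thesis unfolding G_def[abs_def] by (intro borel_measurable_times) auto
  qed
  have resolvent: "resolvent (s / A) (k A) = ennreal (sqrt A) * (\<integral>\<^sup>+h. ennreal (G A h) \<partial>lborel)" if A: "0 < A" for A
  proof -
    have "resolvent (s / A) (k A) = (\<integral>\<^sup>+a. ennreal (g A a) \<partial>count_space UNIV)"
      unfolding resolvent_def g_def using green_identity[of "s / A" "k A"] s A by simp
    also have "\<dots> = (\<integral>\<^sup>+t. ennreal (g A (nat \<lfloor>t :: real\<rfloor>)) * indicator {0..} t \<partial>lborel)"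
      by (rule nn_integral_count_space_floor)
    also have "\<dots> = ennreal \<bar>sqrt A\<bar> * (\<integral>\<^sup>+h. ennreal (g A (nat \<lfloor>0 + sqrt A * h\<rfloor>)) * indicator {0..} (0 + sqrt A * h) \<partial>lborel)"
    proof (rule nn_integral_real_affine)
      have "(\<lambda>t. ennreal (g A (nat \<lfloor>t :: real\<rfloor>))) = (\<lambda>i. ennreal (g A (nat i))) \<circ> (\<lambda>t. \<lfloor>t\<rfloor>)" by auto
      also have "\<dots> \<in> borel_measurable borel"
        by (rule measurable_comp[where N = "count_space UNIV"]) auto
      finally have [measurable]: "(\<lambda>t. ennreal (g A (nat \<lfloor>t :: real\<rfloor>))) \<in> borel_measurable borel" .
      show "(\<lambda>t. ennreal (g A (nat \<lfloor>t :: real\<rfloor>)) * indicator {0..} t) \<in> borel_measurable borel"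
        by measurable
    qed (use A in auto)
    also have "(\<integral>\<^sup>+h. ennreal (g A (nat \<lfloor>0 + sqrt A * h\<rfloor>)) * indicator {0..} (0 + sqrt A * h) \<partial>lborel) = (\<integral>\<^sup>+h. ennreal (G A h) \<partial>lborel)"
      using A by (intro nn_integral_cong) (auto simp: G_def indicator_def zero_le_mult_iff)
    finally show ?thesis using A by simp
  qed
  have pos: "\<forall>\<^sub>F A in at_top. 0 < (A::real)" by (rule eventually_gt_at_top)
  obtain c \<beta>\<^sub>1 where \<beta>\<^sub>1: "0 < \<beta>\<^sub>1" and decay: "\<And>\<beta> z. 0 < \<beta> \<Longrightarrow> \<beta> \<le> \<beta>\<^sub>1 \<Longrightarrow> lw \<beta> 0 z \<le> exp (c - sqrt \<beta> * real z)"
    using right_transform_decay by blast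
  \<comment> \<open>For \<open>\<beta> \<le> 1 / 16\<close> the growing factor \<open>exp (2 * \<beta> * a)\<close> uses up at most half of the decay \<open>exp (- sqrt \<beta> * a)\<close>.\<close>
  define D where "D h = 2 * (exp ((c + 1) - (sqrt s / 2) * h) * indicat_real {0..} h)" for h
  have D_int: "integrable lborel D"
    unfolding D_def[abs_def] using s by (intro integrable_mult_right integrable_exp_half_line) auto
  have bound: "\<forall>\<^sub>F A in at_top. AE h in lborel. norm (G A h) \<le> D h"
    using pos eventually_ge_at_top[of "s / \<beta>\<^sub>1"] eventually_ge_at_top[of "16 * s"]
  proof eventually_elim
    case (elim A)
    define \<beta> where "\<beta> = s / A"
    define r where "r = sqrt \<beta>"
    have \<beta>: "0 < \<beta>" "\<beta> \<le> \<beta>\<^sub>1" "\<beta> \<le> 1 / 16"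
      using elim s \<beta>\<^sub>1 by (auto simp: \<beta>_def field_simps)
    have r: "0 < r" "r \<le> 1 / 4" "r * r = \<beta>"
      using \<beta> real_sqrt_le_mono[OF \<beta>(3)] by (auto simp: r_def real_sqrt_divide)
    have rr: "2 * \<beta> \<le> r / 2" using mult_left_mono[OF r(2), of r] r by simp
    have rA: "r * sqrt A = sqrt s" using elim by (simp add: r_def \<beta>_def real_sqrt_divide)
    show ?case
    proof (rule AE_I2)
      fix h :: real
      show "norm (G A h) \<le> D h"
      proof (cases "0 \<le> h")
        case True
        define a where "a = nat \<lfloor>sqrt A * h\<rfloor>"
        have a: "sqrt A * h - 1 \<le> real a" "sqrt A * h \<le> real (Suc a)"
          using True elim by (auto simp: a_def of_nat_nat) linarith+
        have "r * (sqrt A * h) \<le> r * real (Suc a)" using a(2) r by (intro mult_left_mono) auto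
        then have ra: "sqrt s * h \<le> r * real a + r" using rA by (simp add: algebra_simps)
        have lin: "2 * \<beta> * real a \<le> r / 2 * real a" by (intro mult_right_mono rr) simp
        have t1: "exp (\<beta> * (2 * real a + 1)) * lw \<beta> 0 a * lw \<beta> (Suc (k A)) a \<le> exp (c + 1 - sqrt s / 2 * h)"
        proof -
          have "exp (\<beta> * (2 * real a + 1)) * lw \<beta> 0 a * lw \<beta> (Suc (k A)) a \<le> exp (\<beta> * (2 * real a + 1)) * exp (c - r * real a) * 1"
            using decay[OF \<beta>(1,2), of a] lwb[of A] elim \<beta> unfolding r_def[symmetric] \<beta>_def[symmetric]
            by (intro mult_mono mult_nonneg_nonneg) auto
          also have "\<dots> = exp (\<beta> * (2 * real a + 1) + (c - r * real a))" by (simp add: exp_add)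
          also have "\<dots> \<le> exp (c + 1 - sqrt s / 2 * h)"
            using ra lin r \<beta> by (simp add: algebra_simps)
          finally show ?thesis .
        qed
        have t2: "exp (2 * \<beta> * real (Suc a)) * lw \<beta> 0 (Suc a) * lw \<beta> (k A) a \<le> exp (c + 1 - sqrt s / 2 * h)"
        proof -
          have "exp (2 * \<beta> * real (Suc a)) * lw \<beta> 0 (Suc a) * lw \<beta> (k A) a \<le> exp (2 * \<beta> * real (Suc a)) * exp (c - r * real (Suc a)) * 1"
            using decay[OF \<beta>(1,2), of "Suc a"] lwb[of A] elim \<beta> unfolding r_def[symmetric] \<beta>_def[symmetric]
            by (intro mult_mono mult_nonneg_nonneg) auto
          also have "\<dots> = exp (2 * \<beta> * real (Suc a) + (c - r * real (Suc a)))" by (simp add: exp_add)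
          also have "\<dots> \<le> exp (c + 1 - sqrt s / 2 * h)"
            using ra lin rr r \<beta> by (simp add: algebra_simps)
          finally show ?thesis .
        qed
        have "G A h = exp (\<beta> * (2 * real a + 1)) * lw \<beta> 0 a * lw \<beta> (Suc (k A)) a
            + exp (2 * \<beta> * real (Suc a)) * lw \<beta> 0 (Suc a) * lw \<beta> (k A) a"
          using True by (simp add: G_def g_def a_def \<beta>_def)
        then show ?thesis using t1 t2 G_nonneg[of A h] elim True by (simp add: D_def)
      qed (simp add: G_def D_def)
    qed
  qed
  have lim: "AE h in lborel. ((\<lambda>A. G A h) \<longlongrightarrow> G' h) at_top"
    using AE_lborel_singleton[of 0]
  proof eventually_elim
    case (elim h)
    show ?case
    proof (cases "0 \<le> h")
      case False
      then show ?thesis by (simp add: G_def G'_def)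
    next
      case True
      then have h: "0 < h" using elim by simp
      let ?a = "\<lambda>A. nat \<lfloor>sqrt A * h\<rfloor>"
      have a: "((\<lambda>A. real (?a A) / sqrt A) \<longlongrightarrow> h) at_top" by (rule floor_scaling[OF True])
      have zero: "((\<lambda>A. real 0 / sqrt A) \<longlongrightarrow> 0) at_top" by simp
      note Sa = Suc_scaling[OF a] and Sk = Suc_scaling[OF k]
      have drift: "((\<lambda>A. s / A * (2 * real (?a A) + 1)) \<longlongrightarrow> 0) at_top" "((\<lambda>A. 2 * (s / A) * real (Suc (?a A))) \<longlongrightarrow> 0) at_top"
      proof -
        have 1: "((\<lambda>A. 2 * (s / sqrt A) * (real (?a A) / sqrt A) + s / A) \<longlongrightarrow> 2 * 0 * h + 0) at_top"
          by (intro tendsto_intros a inverse_tendsto_0 inverse_sqrt_tendsto_0)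
        show "((\<lambda>A. s / A * (2 * real (?a A) + 1)) \<longlongrightarrow> 0) at_top"
          by (rule Lim_transform_eventually[OF 1[simplified]])
            (use pos in eventually_elim, simp add: field_simps)
        have 2: "((\<lambda>A. 2 * (s / sqrt A) * (real (Suc (?a A)) / sqrt A)) \<longlongrightarrow> 2 * 0 * h) at_top"
          by (intro tendsto_intros Sa inverse_sqrt_tendsto_0)
        show "((\<lambda>A. 2 * (s / A) * real (Suc (?a A))) \<longlongrightarrow> 0) at_top"
          by (rule Lim_transform_eventually[OF 2[simplified]])
            (use pos in eventually_elim, simp add: field_simps)
      qed
      have "((\<lambda>A. g A (?a A)) \<longlongrightarrow>
          exp 0 * exp (- s * (2 * h\<^sup>2 + 4 * h * 0 + 0\<^sup>2)) * exp (- s * (2 * h\<^sup>2 + 4 * h * x + x\<^sup>2))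
          + exp 0 * exp (- s * (2 * h\<^sup>2 + 4 * h * 0 + 0\<^sup>2)) * exp (- s * (2 * h\<^sup>2 + 4 * h * x + x\<^sup>2))) at_top"
        unfolding g_def
        by (intro tendsto_add tendsto_mult tendsto_exp drift transform_limit s h a Sa k Sk zero)
      also have "exp 0 * exp (- s * (2 * h\<^sup>2 + 4 * h * 0 + 0\<^sup>2)) * exp (- s * (2 * h\<^sup>2 + 4 * h * x + x\<^sup>2))
          + exp 0 * exp (- s * (2 * h\<^sup>2 + 4 * h * 0 + 0\<^sup>2)) * exp (- s * (2 * h\<^sup>2 + 4 * h * x + x\<^sup>2)) = G' h"
        using h by (simp add: G'_def power2_eq_square algebra_simps flip: exp_add)
      finally show ?thesis using h by (simp add: G_def)
    qed
  qed
  have DCT: "((\<lambda>A. \<integral>h. G A h \<partial>lborel) \<longlongrightarrow> (\<integral>h. G' h \<partial>lborel)) at_top"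
    by (rule integral_dominated_convergence_at_top[OF _ _ D_int lim bound]) (auto simp: G'_def[abs_def])
  have "((\<lambda>A. (A * (1 - exp (- s / A))) * (\<integral>h. G A h \<partial>lborel)) \<longlongrightarrow> s * (\<integral>h. G' h \<partial>lborel)) at_top"
    by (intro tendsto_mult geometric_rate DCT)
  also have "(\<integral>h. G' h \<partial>lborel) = enn2real (gauss_tail s x)"
    unfolding G'_def using gauss_tail_affine[OF s] .
  finally show ?thesis
  proof (rule Lim_transform_eventually)
    show "\<forall>\<^sub>F A in at_top. A * (1 - exp (- s / A)) * (\<integral>h. G A h \<partial>lborel) = sqrt A * ((1 - exp (- s / A)) * enn2real (resolvent (s / A) (k A)))"
      using pos
    proof eventually_elim
      case (elim A)
      have "(\<integral>h. G A h \<partial>lborel) = enn2real (\<integral>\<^sup>+h. ennreal (G A h) \<partial>lborel)"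
        by (rule integral_eq_nn_integral) (use G_nonneg[OF elim] in auto)
      then have "enn2real (resolvent (s / A) (k A)) = sqrt A * (\<integral>h. G A h \<partial>lborel)"
        using resolvent[OF elim] elim by (simp add: enn2real_mult)
      then show ?case using elim by simp
    qed
  qed
qed

text \<open>Reflection exchanges up and down exits and changes the sign of the local drift, which is consistent
with the two step probabilities.\<close>

lemma reflected_walk: "self_repelling_walk M w (\<lambda>n \<omega>. - X n \<omega>)"
proof -
  have history: "history M (\<lambda>n \<omega>. - X n \<omega>) n = history M X n" for n
  proof -
    have "{(\<lambda>\<omega>. - X j \<omega>) -` B \<inter> space M | j B. j \<le> n} = {X j -` B \<inter> space M | j B. j \<le> n}"
    proof (intro set_eqI iffI)
      fix S assume "S \<in> {(\<lambda>\<omega>. - X j \<omega>) -` B \<inter> space M | j B. j \<le> n}"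
      then obtain j B where "j \<le> n" "S = (\<lambda>\<omega>. - X j \<omega>) -` B \<inter> space M" by auto
      then have "j \<le> n \<and> S = X j -` (uminus ` B) \<inter> space M" by (auto simp: image_iff) (metis minus_minus)
      then show "S \<in> {X j -` B \<inter> space M | j B. j \<le> n}" by blast
    next
      fix S assume "S \<in> {X j -` B \<inter> space M | j B. j \<le> n}"
      then obtain j B where "j \<le> n" "S = X j -` B \<inter> space M" by auto
      then have "j \<le> n \<and> S = (\<lambda>\<omega>. - X j \<omega>) -` (uminus ` B) \<inter> space M" by (auto simp: image_iff)
      then show "S \<in> {(\<lambda>\<omega>. - X j \<omega>) -` B \<inter> space M | j B. j \<le> n}" by blast
    qed
    then show ?thesis by (simp add: history_def)
  qed
  have drift: "local_drift (\<lambda>j. - X j \<omega>) n = - local_drift (\<lambda>j. X j \<omega>) n" for \<omega> n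
  proof -
    have "(- a = - b + 1) = (a = b - 1)" "(- a = - b - 1) = (a = b + 1)" for a b :: int by auto
    then show ?thesis by (simp add: local_drift_def local_time_plus_def local_time_minus_def)
  qed
  show ?thesis
  proof unfold_locales
    show "(\<lambda>\<omega>. - X n \<omega>) \<in> measurable M (count_space UNIV)" for n
      using measurable_compose[OF measurable_walk[of n], of uminus "count_space UNIV"] by simp
    show "AE \<omega> in M. - X 0 \<omega> = 0" using start by simp
    show "AE \<omega> in M. \<bar>- X (Suc n) \<omega> - - X n \<omega>\<bar> = 1" for n
      using nearest_neighbour[of n] by eventually_elim (simp add: abs_minus_commute)
    have "{\<omega> \<in> space M. - X (Suc n) \<omega> = - X n \<omega> + 1} = {\<omega> \<in> space M. X (Suc n) \<omega> = X n \<omega> - 1}" for n by auto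
    then show "AE \<omega> in M. real_cond_exp M (history M (\<lambda>n \<omega>. - X n \<omega>) n)
         (indicat_real {\<omega> \<in> space M. - X (Suc n) \<omega> = - X n \<omega> + 1}) \<omega> =
        (let D = local_drift (\<lambda>j. - X j \<omega>) n in w (- D) / (w D + w (- D)))" for n
      using step_left[of n] by (simp add: history drift Let_def add.commute)
    have "{\<omega> \<in> space M. - X (Suc n) \<omega> = - X n \<omega> - 1} = {\<omega> \<in> space M. X (Suc n) \<omega> = X n \<omega> + 1}" for n by auto
    then show "AE \<omega> in M. real_cond_exp M (history M (\<lambda>n \<omega>. - X n \<omega>) n)
         (indicat_real {\<omega> \<in> space M. - X (Suc n) \<omega> = - X n \<omega> - 1}) \<omega> =
        (let D = local_drift (\<lambda>j. - X j \<omega>) n in w D / (w D + w (- D)))" for n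
      using step_right[of n] by (simp add: history drift Let_def add.commute)
  qed (rule weight)
qed

lemma geometric_time:
  fixes \<theta> :: "'a \<Rightarrow> nat"
  assumes r: "0 < r"
    and geometric: "\<And>n. measure M {\<omega> \<in> space M. \<theta> \<omega> = n} = (1 - exp (- r)) * exp (- r * real n)"
    and indep: "indep_set (sets (vimage_algebra (space M) \<theta> (count_space UNIV)))
        (sets (vimage_algebra (space M) (\<lambda>\<omega> i. X i \<omega>) (\<Pi>\<^sub>M i\<in>UNIV. count_space UNIV)))"
  shows "measure M {\<omega> \<in> space M. X (\<theta> \<omega>) \<omega> = c} = (1 - exp (- r)) *
     enn2real (\<integral>\<^sup>+n. ennreal (exp (- r * real n)) * emeasure M {\<omega> \<in> space M. X n \<omega> = c} \<partial>count_space UNIV)"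
proof -
  let ?T = "\<lambda>n. {\<omega> \<in> space M. \<theta> \<omega> = n}" and ?X = "\<lambda>n. {\<omega> \<in> space M. X n \<omega> = c}"
  have T: "?T n \<in> sets (vimage_algebra (space M) \<theta> (count_space UNIV))" for n
    using in_vimage_algebra[of "{n}" "count_space UNIV" \<theta> "space M"] by (simp add: vimage_def Int_def conj_commute)
  have Xn: "?X n \<in> sets (vimage_algebra (space M) (\<lambda>\<omega> i. X i \<omega>) (\<Pi>\<^sub>M i\<in>UNIV. count_space UNIV))" for n
  proof -
    have "{f \<in> space (\<Pi>\<^sub>M i\<in>(UNIV :: nat set). count_space (UNIV :: int set)). f n = c} \<in> sets (\<Pi>\<^sub>M i\<in>UNIV. count_space UNIV)"
      by measurable
    from in_vimage_algebra[OF this, of "\<lambda>\<omega> i. X i \<omega>" "space M"] show ?thesis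
      by (simp add: vimage_def Int_def conj_commute space_PiM)
  qed
  have sets [measurable]: "?T n \<in> sets M" for n using indep_setD_ev1[OF indep] T by blast
  have inter: "emeasure M (?T n \<inter> ?X n) = ennreal (1 - exp (- r)) * (ennreal (exp (- r * real n)) * emeasure M (?X n))" for n
    using indep_setD[OF indep T[of n] Xn[of n]] r
    by (simp add: emeasure_eq_measure geometric ennreal_mult'[symmetric] mult.assoc)
  have "emeasure M {\<omega> \<in> space M. X (\<theta> \<omega>) \<omega> = c} = emeasure M (\<Union>n\<in>UNIV. ?T n \<inter> ?X n)"
    by (rule arg_cong[where f = "emeasure M"]) auto
  also have "\<dots> = (\<integral>\<^sup>+n. emeasure M (?T n \<inter> ?X n) \<partial>count_space UNIV)"
    by (rule emeasure_UN_countable) (auto simp: disjoint_family_on_def)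
  also have "\<dots> = ennreal (1 - exp (- r)) * (\<integral>\<^sup>+n. ennreal (exp (- r * real n)) * emeasure M (?X n) \<partial>count_space UNIV)"
    unfolding inter by (rule nn_integral_cmult) auto
  finally show ?thesis
    using r by (simp add: measure_def enn2real_mult)
qed

end

theorem theorem2:
  fixes M :: "'a measure" and w :: "int \<Rightarrow> real" and X :: "nat \<Rightarrow> 'a \<Rightarrow> int"
    and s :: real and \<theta> :: "real \<Rightarrow> 'a \<Rightarrow> nat"
  assumes walk: "self_repelling_walk M w X"
    and s: "0 < s"
    and geometric: "\<And>A n. 0 < A \<Longrightarrow>
      measure M {\<omega> \<in> space M. \<theta> (s / A) \<omega> = n} = (1 - exp (- s / A)) * exp (- s * real n / A)"
    and indep: "\<And>A. 0 < A \<Longrightarrow>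
      prob_space.indep_set M
        (sets (vimage_algebra (space M) (\<theta> (s / A)) (count_space UNIV)))
        (sets (vimage_algebra (space M) (\<lambda>\<omega> i. X i \<omega>) (\<Pi>\<^sub>M i\<in>UNIV. count_space UNIV)))"
  shows "(AE x in lborel.
      ((\<lambda>A. sqrt A * measure M {\<omega> \<in> space M. X (\<theta> (s / A) \<omega>) \<omega> = \<lfloor>sqrt A * x\<rfloor>})
        \<longlongrightarrow> phi_hat s x) at_top) \<and>
    (\<forall>x. phi_hat s x = sqrt (s * pi) * (1 - std_normal_cdf (sqrt (2 * s) * \<bar>x\<bar>)))"
proof -
  interpret self_repelling_walk M w X by (rule walk)
  interpret reflected: self_repelling_walk M w "\<lambda>n \<omega>. - X n \<omega>" by (rule reflected_walk)
  have pos: "\<forall>\<^sub>F A in at_top. 0 < (A::real)" by (rule eventually_gt_at_top)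
  have law: "measure M {\<omega> \<in> space M. X (\<theta> (s / A) \<omega>) \<omega> = c} = (1 - exp (- s / A)) *
      enn2real (\<integral>\<^sup>+n. ennreal (exp (- (s / A) * real n)) * emeasure M {\<omega> \<in> space M. X n \<omega> = c} \<partial>count_space UNIV)"
    if "0 < A" for A c
    using geometric_time[of "s / A" "\<theta> (s / A)" c] geometric[OF that] indep[OF that] s that by simp
  have "((\<lambda>A. sqrt A * measure M {\<omega> \<in> space M. X (\<theta> (s / A) \<omega>) \<omega> = \<lfloor>sqrt A * x\<rfloor>}) \<longlongrightarrow> phi_hat s x) at_top" for x
  proof (cases "0 \<le> x")
    case True
    have "((\<lambda>A. sqrt A * ((1 - exp (- s / A)) * enn2real (resolvent (s / A) (nat \<lfloor>sqrt A * x\<rfloor>)))) \<longlongrightarrow> phi_hat s x) at_top"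
      using resolvent_limit[OF s floor_scaling[OF True]] True by (simp add: phi_hat_eq_gauss_tail)
    then show ?thesis
    proof (rule Lim_transform_eventually)
      show "\<forall>\<^sub>F A in at_top. sqrt A * ((1 - exp (- s / A)) * enn2real (resolvent (s / A) (nat \<lfloor>sqrt A * x\<rfloor>)))
          = sqrt A * measure M {\<omega> \<in> space M. X (\<theta> (s / A) \<omega>) \<omega> = \<lfloor>sqrt A * x\<rfloor>}"
        using pos
      proof eventually_elim
        case (elim A)
        have "int (nat \<lfloor>sqrt A * x\<rfloor>) = \<lfloor>sqrt A * x\<rfloor>" using True elim by simp
        then show ?case by (simp only: law[OF elim] resolvent_def)
      qed
    qed
  next
    case False
    let ?k = "\<lambda>A. nat \<lceil>sqrt A * (- x)\<rceil>"
    have k: "((\<lambda>A. real (?k A) / sqrt A) \<longlongrightarrow> - x) at_top"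
    proof (rule tendsto_sandwich)
      have cl: "sqrt A * (- x) \<le> real (?k A)" "real (?k A) \<le> sqrt A * (- x) + 1" if "0 < A" for A
      proof -
        have "0 \<le> sqrt A * (- x)" using False that by (intro mult_nonneg_nonneg) auto
        then show "sqrt A * (- x) \<le> real (?k A)" "real (?k A) \<le> sqrt A * (- x) + 1" by linarith+
      qed
      show "\<forall>\<^sub>F A in at_top. - x \<le> real (?k A) / sqrt A"
        using pos
      proof eventually_elim
        case (elim A)
        then show ?case using divide_right_mono[OF cl(1)[OF elim], of "sqrt A"] by simp
      qed
      show "\<forall>\<^sub>F A in at_top. real (?k A) / sqrt A \<le> - x + 1 / sqrt A"
        using pos
      proof eventually_elim
        case (elim A)
        then show ?case using divide_right_mono[OF cl(2)[OF elim], of "sqrt A"] elim by (simp add: add_divide_distrib diff_divide_distrib)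
      qed
      show "((\<lambda>A. - x + 1 / sqrt A) \<longlongrightarrow> - x) at_top"
        using tendsto_add[OF tendsto_const[of "- x"] inverse_sqrt_tendsto_0[of 1]] by simp
    qed simp
    have "((\<lambda>A. sqrt A * ((1 - exp (- s / A)) * enn2real (reflected.resolvent (s / A) (?k A)))) \<longlongrightarrow> phi_hat s x) at_top"
      using reflected.resolvent_limit[OF s k] False by (simp add: phi_hat_eq_gauss_tail)
    then show ?thesis
    proof (rule Lim_transform_eventually)
      show "\<forall>\<^sub>F A in at_top. sqrt A * ((1 - exp (- s / A)) * enn2real (reflected.resolvent (s / A) (?k A)))
          = sqrt A * measure M {\<omega> \<in> space M. X (\<theta> (s / A) \<omega>) \<omega> = \<lfloor>sqrt A * x\<rfloor>}"
        using pos
      proof eventually_elim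
        case (elim A)
        have "0 \<le> sqrt A * (- x)" using False elim by (intro mult_nonneg_nonneg) auto
        then have "int (?k A) = - \<lfloor>sqrt A * x\<rfloor>" by (simp add: ceiling_def)
        then have "{\<omega> \<in> space M. - X n \<omega> = int (?k A)} = {\<omega> \<in> space M. X n \<omega> = \<lfloor>sqrt A * x\<rfloor>}" for n by auto
        then show ?case by (simp only: law[OF elim] reflected.resolvent_def)
      qed
    qed
  qed
  then show ?thesis using phi_hat_closed_form[OF s] by simp
qed

end
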